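(* Let $\alpha\in(2,3)$. The functional $E^{(\alpha)}$ is continuously (Fréchet) differentiable on the open subset of $H^{(1+\alpha)/2,2}(\mathbb R/\mathbb Z,\mathbb R^n)$ consisting of all injective regular curves. Moreover, if such a curve $\gamma$ is parametrized by arc-length (i.e. $|\gamma'|\equiv 1$), then for every $h\in H^{(1+\alpha)/2,2}(\mathbb R/\mathbb Z,\mathbb R^n)$ the derivative of $E^{(\alpha)}$ at $\gamma$ in direction $h$ is $$\delta E^{(\alpha)}(\gamma;h)=\lim_{\varepsilon\searrow 0}\iint_{U_\varepsilon}\Big((\alpha-2)\frac{\langle\gamma'(u),h'(u)\rangle}{|w|^\alpha}+2\frac{\langle\gamma'(u),h'(u)\rangle}{|\gamma(u+w)-\gamma(u)|^\alpha}-\alpha\frac{\langle\gamma(u+w)-\gamma(u),h(u+w)-h(u)\rangle}{|\gamma(u+w)-\gamma(u)|^{\alpha+2}}\Big)\,dw\,du,$$ where the limit exists.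
   Context: For $\gamma\in C^{0,1}(\mathbb R/\mathbb Z,\mathbb R^n)$ let $\mathscr L(\gamma)=\int_0^1|\gamma'(\theta)|d\theta$ and, for $|w|\le 1/2$, $d_\gamma(u+w,u)=\min\{\mathscr L(\gamma|_{[u,u+w]}),\mathscr L(\gamma)-\mathscr L(\gamma|_{[u,u+w]})\}$ (intrinsic distance on the curve). O'Hara's energy is $$E^{(\alpha)}(\gamma)=\int_{\mathbb R/\mathbb Z}\int_{-1/2}^{1/2}\Big(\frac1{|\gamma(u+w)-\gamma(u)|^\alpha}-\frac1{d_\gamma(u+w,u)^\alpha}\Big)|\gamma'(u+w)||\gamma'(u)|\,dw\,du\in[0,\infty].$$ $H^{s,p}(\mathbb R/\mathbb Z,\mathbb R^n)=(\mathrm{id}-\Delta)^{-s/2}L^p$ denotes the Bessel potential (fractional Sobolev) space; for $p=2$, $s=k+\sigma$, $k\in\mathbb N_0$, $\sigma\in(0,1)$, its norm is equivalent to $\|f\|_{H^{k,2}}+\big(\int_{\mathbb R/\mathbb Z}\int_{-1/2}^{1/2}\frac{|f^{(k)}(u+w)-f^{(k)}(u)|^2}{|w|^{1+2\sigma}}dw\,du\big)^{1/2}$. A curve $\gamma\in C^1$ is regular if $\gamma'(u)\neq0$ for all $u$, and injective if it is injective on $\mathbb R/\mathbb Z$. For $\varepsilon>0$, $U_\varepsilon=\mathbb R/\mathbb Z\times([-\tfrac12,-\varepsilon]\cup[\varepsilon,\tfrac12])$. *)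

theory Defs
  imports "HOL-Analysis.Analysis"
begin

text \<open>Closed curves on R/Z are represented as 1-periodic functions real => real^'n.\<close>

definition periodic1 :: "(real \<Rightarrow> 'a) \<Rightarrow> bool" where
  "periodic1 f \<longleftrightarrow> (\<forall>x. f (x + 1) = f x)"

definition weak_deriv :: "(real \<Rightarrow> real^'n) \<Rightarrow> (real \<Rightarrow> real^'n) \<Rightarrow> bool" where
  "weak_deriv f g \<longleftrightarrow> periodic1 g \<and> g \<in> borel_measurable lborel \<and>
     (\<forall>a b. a \<le> b \<longrightarrow> set_integrable lborel {a..b} g \<and>
            f b - f a = set_lebesgue_integral lborel {a..b} g) \<and>
     set_nn_integral lborel {0..1} (\<lambda>x. ennreal ((norm (g x))\<^sup>2)) < \<infinity>"

definition gagliardo :: "real \<Rightarrow> (real \<Rightarrow> real^'n) \<Rightarrow> ennreal" where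
  "gagliardo \<sigma> g = set_nn_integral lborel {0..1} (\<lambda>u.
      set_nn_integral lborel {-1/2..1/2} (\<lambda>w.
        ennreal ((norm (g (u + w) - g u))\<^sup>2 / \<bar>w\<bar> powr (1 + 2 * \<sigma>))))"

text \<open>Hsob sigma f: f belongs to H^{1+sigma,2}(R/Z,R^n), for 0 < sigma < 1.\<close>
definition Hsob :: "real \<Rightarrow> (real \<Rightarrow> real^'n) \<Rightarrow> bool" where
  "Hsob \<sigma> f \<longleftrightarrow> periodic1 f \<and> (\<exists>g. weak_deriv f g \<and> gagliardo \<sigma> g < \<infinity>)"

text \<open>A norm equivalent to the H^{1+sigma,2} norm.\<close>
definition Hnorm :: "real \<Rightarrow> (real \<Rightarrow> real^'n) \<Rightarrow> real" where
  "Hnorm \<sigma> f = (let g = (SOME g. weak_deriv f g) in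
      sqrt (set_lebesgue_integral lborel {0..1} (\<lambda>x. (norm (f x))\<^sup>2))
    + sqrt (set_lebesgue_integral lborel {0..1} (\<lambda>x. (norm (g x))\<^sup>2))
    + sqrt (enn2real (gagliardo \<sigma> g)))"

definition C1_curve :: "(real \<Rightarrow> real^'n) \<Rightarrow> bool" where
  "C1_curve \<gamma> \<longleftrightarrow> (\<forall>u. \<gamma> differentiable (at u)) \<and>
     continuous_on UNIV (\<lambda>u. vector_derivative \<gamma> (at u))"

definition regular_curve :: "(real \<Rightarrow> real^'n) \<Rightarrow> bool" where
  "regular_curve \<gamma> \<longleftrightarrow> C1_curve \<gamma> \<and> (\<forall>u. vector_derivative \<gamma> (at u) \<noteq> 0)"

definition injective_RZ :: "(real \<Rightarrow> real^'n) \<Rightarrow> bool" where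
  "injective_RZ \<gamma> \<longleftrightarrow> (\<forall>u v. \<gamma> u = \<gamma> v \<longrightarrow> u - v \<in> \<int>)"

definition curve_length :: "(real \<Rightarrow> real^'n) \<Rightarrow> real" where
  "curve_length \<gamma> = integral {0..1} (\<lambda>t. norm (vector_derivative \<gamma> (at t)))"

definition arc_length :: "(real \<Rightarrow> real^'n) \<Rightarrow> real \<Rightarrow> real \<Rightarrow> real" where
  "arc_length \<gamma> u w = integral {min u (u + w)..max u (u + w)} (\<lambda>t. norm (vector_derivative \<gamma> (at t)))"

definition intr_dist :: "(real \<Rightarrow> real^'n) \<Rightarrow> real \<Rightarrow> real \<Rightarrow> real" where
  "intr_dist \<gamma> u w = min (arc_length \<gamma> u w) (curve_length \<gamma> - arc_length \<gamma> u w)"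

text \<open>Integrand of O'Hara's energy; value infinity where gamma(u+w) = gamma(u)
  (1/0^alpha = infinity).\<close>
definition ohara_integrand :: "real \<Rightarrow> (real \<Rightarrow> real^'n) \<Rightarrow> real \<Rightarrow> real \<Rightarrow> ennreal" where
  "ohara_integrand \<alpha> \<gamma> u w =
     (if \<gamma> (u + w) = \<gamma> u then \<infinity>
      else ennreal ((norm (\<gamma> (u + w) - \<gamma> u) powr (-\<alpha>) - intr_dist \<gamma> u w powr (-\<alpha>))
                    * norm (vector_derivative \<gamma> (at (u + w))) * norm (vector_derivative \<gamma> (at u))))"

definition OHara :: "real \<Rightarrow> (real \<Rightarrow> real^'n) \<Rightarrow> ennreal" where
  "OHara \<alpha> \<gamma> = set_nn_integral lborel {0..1} (\<lambda>u.
      set_nn_integral lborel {-1/2..1/2} (\<lambda>w. ohara_integrand \<alpha> \<gamma> u w))"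

definition dE_integrand :: "real \<Rightarrow> (real \<Rightarrow> real^'n) \<Rightarrow> (real \<Rightarrow> real^'n) \<Rightarrow> real \<Rightarrow> real \<Rightarrow> real" where
  "dE_integrand \<alpha> \<gamma> h u w =
    (let dg = vector_derivative \<gamma> (at u); dh = vector_derivative h (at u);
         D = \<gamma> (u + w) - \<gamma> u; Dh = h (u + w) - h u in
      (\<alpha> - 2) * (dg \<bullet> dh) / \<bar>w\<bar> powr \<alpha>
      + 2 * (dg \<bullet> dh) / norm D powr \<alpha>
      - \<alpha> * (D \<bullet> Dh) / norm D powr (\<alpha> + 2))"

definition Ieps :: "real \<Rightarrow> (real \<Rightarrow> real^'n) \<Rightarrow> (real \<Rightarrow> real^'n) \<Rightarrow> real \<Rightarrow> real" where
  "Ieps \<alpha> \<gamma> h \<epsilon> = set_lebesgue_integral lborel {0..1} (\<lambda>u.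
      set_lebesgue_integral lborel ({-1/2..-\<epsilon>} \<union> {\<epsilon>..1/2}) (\<lambda>w. dE_integrand \<alpha> \<gamma> h u w))"

definition admissible :: "real \<Rightarrow> (real \<Rightarrow> real^'n) \<Rightarrow> bool" where
  "admissible \<sigma> \<gamma> \<longleftrightarrow> Hsob \<sigma> \<gamma> \<and> regular_curve \<gamma> \<and> injective_RZ \<gamma>"

end

theory Submission
  imports Defs
begin

text \<open>
  Write \<open>g\<close> for the velocity of a curve. For each base point \<open>u\<close> the integral over \<open>w\<close> of \<open>d powr (-\<alpha>) - A powr (-\<alpha>)\<close>
  against the speed at \<open>u + w\<close>, where \<open>d\<close> is the intrinsic distance and \<open>A\<close> the length of the arc from \<open>u\<close> to \<open>u + w\<close>,
  has an explicit antiderivative. Hence the energy is the double integral of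
  \<open>\<bar>w\<bar> powr (-\<alpha>) * Phi (g restricted to [u, u + w])\<close> minus a single integral that is smooth in the \<open>C\<^sup>1\<close> topology,
  and the kink of the minimum in \<open>d\<close> disappears.

  The difference between the length of an arc and its chord, and all its derivatives in \<open>g\<close>, are quadratic in increments of \<open>g\<close>
  and of the directions, so \<open>Phi\<close>, its derivative \<open>Psi\<close>, and the differences of \<open>Psi\<close> at nearby curves are bounded by
  mean squares of increments. Integrated against \<open>\<bar>w\<bar> powr (-\<alpha>)\<close> these are controlled by the Gagliardo seminorm. The mean value
  theorem applied for each \<open>(u, w)\<close> then gives Frechet differentiability, and the bound on differences of \<open>Psi\<close> continuity
  of the derivative. Since \<open>\<alpha> > 2\<close>, the Sobolev norm controls the \<open>C\<^sup>1\<close> norm.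

  For an arc length parametrization, the integrand of the claimed formula differs from \<open>\<bar>w\<bar> powr (-\<alpha>) * Psi\<close> only by terms
  whose integral over \<open>\<bar>w\<bar> \<ge> \<epsilon>\<close> vanishes by translation in \<open>u\<close> and reflection in \<open>w\<close>.
\<close>

section \<open>Uniform Lipschitz families\<close>

text \<open>Chord and arc length each contribute terms of size
  \<open>\<bar>w\<bar> powr (-\<alpha>)\<close>, which are integrable only in combination. Every
  functional is therefore rewritten until it contains nothing but defects, such as length minus
  chord, and this form has to survive both differentiation and the comparison of two curves. That is
  why values and differences are estimated together.

  The points where the intrinsic distance fails to be differentiable move with the curve, so a
  pointwise treatment in \<open>w\<close> would not do; but they stay away from
  \<open>w = 0\<close>, where the singularity sits, and the two difficulties can be separated.

  Closeness in the Sobolev norm enters by treating \<open>(p' - p) / \<nu>\<close> as one more path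
  whose increments are counted. After this scaling, and that of the direction by its own size, all
  constants depend only on a lower bound for chords and speeds and an upper bound for speeds. A
  single Lipschitz estimate for \<open>Psi\<close> then yields the quadratic Frechet remainder as
  well as the continuity of the derivative.\<close>

text \<open>The values \<open>X i False\<close> and \<open>X i True\<close> are of order \<open>z i\<close> and their difference is of order \<open>\<nu> i * z i\<close>,
  with one constant for all \<open>i \<in> S\<close>. Such families multiply like orders of magnitude, which replaces estimates
  of second derivatives: every quantity below is assembled from a few of them by products.\<close>

definition lip_family ::
    "'i set \<Rightarrow> ('i \<Rightarrow> real) \<Rightarrow> ('i \<Rightarrow> real) \<Rightarrow> ('i \<Rightarrow> bool \<Rightarrow> 'a::real_normed_vector) \<Rightarrow> bool" where
  "lip_family S \<nu> z X \<longleftrightarrow> (\<exists>C\<ge>0. \<forall>i\<in>S. 0 \<le> \<nu> i \<and> 0 \<le> z i \<and>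
     (\<forall>t. norm (X i t) \<le> C * z i) \<and> norm (X i True - X i False) \<le> C * (\<nu> i * z i))"

lemma lip_familyI:
  assumes "C \<ge> 0" "\<And>i. i \<in> S \<Longrightarrow> 0 \<le> \<nu> i" "\<And>i. i \<in> S \<Longrightarrow> 0 \<le> z i"
    and "\<And>i t. i \<in> S \<Longrightarrow> norm (X i t) \<le> C * z i"
    and "\<And>i. i \<in> S \<Longrightarrow> norm (X i True - X i False) \<le> C * (\<nu> i * z i)"
  shows "lip_family S \<nu> z X"
  using assms unfolding lip_family_def by blast

lemma lip_familyE:
  assumes "lip_family S \<nu> z X"
  obtains C where "C \<ge> 0" "\<And>i. i \<in> S \<Longrightarrow> 0 \<le> \<nu> i" "\<And>i. i \<in> S \<Longrightarrow> 0 \<le> z i"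
    "\<And>i t. i \<in> S \<Longrightarrow> norm (X i t) \<le> C * z i"
    "\<And>i. i \<in> S \<Longrightarrow> norm (X i True - X i False) \<le> C * (\<nu> i * z i)"
  using assms unfolding lip_family_def by blast

lemma lip_family_cong:
  assumes "lip_family S \<nu> z X" "\<And>i t. i \<in> S \<Longrightarrow> X i t = Y i t"
  shows "lip_family S \<nu> z Y"
  using assms unfolding lip_family_def by metis

lemma lip_family_add:
  assumes "lip_family S \<nu> z X" "lip_family S \<nu> z Y"
  shows "lip_family S \<nu> z (\<lambda>i t. X i t + Y i t)"
proof -
  from assms(1) obtain C where C: "C \<ge> 0" "\<And>i. i \<in> S \<Longrightarrow> 0 \<le> \<nu> i" "\<And>i. i \<in> S \<Longrightarrow> 0 \<le> z i"
    "\<And>i t. i \<in> S \<Longrightarrow> norm (X i t) \<le> C * z i"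
    "\<And>i. i \<in> S \<Longrightarrow> norm (X i True - X i False) \<le> C * (\<nu> i * z i)"
    by (rule lip_familyE) blast
  from assms(2) obtain D where D: "D \<ge> 0"
    "\<And>i t. i \<in> S \<Longrightarrow> norm (Y i t) \<le> D * z i"
    "\<And>i. i \<in> S \<Longrightarrow> norm (Y i True - Y i False) \<le> D * (\<nu> i * z i)"
    by (rule lip_familyE) blast
  show ?thesis
  proof (rule lip_familyI[where C="C + D"])
    fix i t assume i: "i \<in> S"
    show "norm (X i t + Y i t) \<le> (C + D) * z i"
      using norm_triangle_ineq[of "X i t" "Y i t"] C(4)[OF i, of t] D(2)[OF i, of t]
      by (simp add: distrib_right)
    have "norm (X i True + Y i True - (X i False + Y i False))
       \<le> norm (X i True - X i False) + norm (Y i True - Y i False)"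
      by (metis add_diff_add norm_triangle_ineq)
    then show "norm (X i True + Y i True - (X i False + Y i False)) \<le> (C + D) * (\<nu> i * z i)"
      using C(5)[OF i] D(3)[OF i] by (simp add: distrib_right)
  qed (use C D in auto)
qed

text \<open>A discrete Leibniz rule: one factor is changed at a time, so \<open>\<nu>\<close>
  appears once while the sizes multiply. The factor 2 counts the two resulting terms.\<close>

lemma (in bounded_bilinear) lip_family:
  assumes "lip_family S \<nu> z X" "lip_family S \<nu> z' Y"
  shows "lip_family S \<nu> (\<lambda>i. z i * z' i) (\<lambda>i t. prod (X i t) (Y i t))"
proof -
  from assms(1) obtain C where C: "C \<ge> 0" "\<And>i. i \<in> S \<Longrightarrow> 0 \<le> \<nu> i" "\<And>i. i \<in> S \<Longrightarrow> 0 \<le> z i"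
    "\<And>i t. i \<in> S \<Longrightarrow> norm (X i t) \<le> C * z i"
    "\<And>i. i \<in> S \<Longrightarrow> norm (X i True - X i False) \<le> C * (\<nu> i * z i)"
    by (rule lip_familyE) blast
  from assms(2) obtain D where D: "D \<ge> 0" "\<And>i. i \<in> S \<Longrightarrow> 0 \<le> z' i"
    "\<And>i t. i \<in> S \<Longrightarrow> norm (Y i t) \<le> D * z' i"
    "\<And>i. i \<in> S \<Longrightarrow> norm (Y i True - Y i False) \<le> D * (\<nu> i * z' i)"
    by (rule lip_familyE) blast
  obtain K where K: "K > 0" "\<And>a b. norm (prod a b) \<le> norm a * norm b * K"
    using pos_bounded by blast
  have P: "norm (prod a b) \<le> K * (p * q)" if "norm a \<le> p" "norm b \<le> q" for a b p q
  proof -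
    have "norm a * norm b \<le> p * q"
      using that norm_ge_zero[of a] by (intro mult_mono) (auto intro: order_trans[OF norm_ge_zero])
    then have "norm a * norm b * K \<le> p * q * K"
      using K(1) by (intro mult_right_mono) auto
    then show ?thesis using K(2)[of a b] by (simp add: mult_ac)
  qed
  show ?thesis
  proof (rule lip_familyI[where C="2 * K * C * D"])
    fix i t assume i: "i \<in> S"
    have "K * ((C * z i) * (D * z' i)) \<le> 2 * (K * ((C * z i) * (D * z' i)))"
      using K C(1,3) D(1,2) i by simp
    then show "norm (prod (X i t) (Y i t)) \<le> 2 * K * C * D * (z i * z' i)"
      using P[OF C(4)[OF i, of t] D(3)[OF i, of t]] by (simp add: mult_ac)
    have "prod (X i True) (Y i True) - prod (X i False) (Y i False)
      = prod (X i True) (Y i True - Y i False) + prod (X i True - X i False) (Y i False)"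
      by (simp add: diff_left diff_right)
    then have "norm (prod (X i True) (Y i True) - prod (X i False) (Y i False))
      \<le> norm (prod (X i True) (Y i True - Y i False)) + norm (prod (X i True - X i False) (Y i False))"
      by (metis norm_triangle_ineq)
    then show "norm (prod (X i True) (Y i True) - prod (X i False) (Y i False))
         \<le> 2 * K * C * D * (\<nu> i * (z i * z' i))"
      using P[OF C(4)[OF i, of True] D(4)[OF i]] P[OF C(5)[OF i] D(3)[OF i, of False]]
      by (simp add: mult_ac)
  qed (use C D K in auto)
qed

lemmas lip_family_mult = bounded_bilinear.lip_family[OF bounded_bilinear_mult]
lemmas lip_family_scaleR = bounded_bilinear.lip_family[OF bounded_bilinear_scaleR]
lemmas lip_family_inner = bounded_bilinear.lip_family[OF bounded_bilinear_inner]

text \<open>In these names a \<open>0\<close> marks the position of the factor of order zero, that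
  is, of weight 1, which leaves the weight of the other factor unchanged.\<close>

lemmas lip_family_mult0 = lip_family_mult[where z'="\<lambda>_. 1", simplified]
lemmas lip_family_0mult = lip_family_mult[where z="\<lambda>_. 1", simplified]
lemmas lip_family_scaleR0 = lip_family_scaleR[where z'="\<lambda>_. 1", simplified]
lemmas lip_family_0scaleR = lip_family_scaleR[where z="\<lambda>_. 1", simplified]
lemmas lip_family_inner0 = lip_family_inner[where z'="\<lambda>_. 1", simplified]
lemmas lip_family_0inner = lip_family_inner[where z="\<lambda>_. 1", simplified]

text \<open>Meant for directions, which are common to both curves: the difference vanishes and only
  the size has to be checked.\<close>

lemma lip_family_indep:
  assumes "\<And>i. i \<in> S \<Longrightarrow> norm (X i) \<le> C * z i" "\<And>i. i \<in> S \<Longrightarrow> 0 \<le> \<nu> i" "\<And>i. i \<in> S \<Longrightarrow> 0 \<le> z i"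
  shows "lip_family S \<nu> z (\<lambda>i t. X i)"
proof (rule lip_familyI[where C="\<bar>C\<bar>"])
  fix i t assume i: "i \<in> S"
  have "C * z i \<le> \<bar>C\<bar> * z i" using assms(3)[OF i] by (intro mult_right_mono) auto
  then show "norm (X i) \<le> \<bar>C\<bar> * z i" using assms(1)[OF i] by linarith
qed (use assms in auto)

lemma lip_family_const:
  assumes "\<And>i. i \<in> S \<Longrightarrow> 0 \<le> \<nu> i"
  shows "lip_family S \<nu> (\<lambda>_. 1) (\<lambda>i t. c)"
  by (rule lip_family_indep[where C="norm c"]) (use assms in auto)

lemma lip_family_nu: "lip_family S \<nu> z X \<Longrightarrow> i \<in> S \<Longrightarrow> 0 \<le> \<nu> i"
  unfolding lip_family_def by blast

lemma lip_family_const':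
  assumes "lip_family S \<nu> z X"
  shows "lip_family S \<nu> (\<lambda>_. 1) (\<lambda>i t. c)"
  by (rule lip_family_const) (rule lip_family_nu[OF assms])

lemma lip_family_cmult:
  fixes X :: "'i \<Rightarrow> bool \<Rightarrow> real"
  assumes "lip_family S \<nu> z X"
  shows "lip_family S \<nu> z (\<lambda>i t. c * X i t)"
  by (rule lip_family_0mult[OF lip_family_const'[OF assms] assms])

lemma lip_family_diff:
  assumes "lip_family S \<nu> z X" "lip_family S \<nu> z Y"
  shows "lip_family S \<nu> z (\<lambda>i t. X i t - Y i t)"
proof -
  have "lip_family S \<nu> z (\<lambda>i t. (-1) *\<^sub>R Y i t)"
    by (rule lip_family_0scaleR[OF lip_family_const'[OF assms(2)] assms(2)])
  from lip_family_add[OF assms(1) this] show ?thesis by simp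
qed

lemma lip_family_norm:
  assumes "lip_family S \<nu> z X"
  shows "lip_family S \<nu> z (\<lambda>i t. norm (X i t))"
proof -
  have "\<bar>norm (X i True) - norm (X i False)\<bar> \<le> norm (X i True - X i False)" for i
    by (rule norm_triangle_ineq3)
  then show ?thesis using assms unfolding lip_family_def
    by simp (meson order_trans)
qed

section \<open>Powers of families bounded away from zero\<close>

lemma powr_lipschitz:
  fixes x y :: real
  assumes "0 < c" "c \<le> x" "c \<le> y" "x \<le> B" "y \<le> B"
  shows "\<bar>y powr a - x powr a\<bar> \<le> \<bar>a\<bar> * (c powr (a - 1) + B powr (a - 1)) * \<bar>y - x\<bar>"
proof -
  have "norm (y powr a - x powr a) \<le> (\<bar>a\<bar> * (c powr (a - 1) + B powr (a - 1))) * norm (y - x)"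
  proof (rule field_differentiable_bound[where S="{c..B}" and f'="\<lambda>x. a * x powr (a - 1)"])
    fix z assume z: "z \<in> {c..B}"
    show "((\<lambda>x. x powr a) has_real_derivative a * z powr (a - 1)) (at z within {c..B})"
      using z assms by (auto intro!: derivative_eq_intros)
    \<comment> \<open>The power is increasing or decreasing according to the sign of
      \<open>a - 1\<close>; the sum of the two endpoint values is a bound in either case.\<close>
    have "z powr (a - 1) \<le> c powr (a - 1) + B powr (a - 1)"
    proof (cases "a \<ge> 1")
      case True
      then have "z powr (a - 1) \<le> B powr (a - 1)" using z assms by (intro powr_mono2) auto
      then show ?thesis by (smt (verit) powr_ge_zero)
    next
      case False
      then have "z powr (a - 1) \<le> c powr (a - 1)" using z assms by (intro powr_mono2') auto
      then show ?thesis by (smt (verit) powr_ge_zero)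
    qed
    then show "norm (a * z powr (a - 1)) \<le> \<bar>a\<bar> * (c powr (a - 1) + B powr (a - 1))"
      by (simp add: abs_mult mult_left_mono)
  qed (use assms in auto)
  then show ?thesis by simp
qed

lemma lip_family_powr:
  fixes X :: "'i \<Rightarrow> bool \<Rightarrow> real"
  assumes "lip_family S \<nu> (\<lambda>_. 1) X" "c > 0" "\<And>i t. i \<in> S \<Longrightarrow> c \<le> X i t"
  shows "lip_family S \<nu> (\<lambda>_. 1) (\<lambda>i t. X i t powr a)"
proof -
  from assms(1) obtain C where C: "C \<ge> 0" "\<And>i. i \<in> S \<Longrightarrow> 0 \<le> \<nu> i"
    "\<And>i t. i \<in> S \<Longrightarrow> norm (X i t) \<le> C * 1"
    "\<And>i. i \<in> S \<Longrightarrow> norm (X i True - X i False) \<le> C * (\<nu> i * 1)"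
    by (rule lip_familyE) blast
  \<comment> \<open>Weight 1 means bounded, so the family supplies its own upper bound
    \<open>C\<close>; together with \<open>c\<close> it confines the arguments to a compact interval
    on which the power is Lipschitz.\<close>
  have X: "X i t \<le> C" if "i \<in> S" for i t using C(3)[OF that, of t] by auto
  define L where "L = \<bar>a\<bar> * (c powr (a - 1) + C powr (a - 1))"
  define M where "M = c powr a + C powr a"
  have L0: "L \<ge> 0" "M \<ge> 0" by (auto simp: L_def M_def)
  show ?thesis
  proof (rule lip_familyI[where C="M + L * C"])
    fix i t assume i: "i \<in> S"
    have "X i t powr a \<le> M"
    proof (cases "a \<ge> 0")
      case True
      then have "X i t powr a \<le> C powr a" using X[OF i] assms(2) assms(3)[OF i]
        by (intro powr_mono2) (auto intro: order_trans[OF less_imp_le])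
      then show ?thesis unfolding M_def by (smt (verit) powr_ge_zero)
    next
      case False
      then have "X i t powr a \<le> c powr a" using X[OF i] assms(2) assms(3)[OF i]
        by (intro powr_mono2') auto
      then show ?thesis unfolding M_def by (smt (verit) powr_ge_zero)
    qed
    then show "norm (X i t powr a) \<le> (M + L * C) * 1" using L0 C(1) by (simp add: add_increasing2)
    have "\<bar>X i True powr a - X i False powr a\<bar> \<le> L * \<bar>X i True - X i False\<bar>"
      unfolding L_def by (rule powr_lipschitz) (use X assms i in auto)
    also have "\<dots> \<le> L * (C * \<nu> i)" using C(4)[OF i] L0 by (intro mult_left_mono) auto
    also have "\<dots> \<le> (M + L * C) * (\<nu> i * 1)" using L0 C(2)[OF i] by (simp add: algebra_simps)
    finally show "norm (X i True powr a - X i False powr a) \<le> (M + L * C) * (\<nu> i * 1)" by simp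
  qed (use C L0 in auto)
qed

lemma lip_family_inverse:
  fixes X :: "'i \<Rightarrow> bool \<Rightarrow> real"
  assumes "lip_family S \<nu> (\<lambda>_. 1) X" "c > 0" "\<And>i t. i \<in> S \<Longrightarrow> c \<le> X i t"
  shows "lip_family S \<nu> (\<lambda>_. 1) (\<lambda>i t. inverse (X i t))"
proof (rule lip_family_cong[OF lip_family_powr[OF assms, of "-1"]])
  fix i t assume "i \<in> S"
  from less_le_trans[OF assms(2) assms(3)[OF this]] have "X i t > 0" .
  then show "X i t powr - 1 = inverse (X i t)" by (simp add: powr_minus)
qed

lemma lip_family_lift:
  assumes "lip_family S \<nu> z X"
  shows "lip_family (S \<times> T) (\<lambda>x. \<nu> (fst x)) (\<lambda>x. z (fst x)) (\<lambda>x t. X (fst x) t)"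
proof -
  from assms obtain C where "C \<ge> 0" "\<forall>i\<in>S. 0 \<le> \<nu> i \<and> 0 \<le> z i \<and>
     (\<forall>t. norm (X i t) \<le> C * z i) \<and> norm (X i True - X i False) \<le> C * (\<nu> i * z i)"
    unfolding lip_family_def by (elim exE conjE) (rule that)
  then show ?thesis unfolding lip_family_def by (intro exI[of _ C]) auto
qed

text \<open>Integration in \<open>s\<close> acts on values, differences and weights alike. With a
  squared increment as weight, this turns pointwise products of two increments into mean
  squares.\<close>

lemma lip_family_integral:
  fixes X :: "'i \<times> real \<Rightarrow> bool \<Rightarrow> 'a::banach"
  assumes "lip_family (S \<times> {0..1}) (\<lambda>x. \<nu> (fst x)) z X"
    and cX: "\<And>i t. i \<in> S \<Longrightarrow> continuous_on {0..1} (\<lambda>s. X (i, s) t)"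
    and cz: "\<And>i. i \<in> S \<Longrightarrow> continuous_on {0..1} (\<lambda>s. z (i, s))"
  shows "lip_family S \<nu> (\<lambda>i. integral {0..1} (\<lambda>s. z (i, s)))
    (\<lambda>i t. integral {0..1} (\<lambda>s. X (i, s) t))"
proof -
  from assms(1) obtain C where C0: "C \<ge> 0"
    and *: "\<forall>i\<in>S \<times> {0..1}. 0 \<le> \<nu> (fst i) \<and> 0 \<le> z i \<and> (\<forall>t. norm (X i t) \<le> C * z i) \<and>
      norm (X i True - X i False) \<le> C * (\<nu> (fst i) * z i)"
    unfolding lip_family_def by (elim exE conjE) (rule that)
  have C: "C \<ge> 0" "0 \<le> \<nu> i" "0 \<le> z (i, s)" "norm (X (i, s) t) \<le> C * z (i, s)"
    "norm (X (i, s) True - X (i, s) False) \<le> C * (\<nu> i * z (i, s))" if "i \<in> S" "s \<in> {0..1}" for i s t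
    using bspec[OF *, of "(i, s)"] that C0 by simp_all
  show ?thesis
  proof (rule lip_familyI[where C=C])
    fix i t assume i: "i \<in> S"
    have zi: "(\<lambda>s. z (i,s)) integrable_on {0..1}" by (rule integrable_continuous_real[OF cz[OF i]])
    have czi: "(\<lambda>s. c * z (i,s)) integrable_on {0..1}" for c
      by (intro integrable_continuous_real continuous_intros cz i)
    have Xi: "(\<lambda>s. X (i,s) t) integrable_on {0..1}" for t by (rule integrable_continuous_real[OF cX[OF i]])
    show "0 \<le> \<nu> i" using C(2)[OF i, of 0] by simp
    show "0 \<le> integral {0..1} (\<lambda>s. z (i,s))" using C(3) i by (intro integral_nonneg zi) auto
    have "norm (integral {0..1} (\<lambda>s. X (i,s) t)) \<le> integral {0..1} (\<lambda>s. C * z (i,s))"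
      using C(4) i by (intro integral_norm_bound_integral Xi czi) auto
    then show "norm (integral {0..1} (\<lambda>s. X (i,s) t)) \<le> C * integral {0..1} (\<lambda>s. z (i,s))" by simp
    have "integral {0..1} (\<lambda>s. X (i,s) True) - integral {0..1} (\<lambda>s. X (i,s) False)
       = integral {0..1} (\<lambda>s. X (i,s) True - X (i,s) False)"
      by (rule integral_diff[symmetric]) (rule Xi)+
    also have "norm \<dots> \<le> integral {0..1} (\<lambda>s. C * \<nu> i * z (i,s))"
      using C(5) i by (intro integral_norm_bound_integral integrable_diff Xi czi) (auto simp: mult_ac)
    finally show "norm (integral {0..1} (\<lambda>s. X (i,s) True) - integral {0..1} (\<lambda>s. X (i,s) False))
       \<le> C * (\<nu> i * integral {0..1} (\<lambda>s. z (i,s)))" by (simp add: mult_ac)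
  qed (use C0 in auto)
qed

lemma lip_family_integral1:
  fixes X :: "'i \<times> real \<Rightarrow> bool \<Rightarrow> 'a::banach"
  assumes "lip_family (S \<times> {0..1}) (\<lambda>x. \<nu> (fst x)) (\<lambda>_. 1) X"
    and "\<And>i t. i \<in> S \<Longrightarrow> continuous_on {0..1} (\<lambda>s. X (i, s) t)"
  shows "lip_family S \<nu> (\<lambda>_. 1) (\<lambda>i t. integral {0..1} (\<lambda>s. X (i, s) t))"
  using lip_family_integral[OF assms] by simp

section \<open>Functionals of velocity paths\<close>

text \<open>For the velocity along the arc from \<open>u\<close> to \<open>u + w\<close> this is the
  increment of the curve divided by \<open>w\<close>, and \<open>plen\<close> is the arc length
  divided by \<open>\<bar>w\<bar>\<close>. In this scaling nothing degenerates as \<open>w\<close>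
  tends to 0.\<close>

definition pmean :: "(real \<Rightarrow> 'a::euclidean_space) \<Rightarrow> 'a" where
  "pmean p = integral {0..1} p"

definition plen :: "(real \<Rightarrow> 'a::euclidean_space) \<Rightarrow> real" where
  "plen p = integral {0..1} (\<lambda>s. norm (p s))"

definition dplen :: "(real \<Rightarrow> 'a::euclidean_space) \<Rightarrow> (real \<Rightarrow> 'a) \<Rightarrow> real" where
  "dplen p k = integral {0..1} (\<lambda>s. sgn (p s) \<bullet> k s)"

text \<open>If \<open>p\<close> is the velocity along the arc from \<open>u\<close> to \<open>u + w\<close>, rescaled to the unit interval, then \<open>\<bar>w\<bar> powr (-\<alpha>) * Phi \<alpha> p\<close>
  is the energy integrand in which the length of that arc replaces the intrinsic distance;
  \<open>Psi\<close> is the derivative of \<open>Phi\<close>.\<close>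

definition Phi :: "real \<Rightarrow> (real \<Rightarrow> 'a::euclidean_space) \<Rightarrow> real" where
  "Phi \<alpha> p = (norm (pmean p) powr (-\<alpha>) - plen p powr (-\<alpha>)) * (norm (p 1) * norm (p 0))"

definition Psi :: "real \<Rightarrow> (real \<Rightarrow> 'a::euclidean_space) \<Rightarrow> (real \<Rightarrow> 'a) \<Rightarrow> real" where
  "Psi \<alpha> p k =
     \<alpha> * (plen p powr (-\<alpha> - 1) * dplen p k
          - norm (pmean p) powr (-\<alpha> - 1) * (sgn (pmean p) \<bullet> pmean k)) * (norm (p 1) * norm (p 0))
     + (norm (pmean p) powr (-\<alpha>) - plen p powr (-\<alpha>))
       * (sgn (p 1) \<bullet> k 1 * norm (p 0) + norm (p 1) * (sgn (p 0) \<bullet> k 0))"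

lemma sgn_inner_self: "x \<noteq> 0 \<Longrightarrow> sgn x \<bullet> (x::'a::euclidean_space) = norm x"
  by (simp add: sgn_div_norm dot_square_norm power2_eq_square)

lemma continuous_on_sgn_path [continuous_intros]:
  fixes f :: "'b::topological_space \<Rightarrow> 'a::euclidean_space"
  assumes "continuous_on S f" "\<And>x. x \<in> S \<Longrightarrow> f x \<noteq> 0"
  shows "continuous_on S (\<lambda>x. sgn (f x))"
  using assms unfolding sgn_div_norm by (intro continuous_intros) auto

lemma norm_line_derivative:
  fixes x k :: "'a::euclidean_space"
  assumes "x + t *\<^sub>R k \<noteq> 0"
  shows "((\<lambda>t. norm (x + t *\<^sub>R k)) has_real_derivative sgn (x + t *\<^sub>R k) \<bullet> k) (at t within U)"
proof -
  have 1: "((\<lambda>t. x + t *\<^sub>R k) has_derivative (\<lambda>r. r *\<^sub>R k)) (at t within U)"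
    by (auto intro!: derivative_eq_intros)
  have "((\<lambda>t. norm (x + t *\<^sub>R k)) has_derivative (\<lambda>r. r *\<^sub>R k \<bullet> sgn (x + t *\<^sub>R k))) (at t within U)"
    using has_derivative_compose[where f="\<lambda>t. x + t *\<^sub>R k" and f'="\<lambda>r. r *\<^sub>R k" and s=U,
        OF 1 has_derivative_norm[OF assms]] .
  moreover have "(\<lambda>r. r *\<^sub>R k \<bullet> sgn (x + t *\<^sub>R k)) = (*) (sgn (x + t *\<^sub>R k) \<bullet> k)"
    by (auto simp: inner_commute)
  ultimately show ?thesis by (simp add: has_field_derivative_def)
qed

lemma pmean_add_scaleR:
  assumes "continuous_on {0..1} p" "continuous_on {0..1} k"
  shows "pmean (\<lambda>s. p s + t *\<^sub>R k s) = pmean p + t *\<^sub>R pmean k"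
proof -
  have "(\<lambda>s. t *\<^sub>R k s) integrable_on {0..1}" "p integrable_on {0..1}"
    using assms by (auto intro!: integrable_continuous_real continuous_intros)
  then show ?thesis unfolding pmean_def by (simp add: integral_add)
qed

lemma plen_line_derivative:
  fixes p k :: "real \<Rightarrow> 'a::euclidean_space"
  assumes p: "continuous_on {0..1} p" and k: "continuous_on {0..1} k"
    and nz: "\<And>t s. t \<in> {0..1} \<Longrightarrow> s \<in> {0..1} \<Longrightarrow> p s + t *\<^sub>R k s \<noteq> 0" and t: "t \<in> {0..1}"
  shows "((\<lambda>t. plen (\<lambda>s. p s + t *\<^sub>R k s)) has_real_derivative dplen (\<lambda>s. p s + t *\<^sub>R k s) k) (at t within {0..1})"
proof -
  have pk: "continuous_on ({0..1} \<times> {0..1::real}) (\<lambda>x. p (snd x))"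
     "continuous_on ({0..1} \<times> {0..1::real}) (\<lambda>x. k (snd x))"
    by (auto intro!: continuous_intros continuous_on_compose2[OF p] continuous_on_compose2[OF k])
  have "((\<lambda>t. integral (cbox 0 1) (\<lambda>s. norm (p s + t *\<^sub>R k s))) has_real_derivative
      integral (cbox 0 1) (\<lambda>s. sgn (p s + t *\<^sub>R k s) \<bullet> k s)) (at t within {0..1})"
  proof (rule leibniz_rule_field_derivative[where fx="\<lambda>t s. sgn (p s + t *\<^sub>R k s) \<bullet> k s" and U="{0..1}"])
    show "continuous_on ({0..1} \<times> cbox 0 1) (\<lambda>(t, s). sgn (p s + t *\<^sub>R k s) \<bullet> k s)"
      unfolding split_def using nz by (intro continuous_intros) (auto intro!: pk continuous_intros)
  qed (use nz t in \<open>auto intro!: norm_line_derivative integrable_continuous_real continuous_intros p k\<close>)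
  then show ?thesis by (simp add: plen_def dplen_def)
qed

lemma Phi_line_derivative:
  fixes p k :: "real \<Rightarrow> 'a::euclidean_space"
  assumes p: "continuous_on {0..1} p" and k: "continuous_on {0..1} k"
    and nz: "\<And>t s. t \<in> {0..1} \<Longrightarrow> s \<in> {0..1} \<Longrightarrow> p s + t *\<^sub>R k s \<noteq> 0" and t: "t \<in> {0..1}"
    and D: "pmean (\<lambda>s. p s + t *\<^sub>R k s) \<noteq> 0" and M: "plen (\<lambda>s. p s + t *\<^sub>R k s) > 0"
  shows "((\<lambda>t. Phi \<alpha> (\<lambda>s. p s + t *\<^sub>R k s)) has_real_derivative Psi \<alpha> (\<lambda>s. p s + t *\<^sub>R k s) k) (at t within {0..1})"
proof -
  note pm = pmean_add_scaleR[OF p k]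
  have 1: "((\<lambda>t. norm (pmean p + t *\<^sub>R pmean k)) has_real_derivative
     sgn (pmean p + t *\<^sub>R pmean k) \<bullet> pmean k) (at t within {0..1})"
    using D by (intro norm_line_derivative) (simp add: pm)
  have 2: "((\<lambda>t. norm (p s + t *\<^sub>R k s)) has_real_derivative sgn (p s + t *\<^sub>R k s) \<bullet> k s) (at t within {0..1})"
    if "s \<in> {0..1}" for s
    using nz[OF t that] by (rule norm_line_derivative)
  note 3 = plen_line_derivative[OF p k nz t]
  have D': "norm (pmean p + t *\<^sub>R pmean k) > 0" using D by (simp add: pm)
  \<comment> \<open>The powers are written as quotients so that the output of the derivative rule
    for \<open>powr\<close> and the formula in \<open>Psi\<close> reach the same normal
    form.\<close>
  have a: "norm (pmean p + t *\<^sub>R pmean k) powr (-\<alpha> - 1) = norm (pmean p + t *\<^sub>R pmean k) powr (-\<alpha>) / norm (pmean p + t *\<^sub>R pmean k)"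
    "plen (\<lambda>s. p s + t *\<^sub>R k s) powr (-\<alpha> - 1) = plen (\<lambda>s. p s + t *\<^sub>R k s) powr (-\<alpha>) / plen (\<lambda>s. p s + t *\<^sub>R k s)"
    using D' M by (auto simp: powr_diff)
  show ?thesis unfolding Phi_def Psi_def pm
    apply (rule derivative_eq_intros 1 3 2[of 1] 2[of 0] D' M refl | simp)+
    apply (simp add: a algebra_simps)
    done
qed

text \<open>Index tuples are \<open>(\<nu>, p, p', k)\<close>: two paths at distance at most \<open>\<nu>\<close> and a direction.\<close>

definition path_data :: "real \<Rightarrow> real \<Rightarrow>
    (real \<times> (real \<Rightarrow> 'a::euclidean_space) \<times> (real \<Rightarrow> 'a) \<times> (real \<Rightarrow> 'a)) set" where
  "path_data c C = {(\<nu>, p, p', k). 0 < \<nu> \<and> \<nu> \<le> 1 \<and>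
     continuous_on {0..1} p \<and> continuous_on {0..1} p' \<and> continuous_on {0..1} k \<and>
     (\<forall>s\<in>{0..1}. c \<le> norm (p s) \<and> norm (p s) \<le> C \<and> c \<le> norm (p' s) \<and> norm (p' s) \<le> C \<and>
        norm (k s) \<le> 1 \<and> norm (p' s - p s) \<le> \<nu>)}"

text \<open>The bound on the means is kept apart from \<open>path_data\<close> because
  \<open>rho\<close> is evaluated on whole periods, where the velocity of a closed curve has mean
  zero.\<close>

definition path_data_mean where
  "path_data_mean c C = path_data c C \<inter> {(\<nu>, p, p', k). c \<le> norm (pmean p) \<and> c \<le> norm (pmean p')}"

definition pd_path where
  "pd_path i t = (if t then fst (snd (snd i)) else fst (snd i))"

definition pd_dir where
  "pd_dir i = snd (snd (snd i))"

text \<open>Deviations from the mean for the path, the rescaled difference of the two paths, and the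
  direction. Dividing the difference by \<open>\<nu>\<close> is what allows a quantity of size
  \<open>pd_inc\<close> to change by at most a multiple of \<open>\<nu> * pd_inc\<close>.\<close>

definition pd_inc where
  "pd_inc i s = (let (\<nu>, p, p', k) = i in
     norm (p s - pmean p) + norm ((p' s - p s) /\<^sub>R \<nu> - pmean (\<lambda>s. (p' s - p s) /\<^sub>R \<nu>)) + norm (k s - pmean k))"

lemma path_dataD:
  assumes "i \<in> path_data c C"
  shows "0 < fst i" "fst i \<le> 1" "continuous_on {0..1} (pd_path i t)" "continuous_on {0..1} (pd_dir i)"
    "s \<in> {0..1} \<Longrightarrow> c \<le> norm (pd_path i t s)" "s \<in> {0..1} \<Longrightarrow> norm (pd_path i t s) \<le> C"
    "s \<in> {0..1} \<Longrightarrow> norm (pd_dir i s) \<le> 1"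
    "s \<in> {0..1} \<Longrightarrow> norm (pd_path i True s - pd_path i False s) \<le> fst i"
  using assms by (auto simp: path_data_def pd_path_def pd_dir_def)

lemma path_data_meanD:
  assumes "i \<in> path_data_mean c C"
  shows "i \<in> path_data c C" "c \<le> norm (pmean (pd_path i t))"
  using assms by (auto simp: path_data_mean_def pd_path_def)

text \<open>The reparametrization \<open>g\<close> serves for endpoints (constant \<open>g\<close>)
  and for the two halves of a period. In the constant, \<open>C\<close> bounds the values and
  \<open>1\<close> the differences.\<close>

lemma lip_pd_path:
  fixes g :: "real \<Rightarrow> real"
  assumes "C \<ge> 0" "S \<subseteq> path_data c C" "\<And>x. x \<in> {0..1} \<Longrightarrow> g x \<in> {0..1}"
  shows "lip_family (S \<times> {0..1}) (\<lambda>x. fst (fst x)) (\<lambda>_. 1) (\<lambda>x t. pd_path (fst x) t (g (snd x)))"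
proof (rule lip_familyI[where C="C + 1"])
  fix x t assume "x \<in> S \<times> {0..1::real}"
  then obtain i s where x: "x = (i, s)" "i \<in> path_data c C" "g s \<in> {0..1}" using assms by auto
  note P = path_dataD[OF x(2)]
  show "norm (pd_path (fst x) t (g (snd x))) \<le> (C + 1) * 1" using P(6)[OF x(3), of t] x by simp
  have "norm (pd_path (fst x) True (g (snd x)) - pd_path (fst x) False (g (snd x))) \<le> fst i"
    using P(8)[OF x(3)] x by simp
  also have "\<dots> \<le> (C + 1) * fst i" using P(1) assms(1) by (simp add: algebra_simps)
  finally show "norm (pd_path (fst x) True (g (snd x)) - pd_path (fst x) False (g (snd x)))
      \<le> (C + 1) * (fst (fst x) * 1)" using x by simp
  show "0 \<le> fst (fst x)" using P(1) x by simp
qed (use assms in auto)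

lemma pmean_norm_le:
  assumes "continuous_on {0..1} p" "\<And>s. s \<in> {0..1} \<Longrightarrow> norm (p s) \<le> B"
  shows "norm (pmean p) \<le> B"
  using integral_bound[of 0 1 p B] assms unfolding pmean_def by simp

lemma pmean_diff:
  assumes "continuous_on {0..1} p" "continuous_on {0..1} q"
  shows "pmean (\<lambda>s. p s - q s) = pmean p - pmean q"
  using assms unfolding pmean_def by (intro integral_diff integrable_continuous_real)

lemma pmean_scaleR: "pmean (\<lambda>s. c *\<^sub>R p s) = c *\<^sub>R pmean p"
  unfolding pmean_def by simp

lemma pd_inc_continuous:
  assumes "i \<in> path_data c C"
  shows "continuous_on {0..1} (pd_inc i)"
  using assms unfolding pd_inc_def path_data_def
  by (cases i) (auto intro!: continuous_intros)

lemma pd_inc_nonneg: "0 \<le> pd_inc i s"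
  by (cases i) (auto simp: pd_inc_def)

text \<open>Taking the mean is linear, so the increments of \<open>p'\<close> and \<open>p\<close>
  differ by \<open>\<nu>\<close> times those of the rescaled difference. Since
  \<open>\<nu> \<le> 1\<close>, the same identity bounds the increments of \<open>p'\<close>. All
  other quantities of first order are derived from this family.\<close>

lemma lip_increment:
  assumes "S \<subseteq> path_data c C"
  shows "lip_family (S \<times> {0..1}) (\<lambda>x. fst (fst x)) (\<lambda>x. pd_inc (fst x) (snd x))
    (\<lambda>x t. pd_path (fst x) t (snd x) - pmean (pd_path (fst x) t))"
proof -
  have *: "norm (pd_path i t s - pmean (pd_path i t)) \<le> 2 * pd_inc i s \<and>
     norm ((pd_path i True s - pmean (pd_path i True)) - (pd_path i False s - pmean (pd_path i False)))
       \<le> fst i * pd_inc i s" if i: "i \<in> S" for i s t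
  proof -
    obtain \<nu> p p' k where [simp]: "i = (\<nu>, p, p', k)" by (cases i)
    have v: "0 < \<nu>" "\<nu> \<le> 1" "continuous_on {0..1} p" "continuous_on {0..1} p'"
      using assms i by (auto simp: path_data_def)
    define f where "f s = (p' s - p s) /\<^sub>R \<nu>" for s
    have fm: "pmean f = (pmean p' - pmean p) /\<^sub>R \<nu>"
      using v unfolding f_def by (simp only: pmean_scaleR pmean_diff)
    have inc: "pd_inc i s = norm (p s - pmean p) + norm (f s - pmean f) + norm (k s - pmean k)"
      by (simp add: pd_inc_def f_def[abs_def])
    have e: "(p' s - pmean p') - (p s - pmean p) = \<nu> *\<^sub>R (f s - pmean f)"
      using v(1) by (simp add: f_def fm scaleR_diff_right algebra_simps)
    have d: "norm ((p' s - pmean p') - (p s - pmean p)) = \<nu> * norm (f s - pmean f)"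
      using v(1) by (simp add: e)
    have "\<nu> * norm (f s - pmean f) \<le> 1 * norm (f s - pmean f)" using v by (intro mult_right_mono) auto
    then have "norm (p' s - pmean p') \<le> norm (p s - pmean p) + norm (f s - pmean f)"
      using d norm_triangle_sub[of "p' s - pmean p'" "p s - pmean p"] by simp
    moreover have "\<nu> * norm (f s - pmean f) \<le> \<nu> * pd_inc i s"
      using v inc by (intro mult_left_mono) auto
    moreover have "norm (p s - pmean p) + norm (f s - pmean f) \<le> pd_inc i s" unfolding inc by simp
    moreover have "0 \<le> norm (p s - pmean p)" "0 \<le> norm (f s - pmean f)" by auto
    ultimately have "norm (p' s - pmean p') \<le> 2 * pd_inc i s" "norm (p s - pmean p) \<le> 2 * pd_inc i s"
      "norm ((p' s - pmean p') - (p s - pmean p)) \<le> \<nu> * pd_inc i s"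
      using d by linarith+
    then show ?thesis by (auto simp: pd_path_def)
  qed
  show ?thesis
  proof (rule lip_familyI[where C=2])
    fix x t assume x: "x \<in> S \<times> {0..1::real}"
    then have n: "0 \<le> fst (fst x) * pd_inc (fst x) (snd x)"
      using assms path_dataD(1)[of "fst x" c C]
      by (intro mult_nonneg_nonneg pd_inc_nonneg) (auto simp: mem_Times_iff)
    show "norm (pd_path (fst x) t (snd x) - pmean (pd_path (fst x) t)) \<le> 2 * pd_inc (fst x) (snd x)"
      using * x by (auto simp: mem_Times_iff)
    have "norm (pd_path (fst x) True (snd x) - pmean (pd_path (fst x) True)
          - (pd_path (fst x) False (snd x) - pmean (pd_path (fst x) False)))
        \<le> fst (fst x) * pd_inc (fst x) (snd x)"
      using * x by (auto simp: mem_Times_iff)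
    then show "norm (pd_path (fst x) True (snd x) - pmean (pd_path (fst x) True)
          - (pd_path (fst x) False (snd x) - pmean (pd_path (fst x) False)))
        \<le> 2 * (fst (fst x) * pd_inc (fst x) (snd x))"
      using n by linarith
    show "0 \<le> fst (fst x)"
      using assms path_dataD(1)[of "fst x" c C] x by (auto simp: mem_Times_iff)
  qed (simp_all add: pd_inc_nonneg)
qed

section \<open>Quadratic bounds for the path functionals\<close>

definition pd_quad where
  "pd_quad i = integral {0..1} (\<lambda>s. (pd_inc i s)\<^sup>2)"

lemma norm_diff_inner:
  fixes v w :: "'a::euclidean_space"
  shows "(v - w) \<bullet> (v + w) = (norm v - norm w) * (norm v + norm w)"
  by (simp add: inner_diff_left inner_add_right inner_commute algebra_simps flip: power2_norm_eq_inner)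
     (simp add: power2_eq_square)

context
  fixes c C :: real
  assumes c: "0 < c" "c \<le> C"
begin

private abbreviation (input) "Paths \<equiv> path_data_mean c C :: (real \<times> (real \<Rightarrow> 'a::euclidean_space) \<times> (real \<Rightarrow> 'a) \<times> (real \<Rightarrow> 'a)) set"
private abbreviation (input) "Points \<equiv> (path_data_mean c C :: (real \<times> (real \<Rightarrow> 'a::euclidean_space) \<times> (real \<Rightarrow> 'a) \<times> (real \<Rightarrow> 'a)) set) \<times> {0..1::real}"
private abbreviation (input) "Inc \<equiv> (\<lambda>x. pd_inc (fst x) (snd x))"
private abbreviation (input) "Dist \<equiv> (\<lambda>x. fst (fst x))"
private abbreviation (input) "Pt \<equiv> (\<lambda>x t. pd_path (fst x) t (snd x))"
private abbreviation (input) "Mean \<equiv> (\<lambda>i t. pmean (pd_path i t))"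
private abbreviation (input) "Len \<equiv> (\<lambda>i t. plen (pd_path i t))"
private abbreviation (input) "DSgn \<equiv> (\<lambda>x t. sgn (pd_path (fst x) t (snd x)) - sgn (pmean (pd_path (fst x) t)))"

lemma Paths_sub: "path_data_mean c C \<subseteq> path_data c C"
  by (auto simp: path_data_mean_def)

lemma Paths_nu: "i \<in> Paths \<Longrightarrow> 0 \<le> fst i"
  using path_dataD(1)[OF path_data_meanD(1)] by (rule less_imp_le)

lemma Paths_ge: "i \<in> Paths \<Longrightarrow> s \<in> {0..1} \<Longrightarrow> c \<le> norm (pd_path i t s)"
  by (rule path_dataD(5)[OF path_data_meanD(1)])

lemma Paths_dir: "i \<in> Paths \<Longrightarrow> s \<in> {0..1} \<Longrightarrow> norm (pd_dir i s) \<le> 1"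
  by (rule path_dataD(7)[OF path_data_meanD(1)])

lemma Paths_nz:
  assumes "i \<in> Paths"
  shows "s \<in> {0..1} \<Longrightarrow> pd_path i t s \<noteq> 0" "pmean (pd_path i t) \<noteq> 0"
  using Paths_ge[OF assms, of s t] path_data_meanD(2)[OF assms, of t] c by auto

lemma cont_path: "i \<in> Paths \<Longrightarrow> continuous_on {0..1} (pd_path i t)"
  by (rule path_dataD(3)[OF path_data_meanD(1)])

lemma cont_dir: "i \<in> Paths \<Longrightarrow> continuous_on {0..1} (pd_dir i)"
  by (rule path_dataD(4)[OF path_data_meanD(1)])

lemma cont_inc: "i \<in> Paths \<Longrightarrow> continuous_on {0..1} (pd_inc i)"
  by (rule pd_inc_continuous[OF path_data_meanD(1)])

lemma cont_sgn: "i \<in> Paths \<Longrightarrow> continuous_on {0..1} (\<lambda>s. sgn (pd_path i t s))"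
  by (intro continuous_intros cont_path) (simp_all add: Paths_nz)

lemma lip_path: "lip_family Points Dist (\<lambda>_. 1) Pt"
  using lip_pd_path[OF _ Paths_sub, of "\<lambda>x. x"] c by simp

lemma lip_mean: "lip_family Paths fst (\<lambda>_. 1) Mean"
  unfolding pmean_def
  by (rule lip_family_integral1[OF lip_path, unfolded fst_conv snd_conv]) (rule cont_path)

lemma lip_len: "lip_family Paths fst (\<lambda>_. 1) Len"
  unfolding plen_def
  by (rule lip_family_integral1[OF lip_family_norm[OF lip_path], unfolded fst_conv snd_conv])
     (intro continuous_intros cont_path)

lemma lip_end:
  assumes "s \<in> {0..1}"
  shows "lip_family Paths fst (\<lambda>_. 1) (\<lambda>i t. pd_path i t s)"
proof -
  \<comment> \<open>A family constant in \<open>s\<close> equals its own integral over the unit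
    interval, which carries the statement from \<open>Points\<close> to
    \<open>Paths\<close>.\<close>
  have "lip_family Points Dist (\<lambda>_. 1) (\<lambda>x t. pd_path (fst x) t s)"
    by (rule lip_pd_path[OF _ Paths_sub]) (use assms c in auto)
  from lip_family_integral[OF this] show ?thesis by simp
qed

lemma lip_dir:
  assumes "s \<in> {0..1}"
  shows "lip_family Paths fst (\<lambda>_. 1) (\<lambda>i t. pd_dir i s)"
  by (rule lip_family_indep[where C=1])
     (use assms in \<open>simp_all add: Paths_nu Paths_dir\<close>)

lemma lip_dir_mean: "lip_family Paths fst (\<lambda>_. 1) (\<lambda>i t. pmean (pd_dir i))"
  by (rule lip_family_indep[where C=1])
     (auto simp: Paths_nu Paths_dir intro!: pmean_norm_le cont_dir simp del: split_paired_All)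

lemma lip_nrm_path_inv: "lip_family Points Dist (\<lambda>_. 1) (\<lambda>x t. inverse (norm (Pt x t)))"
  by (rule lip_family_inverse[OF lip_family_norm[OF lip_path] c(1)])
     (simp add: mem_Times_iff Paths_ge)

lemma lip_nrm_mean_inv: "lip_family Paths fst (\<lambda>_. 1) (\<lambda>i t. inverse (norm (Mean i t)))"
  by (rule lip_family_inverse[OF lip_family_norm[OF lip_mean] c(1)])
     (use path_data_meanD(2) in auto)

lemma lip_sgn_mean: "lip_family Paths fst (\<lambda>_. 1) (\<lambda>i t. sgn (Mean i t))"
  unfolding sgn_div_norm by (rule lip_family_0scaleR[OF lip_nrm_mean_inv lip_mean])

lemma lip_sgn_end:
  assumes "s \<in> {0..1}"
  shows "lip_family Paths fst (\<lambda>_. 1) (\<lambda>i t. sgn (pd_path i t s))"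
  unfolding sgn_div_norm
proof (rule lip_family_0scaleR[OF lip_family_inverse[OF _ c(1)] lip_end[OF assms]])
  show "lip_family Paths fst (\<lambda>_. 1) (\<lambda>i t. norm (pd_path i t s))"
    by (rule lip_family_norm[OF lip_end[OF assms]])
qed (use assms in \<open>simp add: Paths_ge\<close>)

text \<open>Rationalizing the difference of norms by \<open>norm_diff_inner\<close> exhibits the
  increment as a factor; the denominator is at least \<open>c\<close>.\<close>

lemma lip_norm_diff: "lip_family Points Dist Inc (\<lambda>x t. norm (Pt x t) - norm (Mean (fst x) t))"
proof (rule lip_family_cong)
  let ?Y = "\<lambda>x t. inverse (norm (Pt x t) + norm (Mean (fst x) t))
     * ((Pt x t - Mean (fst x) t) \<bullet> (Pt x t + Mean (fst x) t))"
  have "lip_family Points Dist (\<lambda>_. 1) (\<lambda>x t. inverse (norm (Pt x t) + norm (Mean (fst x) t)))"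
    by (rule lip_family_inverse[OF lip_family_add[OF lip_family_norm[OF lip_path] lip_family_norm[OF lip_family_lift[OF lip_mean]]] c(1)])
       (simp add: mem_Times_iff Paths_ge add_increasing2)
  then show "lip_family Points Dist Inc ?Y"
    by (rule lip_family_0mult) (rule lip_family_inner0[OF lip_increment[OF Paths_sub]
       lip_family_add[OF lip_path lip_family_lift[OF lip_mean]]])
  fix x t assume x: "x \<in> Points"
  have "norm (Pt x t) > 0" using x by (simp add: mem_Times_iff Paths_nz)
  then have p: "norm (Pt x t) + norm (Mean (fst x) t) > 0" by (simp add: add_pos_nonneg)
  show "?Y x t = norm (Pt x t) - norm (Mean (fst x) t)"
    unfolding norm_diff_inner using p by simp
qed

text \<open>With \<open>p\<close> the path and \<open>D\<close> its mean, the difference of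
  directions is \<open>(p - D) / norm p\<close> minus \<open>(norm p - norm D) / norm p\<close>
  times \<open>sgn D\<close>; each part contains exactly one increment.\<close>

lemma lip_sgn_diff: "lip_family Points Dist Inc DSgn"
proof (rule lip_family_cong)
  let ?Y = "\<lambda>x t. inverse (norm (Pt x t)) *\<^sub>R (Pt x t - Mean (fst x) t) -
      (inverse (norm (Pt x t)) * (norm (Pt x t) - norm (Mean (fst x) t))) *\<^sub>R sgn (Mean (fst x) t)"
  show "lip_family Points Dist Inc ?Y"
    by (intro lip_family_diff lip_family_0scaleR[OF lip_nrm_path_inv lip_increment[OF Paths_sub]]
       lip_family_scaleR0[OF lip_family_0mult[OF lip_nrm_path_inv lip_norm_diff] lip_family_lift[OF lip_sgn_mean]])
  fix x t assume x: "x \<in> Points"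
  then have "Pt x t \<noteq> 0" "Mean (fst x) t \<noteq> 0" by (simp_all add: mem_Times_iff Paths_nz)
  then show "?Y x t = DSgn x t"
    by (simp add: sgn_div_norm scaleR_diff_left scaleR_diff_right left_diff_distrib right_diff_distrib)
qed

text \<open>The norm of the mean \<open>D\<close> is the mean of \<open>p \<bullet> sgn D\<close>,
  and for unit vectors \<open>a\<close>, \<open>b\<close> the number
  \<open>1 - a \<bullet> b\<close> is half the squared distance of \<open>a\<close> and
  \<open>b\<close>. This is the origin of the quadratic smallness: the length exceeds the chord only
  by the square of the oscillation of the tangent.\<close>

lemma len_defect:
  assumes i: "i \<in> Paths"
  shows "Len i t - norm (Mean i t) = integral {0..1} (\<lambda>s. 1/2 * norm (pd_path i t s) * (DSgn (i,s) t \<bullet> DSgn (i,s) t))"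
proof -
  let ?p = "pd_path i t" and ?D = "pmean (pd_path i t)"
  have e: "1/2 * norm (?p s) * (DSgn (i,s) t \<bullet> DSgn (i,s) t) = norm (?p s) - ?p s \<bullet> sgn ?D" if "s \<in> {0..1}" for s
  proof -
    have nz: "?p s \<noteq> 0" "?D \<noteq> 0" using Paths_nz[OF i] that by auto
    then have "sgn (?p s) \<bullet> sgn (?p s) = 1" "sgn ?D \<bullet> sgn ?D = 1"
      by (simp_all add: dot_square_norm norm_sgn)
    then have "DSgn (i,s) t \<bullet> DSgn (i,s) t = 2 - 2 * (sgn (?p s) \<bullet> sgn ?D)"
      by (simp add: inner_diff_left inner_diff_right inner_commute)
    then have "1/2 * norm (?p s) * (DSgn (i,s) t \<bullet> DSgn (i,s) t) = norm (?p s) - (norm (?p s) *\<^sub>R sgn (?p s)) \<bullet> sgn ?D"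
      by (simp only:) (simp add: right_diff_distrib)
    also have "norm (?p s) *\<^sub>R sgn (?p s) = ?p s" using nz by (simp add: sgn_div_norm)
    finally show ?thesis .
  qed
  have "integral {0..1} (\<lambda>s. 1/2 * norm (?p s) * (DSgn (i,s) t \<bullet> DSgn (i,s) t)) = integral {0..1} (\<lambda>s. norm (?p s) - ?p s \<bullet> sgn ?D)"
    using e by (intro integral_cong) auto
  also have "\<dots> = plen ?p - integral {0..1} (\<lambda>s. ?p s \<bullet> sgn ?D)"
    unfolding plen_def by (intro integral_diff integrable_continuous_real continuous_intros cont_path i)
  also have "integral {0..1} (\<lambda>s. ?p s \<bullet> sgn ?D) = ?D \<bullet> sgn ?D"
    unfolding pmean_def using integral_linear[OF integrable_continuous_real[OF cont_path[OF i]] bounded_linear_inner_left[of "sgn ?D"], of t]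
    by (simp add: o_def pmean_def)
  also have "\<dots> = norm ?D" using Paths_nz(2)[OF i, of t] by (metis sgn_inner_self inner_commute)
  finally show ?thesis by simp
qed

lemma len_ge_mean: "i \<in> Paths \<Longrightarrow> norm (Mean i t) \<le> Len i t"
  unfolding pmean_def plen_def
  by (intro integral_norm_bound_integral integrable_continuous_real continuous_intros cont_path) auto

lemma len_ge: "i \<in> Paths \<Longrightarrow> c \<le> Len i t"
  using len_ge_mean path_data_meanD(2) by (rule order_trans[rotated])

lemma lip_len_defect: "lip_family Paths fst pd_quad (\<lambda>i t. Len i t - norm (Mean i t))"
proof (rule lip_family_cong)
  let ?X = "\<lambda>x t. 1/2 * norm (Pt x t) * (DSgn x t \<bullet> DSgn x t)"
  have *: "lip_family Points Dist (\<lambda>x. (Inc x)\<^sup>2) ?X"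
    unfolding power2_eq_square
    by (rule lip_family_0mult[OF lip_family_cmult[OF lip_family_norm[OF lip_path]] lip_family_inner[OF lip_sgn_diff lip_sgn_diff]])
  show "lip_family Paths fst pd_quad (\<lambda>i t. integral {0..1} (\<lambda>s. ?X (i,s) t))"
    unfolding pd_quad_def fst_conv snd_conv
    by (rule lip_family_integral[OF *, unfolded fst_conv snd_conv]) (intro continuous_intros cont_path cont_sgn cont_inc; assumption)+
qed (simp add: len_defect)

text \<open>Each term on the right is a product of two increments, up to factors of order zero.\<close>

lemma dlen_defect:
  assumes i: "i \<in> Paths"
  shows "norm (Mean i t) * (dplen (pd_path i t) (pd_dir i) - sgn (Mean i t) \<bullet> pmean (pd_dir i)) =
    integral {0..1} (\<lambda>s. norm (Mean i t) * (DSgn (i,s) t \<bullet> (pd_dir i s - pmean (pd_dir i)))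
       - (norm (pd_path i t s) - norm (Mean i t)) * (DSgn (i,s) t \<bullet> pmean (pd_dir i)))
    - (Len i t - norm (Mean i t)) * (sgn (Mean i t) \<bullet> pmean (pd_dir i))"
proof -
  let ?p = "pd_path i t" and ?D = "pmean (pd_path i t)" and ?k = "pd_dir i" and ?K = "pmean (pd_dir i)"
  have int: "f integrable_on {0..1}" if "continuous_on {0..1} f" for f :: "real \<Rightarrow> real"
    using that by (rule integrable_continuous_real)
  note ci = continuous_intros cont_path[OF i] cont_dir[OF i] cont_sgn[OF i]
  have iA: "(\<lambda>s. norm ?D * (sgn (?p s) \<bullet> ?k s)) integrable_on {0..1}"
    and iB: "(\<lambda>s. norm ?D * (?k s \<bullet> sgn ?D)) integrable_on {0..1}"
    and iC: "(\<lambda>s. ?p s \<bullet> ?K) integrable_on {0..1}"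
    and iE: "(\<lambda>s. norm (?p s) * (sgn ?D \<bullet> ?K)) integrable_on {0..1}"
    by (intro int ci)+
  have lin: "integral {0..1} (\<lambda>s. f s \<bullet> v) = integral {0..1} f \<bullet> v" if "continuous_on {0..1} f" for f :: "real \<Rightarrow> 'a" and v
    using integral_linear[OF integrable_continuous_real[OF that] bounded_linear_inner_left, of v] by (simp add: o_def)
  \<comment> \<open>Pairing \<open>DSgn\<close> with the constant \<open>?K\<close> is only of first
    order. Replacing the factor \<open>norm ?D\<close> by \<open>norm (?p s)\<close> costs a second
    increment, and the term with the new factor integrates to the length defect, which is again
    quadratic.\<close>
  have e: "norm ?D * (DSgn (i,s) t \<bullet> (?k s - ?K)) - (norm (?p s) - norm ?D) * (DSgn (i,s) t \<bullet> ?K)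
     = norm ?D * (sgn (?p s) \<bullet> ?k s) - norm ?D * (?k s \<bullet> sgn ?D) - ((?p s \<bullet> ?K) - norm (?p s) * (sgn ?D \<bullet> ?K))"
    if "s \<in> {0..1}" for s
  proof -
    have nz: "?p s \<noteq> 0" using Paths_nz[OF i] that by auto
    then have "?p s \<bullet> ?K = (norm (?p s) *\<^sub>R sgn (?p s)) \<bullet> ?K" by (simp add: sgn_div_norm)
    then have "?p s \<bullet> ?K = norm (?p s) * (sgn (?p s) \<bullet> ?K)" by simp
    then show ?thesis by (simp add: algebra_simps inner_commute)
  qed
  have "integral {0..1} (\<lambda>s. norm ?D * (DSgn (i,s) t \<bullet> (?k s - ?K)) - (norm (?p s) - norm ?D) * (DSgn (i,s) t \<bullet> ?K))
    = integral {0..1} (\<lambda>s. norm ?D * (sgn (?p s) \<bullet> ?k s) - norm ?D * (?k s \<bullet> sgn ?D) - ((?p s \<bullet> ?K) - norm (?p s) * (sgn ?D \<bullet> ?K)))"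
    using e by (intro integral_cong) auto
  also have "\<dots> = integral {0..1} (\<lambda>s. norm ?D * (sgn (?p s) \<bullet> ?k s)) - integral {0..1} (\<lambda>s. norm ?D * (?k s \<bullet> sgn ?D))
      - (integral {0..1} (\<lambda>s. ?p s \<bullet> ?K) - integral {0..1} (\<lambda>s. norm (?p s) * (sgn ?D \<bullet> ?K)))"
    by (simp only: integral_diff[OF integrable_diff[OF iA iB] integrable_diff[OF iC iE]]
      integral_diff[OF iA iB] integral_diff[OF iC iE])
  also have "\<dots> = norm ?D * dplen ?p ?k - norm ?D * (?K \<bullet> sgn ?D) - (?D \<bullet> ?K - plen ?p * (sgn ?D \<bullet> ?K))"
    using lin[OF cont_dir[OF i]] lin[OF cont_path[OF i]]
    by (simp add: dplen_def plen_def flip: pmean_def)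
  finally have A: "integral {0..1} (\<lambda>s. norm ?D * (DSgn (i,s) t \<bullet> (?k s - ?K)) - (norm (?p s) - norm ?D) * (DSgn (i,s) t \<bullet> ?K))
    = norm ?D * dplen ?p ?k - norm ?D * (?K \<bullet> sgn ?D) - (?D \<bullet> ?K - plen ?p * (sgn ?D \<bullet> ?K))" .
  have "?D \<bullet> ?K = (norm ?D *\<^sub>R sgn ?D) \<bullet> ?K" using Paths_nz(2)[OF i] by (simp add: sgn_div_norm)
  then have B: "?D \<bullet> ?K = norm ?D * (sgn ?D \<bullet> ?K)" by simp
  show ?thesis unfolding A B by (simp add: algebra_simps inner_commute)
qed

lemma lip_dlen_defect:
  "lip_family Paths fst pd_quad (\<lambda>i t. dplen (pd_path i t) (pd_dir i) - sgn (Mean i t) \<bullet> pmean (pd_dir i))"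
proof (rule lip_family_cong)
  let ?X = "\<lambda>x t. norm (Mean (fst x) t) * (DSgn x t \<bullet> (pd_dir (fst x) (snd x) - pmean (pd_dir (fst x))))
       - (norm (Pt x t) - norm (Mean (fst x) t)) * (DSgn x t \<bullet> pmean (pd_dir (fst x)))"
  let ?R = "\<lambda>i t. (Len i t - norm (Mean i t)) * (sgn (Mean i t) \<bullet> pmean (pd_dir i))"
  let ?Y = "\<lambda>i t. inverse (norm (Mean i t)) * (integral {0..1} (\<lambda>s. ?X (i,s) t) - ?R i t)"
  have nu0: "0 \<le> Dist x" if "x \<in> Points" for x
    using that by (simp add: mem_Times_iff Paths_nu)
  have kk: "lip_family Points Dist Inc (\<lambda>x t. pd_dir (fst x) (snd x) - pmean (pd_dir (fst x)))"
    by (rule lip_family_indep[where C=1])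
       (simp_all add: nu0 pd_inc_nonneg, simp add: pd_dir_def pd_inc_def split: prod.splits)
  have 1: "lip_family Points Dist (\<lambda>x. (Inc x)\<^sup>2) (\<lambda>x t. norm (Mean (fst x) t) * (DSgn x t \<bullet> (pd_dir (fst x) (snd x) - pmean (pd_dir (fst x)))))"
    unfolding power2_eq_square
    by (rule lip_family_0mult[OF lip_family_norm[OF lip_family_lift[OF lip_mean]] lip_family_inner[OF lip_sgn_diff kk]])
  have 2: "lip_family Points Dist (\<lambda>x. (Inc x)\<^sup>2) (\<lambda>x t. (norm (Pt x t) - norm (Mean (fst x) t)) * (DSgn x t \<bullet> pmean (pd_dir (fst x))))"
    unfolding power2_eq_square
    by (rule lip_family_mult[OF lip_norm_diff lip_family_inner0[OF lip_sgn_diff lip_family_lift[OF lip_dir_mean]]])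
  have 3: "lip_family Paths fst pd_quad (\<lambda>i t. integral {0..1} (\<lambda>s. ?X (i,s) t))"
    unfolding pd_quad_def fst_conv snd_conv
    by (rule lip_family_integral[OF lip_family_diff[OF 1 2], unfolded fst_conv snd_conv]) (intro continuous_intros cont_path cont_dir cont_sgn cont_inc; assumption)+
  have 4: "lip_family Paths fst pd_quad ?R"
    by (rule lip_family_mult0[OF lip_len_defect lip_family_0inner[OF lip_sgn_mean lip_dir_mean]])
  show "lip_family Paths fst pd_quad ?Y"
    by (rule lip_family_0mult[OF lip_nrm_mean_inv lip_family_diff[OF 3 4]])
  fix i t assume i: "i \<in> Paths"
  have "norm (Mean i t) > 0" using Paths_nz(2)[OF i] by simp
  then show "?Y i t = dplen (pd_path i t) (pd_dir i) - sgn (Mean i t) \<bullet> pmean (pd_dir i)"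
    using dlen_defect[OF i, of t] by (simp add: field_simps)
qed

text \<open>The mean value theorem in integral form: an unspecified intermediate point could not be
  compared between two curves, whereas this integral depends on the data in a Lipschitz way.\<close>

lemma powr_diff_integral:
  fixes x m :: real
  assumes "0 < x" "0 \<le> m"
  shows "x powr b - (x + m) powr b = - b * m * integral {0..1} (\<lambda>\<theta>. (x + \<theta> * m) powr (b - 1))"
proof -
  have "((\<lambda>\<theta>. b * (x + \<theta> * m) powr (b - 1) * m) has_integral ((x + 1 * m) powr b - (x + 0 * m) powr b)) {0..1}"
  proof (rule fundamental_theorem_of_calculus)
    fix \<theta> :: real assume "\<theta> \<in> {0..1}"
    then have "x + \<theta> * m > 0" using assms by (simp add: add_pos_nonneg)
    then have "((\<lambda>\<theta>. (x + \<theta> * m) powr b) has_real_derivative b * (x + \<theta> * m) powr (b - 1) * m) (at \<theta> within {0..1})"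
      by (auto intro!: derivative_eq_intros)
    then show "((\<lambda>\<theta>. (x + \<theta> * m) powr b) has_vector_derivative b * (x + \<theta> * m) powr (b - 1) * m) (at \<theta> within {0..1})"
      by (simp add: has_real_derivative_iff_has_vector_derivative)
  qed auto
  then have "integral {0..1} (\<lambda>\<theta>. (b * m) * (x + \<theta> * m) powr (b - 1)) = (x + m) powr b - x powr b"
    by (intro integral_unique) (simp add: mult_ac)
  then show ?thesis by simp
qed

lemma lip_powr_diff:
  "lip_family Paths fst pd_quad (\<lambda>i t. norm (Mean i t) powr b - Len i t powr b)"
proof (rule lip_family_cong)
  let ?m = "\<lambda>i t. Len i t - norm (Mean i t)"
  let ?F = "\<lambda>x t. (norm (Mean (fst x) t) + snd x * ?m (fst x) t) powr (b - 1)"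
  let ?Y = "\<lambda>i t. (- b * ?m i t) * integral {0..1} (\<lambda>s. ?F (i,s) t)"
  \<comment> \<open>The interpolation parameter of \<open>powr_diff_integral\<close> takes the place
    of the path parameter, so that the integral rule for families applies.\<close>
  have th: "lip_family Points Dist (\<lambda>_. 1) (\<lambda>x t. snd x)"
    by (rule lip_family_indep[where C=1])
      (auto simp: mem_Times_iff Paths_nu simp del: split_paired_All)
  have m0: "0 \<le> ?m i t" if "i \<in> Paths" for i t using len_ge_mean[OF that] by simp
  have pos: "c \<le> norm (Mean i t) + s * ?m i t" if "i \<in> Paths" "s \<in> {0..1}" for i s t
    using path_data_meanD(2)[OF that(1), of t] m0[OF that(1), of t] that(2) by (auto intro!: add_increasing2)
  have nz: "i \<in> Paths \<Longrightarrow> s \<in> {0..1} \<Longrightarrow> norm (Mean i t) + s * ?m i t \<noteq> 0" for i s t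
    using pos[of i s t] c(1) by linarith
  have *: "lip_family Points Dist (\<lambda>_. 1) ?F"
  proof (rule lip_family_powr[OF _ c(1)])
    show "lip_family Points Dist (\<lambda>_. 1) (\<lambda>x t. norm (Mean (fst x) t) + snd x * ?m (fst x) t)"
      by (intro lip_family_add lip_family_norm[OF lip_family_lift[OF lip_mean]] lip_family_0mult[OF th]
        lip_family_lift[OF lip_family_diff[OF lip_len lip_family_norm[OF lip_mean]]])
  qed (simp add: mem_Times_iff pos)
  have 1: "lip_family Paths fst (\<lambda>_. 1) (\<lambda>i t. integral {0..1} (\<lambda>s. ?F (i,s) t))"
    unfolding fst_conv snd_conv
    by (rule lip_family_integral1[OF *, unfolded fst_conv snd_conv])
       (intro continuous_intros ballI nz)
  show "lip_family Paths fst pd_quad ?Y"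
    by (rule lip_family_mult0[OF lip_family_cmult[OF lip_len_defect] 1])
  fix i t assume i: "i \<in> Paths"
  have "norm (Mean i t) > 0" using Paths_nz(2)[OF i] by simp
  from powr_diff_integral[OF this m0[OF i, of t], of b]
  show "?Y i t = norm (Mean i t) powr b - Len i t powr b" by simp
qed

lemma lip_Phi: "lip_family Paths fst pd_quad (\<lambda>i t. Phi \<alpha> (pd_path i t))"
  unfolding Phi_def
  by (intro lip_family_mult0 lip_powr_diff lip_family_0mult lip_family_norm lip_end) auto

text \<open>In the first bracket of \<open>Psi\<close> neither term is small. Adding and subtracting
  \<open>plen p powr (-\<alpha> - 1)\<close> times the chord derivative leaves the defect of the
  derivatives and a difference of powers, both quadratic.\<close>

lemma lip_Psi: "lip_family Paths fst pd_quad (\<lambda>i t. Psi \<alpha> (pd_path i t) (pd_dir i))"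
proof (rule lip_family_cong)
  let ?D = "\<lambda>i t. norm (Mean i t)"
  let ?n = "\<lambda>i t. dplen (pd_path i t) (pd_dir i) - sgn (Mean i t) \<bullet> pmean (pd_dir i)"
  let ?ab = "\<lambda>i t. norm (pd_path i t 1) * norm (pd_path i t 0)"
  let ?Y = "\<lambda>i t. \<alpha> * (Len i t powr (-\<alpha> - 1) * ?n i t -
       (?D i t powr (-\<alpha> - 1) - Len i t powr (-\<alpha> - 1)) * (sgn (Mean i t) \<bullet> pmean (pd_dir i))) * ?ab i t
     + (?D i t powr (-\<alpha>) - Len i t powr (-\<alpha>))
       * (sgn (pd_path i t 1) \<bullet> pd_dir i 1 * norm (pd_path i t 0) + norm (pd_path i t 1) * (sgn (pd_path i t 0) \<bullet> pd_dir i 0))"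
  have ab: "lip_family Paths fst (\<lambda>_. 1) ?ab"
    by (intro lip_family_0mult lip_family_norm lip_end) auto
  have M: "lip_family Paths fst (\<lambda>_. 1) (\<lambda>i t. Len i t powr (-\<alpha> - 1))"
    by (rule lip_family_powr[OF lip_len c(1)]) (rule len_ge)
  have last: "lip_family Paths fst (\<lambda>_. 1) (\<lambda>i t. sgn (pd_path i t 1) \<bullet> pd_dir i 1 * norm (pd_path i t 0) + norm (pd_path i t 1) * (sgn (pd_path i t 0) \<bullet> pd_dir i 0))"
    by (intro lip_family_add lip_family_0mult lip_family_norm lip_family_0inner lip_end lip_sgn_end lip_dir) auto
  show "lip_family Paths fst pd_quad ?Y"
    by (intro lip_family_add lip_family_mult0[OF _ ab] lip_family_mult0[OF _ last] lip_family_cmult lip_family_diff lip_powr_diff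
       lip_family_0mult[OF M lip_dlen_defect] lip_family_mult0[OF lip_powr_diff lip_family_0inner[OF lip_sgn_mean lip_dir_mean]])
  show "?Y i t = Psi \<alpha> (pd_path i t) (pd_dir i)" for i t
    unfolding Psi_def by (simp add: algebra_simps)
qed

end

text \<open>For a whole period \<open>p\<close> of the velocity starting at \<open>u\<close>, the numbers \<open>A\<close> and \<open>B\<close> are the lengths of the arcs over
  \<open>[u, u + 1/2]\<close> and \<open>[u - 1/2, u]\<close>, and \<open>rho\<close> is the integral over \<open>w\<close> of the difference between the integrands
  with the intrinsic distance and with the arc length.\<close>

definition rho :: "real \<Rightarrow> (real \<Rightarrow> 'a::euclidean_space) \<Rightarrow> real" where
  "rho \<alpha> p = (let A = plen (\<lambda>s. p (s / 2)) / 2; B = plen (\<lambda>s. p ((1 + s) / 2)) / 2 in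
     norm (p 0) * (A powr (1 - \<alpha>) + B powr (1 - \<alpha>) - 2 * ((A + B) / 2) powr (1 - \<alpha>)) / (\<alpha> - 1))"

definition drho :: "real \<Rightarrow> (real \<Rightarrow> 'a::euclidean_space) \<Rightarrow> (real \<Rightarrow> 'a) \<Rightarrow> real" where
  "drho \<alpha> p k = (let A = plen (\<lambda>s. p (s / 2)) / 2; B = plen (\<lambda>s. p ((1 + s) / 2)) / 2;
       A' = dplen (\<lambda>s. p (s / 2)) (\<lambda>s. k (s / 2)) / 2;
       B' = dplen (\<lambda>s. p ((1 + s) / 2)) (\<lambda>s. k ((1 + s) / 2)) / 2 in
     sgn (p 0) \<bullet> k 0 * (A powr (1 - \<alpha>) + B powr (1 - \<alpha>) - 2 * ((A + B) / 2) powr (1 - \<alpha>)) / (\<alpha> - 1)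
     - norm (p 0) * (A powr (-\<alpha>) * A' + B powr (-\<alpha>) * B' - ((A + B) / 2) powr (-\<alpha>) * (A' + B')))"

section \<open>Regularity of the correction term \<open>rho\<close>\<close>

lemma plen_ge:
  fixes p :: "real \<Rightarrow> 'a::euclidean_space"
  assumes "continuous_on {0..1} p" "\<And>s. s \<in> {0..1} \<Longrightarrow> c \<le> norm (p s)"
  shows "c \<le> plen p"
proof -
  have "integral {0..1} (\<lambda>s::real. c) \<le> plen p"
    unfolding plen_def using assms by (intro integral_le integrable_continuous_real continuous_intros) auto
  then show ?thesis by simp
qed

context
  fixes c C :: real and g :: "real \<Rightarrow> real"
  assumes c: "0 < c" "c \<le> C" and g: "continuous_on {0..1} g" "\<And>s. s \<in> {0..1} \<Longrightarrow> g s \<in> {0..1}"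
begin

lemma pd_comp:
  assumes "i \<in> path_data c C"
  shows "0 \<le> fst i" "s \<in> {0..1} \<Longrightarrow> c \<le> norm (pd_path i t (g s))" "s \<in> {0..1} \<Longrightarrow> norm (pd_dir i (g s)) \<le> 1"
  using path_dataD(1,5,7)[OF assms] g(2) by (auto intro: less_imp_le)

lemma lip_dir_comp: "lip_family (path_data c C \<times> {0..1}) (\<lambda>x. fst (fst x)) (\<lambda>_. 1) (\<lambda>x t. pd_dir (fst x) (g (snd x)))"
  by (rule lip_family_indep[where C=1])
     (simp_all add: mem_Times_iff pd_comp)

lemma lip_path_comp: "lip_family (path_data c C \<times> {0..1}) (\<lambda>x. fst (fst x)) (\<lambda>_. 1) (\<lambda>x t. pd_path (fst x) t (g (snd x)))"
  by (rule lip_pd_path[OF _ subset_refl g(2)]) (use c in auto)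

lemma lip_sgn_comp: "lip_family (path_data c C \<times> {0..1}) (\<lambda>x. fst (fst x)) (\<lambda>_. 1) (\<lambda>x t. sgn (pd_path (fst x) t (g (snd x))))"
  unfolding sgn_div_norm
  by (rule lip_family_0scaleR[OF lip_family_inverse[OF lip_family_norm[OF lip_path_comp] c(1)] lip_path_comp])
     (simp add: mem_Times_iff pd_comp)

lemma cont_path_comp: "i \<in> path_data c C \<Longrightarrow> continuous_on {0..1} (\<lambda>s. pd_path i t (g s))"
  by (rule continuous_on_compose2[OF path_dataD(3) g(1)], assumption) (rule image_subsetI, rule g(2))

lemma cont_dir_comp: "i \<in> path_data c C \<Longrightarrow> continuous_on {0..1} (\<lambda>s. pd_dir i (g s))"
  by (rule continuous_on_compose2[OF path_dataD(4) g(1)], assumption) (rule image_subsetI, rule g(2))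

lemma path_comp_nz: "i \<in> path_data c C \<Longrightarrow> s \<in> {0..1} \<Longrightarrow> pd_path i t (g s) \<noteq> 0"
  using path_dataD(5)[OF _ g(2), of i c C s t] c(1) by auto

lemma lip_plen_comp: "lip_family (path_data c C) fst (\<lambda>_. 1) (\<lambda>i t. plen (\<lambda>s. pd_path i t (g s)))"
  unfolding plen_def
  by (rule lip_family_integral1[OF lip_family_norm[OF lip_path_comp], unfolded fst_conv snd_conv])
     (intro continuous_intros cont_path_comp)

lemma lip_dplen_comp: "lip_family (path_data c C) fst (\<lambda>_. 1) (\<lambda>i t. dplen (\<lambda>s. pd_path i t (g s)) (\<lambda>s. pd_dir i (g s)))"
  unfolding dplen_def
  by (rule lip_family_integral1[OF lip_family_0inner[OF lip_sgn_comp lip_dir_comp], unfolded fst_conv snd_conv])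
     (intro continuous_intros cont_path_comp cont_dir_comp path_comp_nz)

lemma plen_comp_ge: "i \<in> path_data c C \<Longrightarrow> c \<le> plen (\<lambda>s. pd_path i t (g s))"
  by (intro plen_ge cont_path_comp path_dataD(5) g)

end

text \<open>The weight is 1 since no singularity in \<open>w\<close> has to be compensated: both
  half arcs have length at least \<open>c / 2\<close>, so all powers are harmless.\<close>

lemma lip_drho:
  assumes c: "0 < c" "c \<le> C"
  shows "lip_family (path_data c C :: (real \<times> (real \<Rightarrow> 'a::euclidean_space) \<times> (real \<Rightarrow> 'a) \<times> (real \<Rightarrow> 'a)) set)
      fst (\<lambda>_. 1) (\<lambda>i t. drho \<alpha> (pd_path i t) (pd_dir i))"
proof -
  have g1: "continuous_on {0..1} (\<lambda>s::real. s / 2)" "\<And>s::real. s \<in> {0..1} \<Longrightarrow> s / 2 \<in> {0..1}"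
   and g2: "continuous_on {0..1} (\<lambda>s::real. (1 + s) / 2)" "\<And>s::real. s \<in> {0..1} \<Longrightarrow> (1 + s) / 2 \<in> {0..1}"
   and g0: "continuous_on {0..1} (\<lambda>s::real. 0::real)" "\<And>s::real. s \<in> {0..1} \<Longrightarrow> (0::real) \<in> {0..1}"
    by (auto intro!: continuous_intros)
  let ?A = "\<lambda>i t. plen (\<lambda>s. pd_path i t (s / 2)) / 2" and ?B = "\<lambda>i t. plen (\<lambda>s. pd_path i t ((1 + s) / 2)) / 2"
  let ?S = "path_data c C :: (real \<times> (real \<Rightarrow> 'a::euclidean_space) \<times> (real \<Rightarrow> 'a) \<times> (real \<Rightarrow> 'a)) set"
  note cc = lip_family_cmult[where c="1/2", simplified]
  have A: "lip_family ?S fst (\<lambda>_. 1) ?A" and B: "lip_family ?S fst (\<lambda>_. 1) ?B"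
    using cc[OF lip_plen_comp[OF c g1]] cc[OF lip_plen_comp[OF c g2]] by simp_all
  have A': "lip_family ?S fst (\<lambda>_. 1) (\<lambda>i t. dplen (\<lambda>s. pd_path i t (s / 2)) (\<lambda>s. pd_dir i (s / 2)) / 2)"
   and B': "lip_family ?S fst (\<lambda>_. 1) (\<lambda>i t. dplen (\<lambda>s. pd_path i t ((1 + s) / 2)) (\<lambda>s. pd_dir i ((1 + s) / 2)) / 2)"
    using cc[OF lip_dplen_comp[OF c g1]] cc[OF lip_dplen_comp[OF c g2]] by simp_all
  have AB: "lip_family ?S fst (\<lambda>_. 1) (\<lambda>i t. (?A i t + ?B i t) / 2)"
    using cc[OF lip_family_add[OF A B]] by simp
  have A0: "i \<in> ?S \<Longrightarrow> c / 2 \<le> ?A i t" and B0: "i \<in> ?S \<Longrightarrow> c / 2 \<le> ?B i t" for i t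
    using plen_comp_ge[OF c g1, of i t] plen_comp_ge[OF c g2, of i t] by simp_all
  have AB0: "i \<in> ?S \<Longrightarrow> c / 2 \<le> (?A i t + ?B i t) / 2" for i t
    using A0[of i t] B0[of i t] by argo
  have c2: "0 < c / 2" using c by simp
  note pw = lip_family_powr[OF A c2 A0] lip_family_powr[OF B c2 B0] lip_family_powr[OF AB c2 AB0]
  \<comment> \<open>Evaluation at 0 is obtained by integrating the constant
    reparametrization.\<close>
  have i0: "lip_family ?S fst (\<lambda>_. 1) (\<lambda>i t. pd_path i t 0)"
    using lip_family_integral1[OF lip_path_comp[OF c g0], unfolded fst_conv snd_conv] by simp
  have s0: "lip_family ?S fst (\<lambda>_. 1) (\<lambda>i t. sgn (pd_path i t 0))"
    using lip_family_integral1[OF lip_sgn_comp[OF c g0], unfolded fst_conv snd_conv] by simp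
  have d0: "lip_family ?S fst (\<lambda>_. 1) (\<lambda>i t. pd_dir i 0)"
    using lip_family_integral1[OF lip_dir_comp[OF c g0], unfolded fst_conv snd_conv] by simp
  note rules = lip_family_add lip_family_diff lip_family_cmult lip_family_0mult pw A' B'
       lip_family_0inner s0 d0 lip_family_norm i0
  have q: "lip_family ?S fst (\<lambda>_. 1) (\<lambda>i t. 1 / (\<alpha> - 1))"
    by (rule lip_family_const'[OF i0])
  show "lip_family ?S fst (\<lambda>_. 1) (\<lambda>i t. drho \<alpha> (pd_path i t) (pd_dir i))"
  proof (rule lip_family_cong)
    show "lip_family ?S fst (\<lambda>_. 1) (\<lambda>i t. (1 / (\<alpha> - 1)) * (sgn (pd_path i t 0) \<bullet> pd_dir i 0 *
       (?A i t powr (1 - \<alpha>) + ?B i t powr (1 - \<alpha>) - 2 * ((?A i t + ?B i t) / 2) powr (1 - \<alpha>)))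
       - norm (pd_path i t 0) * (?A i t powr (-\<alpha>) * (dplen (\<lambda>s. pd_path i t (s / 2)) (\<lambda>s. pd_dir i (s / 2)) / 2)
         + ?B i t powr (-\<alpha>) * (dplen (\<lambda>s. pd_path i t ((1 + s) / 2)) (\<lambda>s. pd_dir i ((1 + s) / 2)) / 2)
         - ((?A i t + ?B i t) / 2) powr (-\<alpha>) * (dplen (\<lambda>s. pd_path i t (s / 2)) (\<lambda>s. pd_dir i (s / 2)) / 2
          + dplen (\<lambda>s. pd_path i t ((1 + s) / 2)) (\<lambda>s. pd_dir i ((1 + s) / 2)) / 2)))"
      by (intro rules)
  qed (simp add: drho_def Let_def)
qed

lemma rho_line_derivative:
  fixes p k :: "real \<Rightarrow> 'a::euclidean_space"
  assumes p: "continuous_on {0..1} p" and k: "continuous_on {0..1} k" and c: "0 < c"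
    and nz: "\<And>t s. t \<in> {0..1} \<Longrightarrow> s \<in> {0..1} \<Longrightarrow> c \<le> norm (p s + t *\<^sub>R k s)" and t: "t \<in> {0..1}"
    and \<alpha>: "\<alpha> > 1"
  shows "((\<lambda>t. rho \<alpha> (\<lambda>s. p s + t *\<^sub>R k s)) has_real_derivative drho \<alpha> (\<lambda>s. p s + t *\<^sub>R k s) k) (at t within {0..1})"
proof -
  have *: "((\<lambda>t. plen (\<lambda>s. p (g s) + t *\<^sub>R k (g s))) has_real_derivative
      dplen (\<lambda>s. p (g s) + t *\<^sub>R k (g s)) (\<lambda>s. k (g s))) (at t within {0..1}) \<and>
      0 < plen (\<lambda>s. p (g s) + t *\<^sub>R k (g s))"
    if g: "continuous_on {0..1} g" "\<And>s. s \<in> {0..1} \<Longrightarrow> g s \<in> {0..1}" for g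
  proof
    have pg: "continuous_on {0..1} (\<lambda>s. p (g s))" "continuous_on {0..1} (\<lambda>s. k (g s))"
      by (rule continuous_on_compose2[OF p g(1)] continuous_on_compose2[OF k g(1)]; rule image_subsetI, rule g(2), assumption)+
    have n: "p (g s) + t *\<^sub>R k (g s) \<noteq> 0" if "t \<in> {0..1}" "s \<in> {0..1}" for t s
      using nz[OF that(1) g(2)[OF that(2)]] c by auto
    show "((\<lambda>t. plen (\<lambda>s. p (g s) + t *\<^sub>R k (g s))) has_real_derivative
      dplen (\<lambda>s. p (g s) + t *\<^sub>R k (g s)) (\<lambda>s. k (g s))) (at t within {0..1})"
      by (rule plen_line_derivative[OF pg n t])
    have "c \<le> plen (\<lambda>s. p (g s) + t *\<^sub>R k (g s))"
      by (intro plen_ge continuous_intros pg nz t g)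
    then show "0 < plen (\<lambda>s. p (g s) + t *\<^sub>R k (g s))" using c by linarith
  qed
  have g1: "continuous_on {0..1} (\<lambda>s::real. s / 2)" "\<And>s::real. s \<in> {0..1} \<Longrightarrow> s / 2 \<in> {0..1}"
   and g2: "continuous_on {0..1} (\<lambda>s::real. (1 + s) / 2)" "\<And>s::real. s \<in> {0..1} \<Longrightarrow> (1 + s) / 2 \<in> {0..1}"
    by (auto intro!: continuous_intros)
  have 1: "((\<lambda>t. plen (\<lambda>s. p (s / 2) + t *\<^sub>R k (s / 2))) has_real_derivative
      dplen (\<lambda>s. p (s / 2) + t *\<^sub>R k (s / 2)) (\<lambda>s. k (s / 2))) (at t within {0..1})"
      "0 < plen (\<lambda>s. p (s / 2) + t *\<^sub>R k (s / 2))"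
    using *[OF g1] by simp_all
  have 2: "((\<lambda>t. plen (\<lambda>s. p ((1 + s) / 2) + t *\<^sub>R k ((1 + s) / 2))) has_real_derivative
      dplen (\<lambda>s. p ((1 + s) / 2) + t *\<^sub>R k ((1 + s) / 2)) (\<lambda>s. k ((1 + s) / 2))) (at t within {0..1})"
      "0 < plen (\<lambda>s. p ((1 + s) / 2) + t *\<^sub>R k ((1 + s) / 2))"
    using *[OF g2] by simp_all
  have 3: "((\<lambda>t. norm (p 0 + t *\<^sub>R k 0)) has_real_derivative sgn (p 0 + t *\<^sub>R k 0) \<bullet> k 0) (at t within {0..1})"
    using nz[OF t, of 0] c by (intro norm_line_derivative) auto
  define A where "A t = plen (\<lambda>s. p (s / 2) + t *\<^sub>R k (s / 2)) / 2" for t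
  define B where "B t = plen (\<lambda>s. p ((1 + s) / 2) + t *\<^sub>R k ((1 + s) / 2)) / 2" for t
  define A' where "A' = dplen (\<lambda>s. p (s / 2) + t *\<^sub>R k (s / 2)) (\<lambda>s. k (s / 2)) / 2"
  define B' where "B' = dplen (\<lambda>s. p ((1 + s) / 2) + t *\<^sub>R k ((1 + s) / 2)) (\<lambda>s. k ((1 + s) / 2)) / 2"
  have dA: "(A has_real_derivative A') (at t within {0..1})" unfolding A_def[abs_def] A'_def
    by (rule DERIV_cdivide[OF 1(1)])
  have dB: "(B has_real_derivative B') (at t within {0..1})" unfolding B_def[abs_def] B'_def
    by (rule DERIV_cdivide[OF 2(1)])
  have pos: "A t > 0" "B t > 0" using 1(2) 2(2) by (auto simp: A_def B_def)
  define N where "N t = norm (p 0 + t *\<^sub>R k 0)" for t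
  define N' where "N' = sgn (p 0 + t *\<^sub>R k 0) \<bullet> k 0"
  have dN: "(N has_real_derivative N') (at t within {0..1})" using 3 by (simp add: N_def[abs_def] N'_def)
  have dP: "((\<lambda>t. X t powr (1 - \<alpha>)) has_real_derivative (1 - \<alpha>) * X t powr (-\<alpha>) * X') (at t within {0..1})"
    if "(X has_real_derivative X') (at t within {0..1})" "X t > 0" for X X'
    using DERIV_chain2[OF has_real_derivative_powr[OF that(2), of "1 - \<alpha>"] that(1)] by simp
  have dM: "((\<lambda>t. (A t + B t) / 2) has_real_derivative (A' + B') / 2) (at t within {0..1})"
    by (intro DERIV_cdivide DERIV_add dA dB)
  have "((\<lambda>t. N t * (A t powr (1 - \<alpha>) + B t powr (1 - \<alpha>) - 2 * ((A t + B t) / 2) powr (1 - \<alpha>)) / (\<alpha> - 1)) has_real_derivative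
     (N' * (A t powr (1 - \<alpha>) + B t powr (1 - \<alpha>) - 2 * ((A t + B t) / 2) powr (1 - \<alpha>))
       + ((1 - \<alpha>) * A t powr (-\<alpha>) * A' + (1 - \<alpha>) * B t powr (-\<alpha>) * B' - 2 * ((1 - \<alpha>) * ((A t + B t) / 2) powr (-\<alpha>) * ((A' + B') / 2))) * N t) / (\<alpha> - 1))
     (at t within {0..1})"
    using pos by (intro DERIV_cdivide DERIV_mult dN DERIV_diff DERIV_add DERIV_cmult dP[OF dA] dP[OF dB] dP[OF dM]) auto
  \<comment> \<open>The exponent \<open>1 - \<alpha>\<close> brought down by differentiation cancels
    against the denominator \<open>\<alpha> - 1\<close>, which accounts for the sign and the missing
    quotient in the second part of \<open>drho\<close>.\<close>
  moreover have "(N' * Q + ((1 - \<alpha>) * a * A' + (1 - \<alpha>) * b * B' - 2 * ((1 - \<alpha>) * m * ((A' + B') / 2))) * n) / (\<alpha> - 1)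
     = N' * Q / (\<alpha> - 1) - n * (a * A' + b * B' - m * (A' + B'))" for Q a b m n
  proof -
    have "((1 - \<alpha>) * a * A' + (1 - \<alpha>) * b * B' - 2 * ((1 - \<alpha>) * m * ((A' + B') / 2))) * n
      = - (n * (a * A' + b * B' - m * (A' + B'))) * (\<alpha> - 1)" by (simp add: field_simps)
    then show ?thesis using \<alpha> by (simp add: add_divide_distrib diff_divide_distrib)
  qed
  ultimately show ?thesis
    by (simp add: rho_def drho_def Let_def A_def[symmetric] B_def[symmetric] A'_def[symmetric] B'_def[symmetric]
      N_def[symmetric] N'_def[symmetric])
qed

section \<open>Mean squares of increments and the Gagliardo seminorm\<close>

definition Qinc :: "(real \<Rightarrow> 'a::euclidean_space) \<Rightarrow> real" where
  "Qinc p = integral {0..1} (\<lambda>s. (norm (p s - p 0))\<^sup>2)"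

lemma Qinc_nonneg: "continuous_on {0..1} p \<Longrightarrow> 0 \<le> Qinc p"
  unfolding Qinc_def by (intro integral_nonneg integrable_continuous_real continuous_intros) auto

text \<open>The mean minimizes the mean square deviation, the cross term having integral zero.
  Deviations from the mean suit the algebra of defects, those from the base point \<open>p 0\<close>
  suit the Gagliardo integrand.\<close>

lemma variance_le_Qinc:
  fixes p :: "real \<Rightarrow> 'a::euclidean_space"
  assumes p: "continuous_on {0..1} p"
  shows "integral {0..1} (\<lambda>s. (norm (p s - pmean p))\<^sup>2) \<le> Qinc p"
proof -
  let ?d = "pmean p - p 0"
  have lin: "integral {0..1} (\<lambda>s. (p s - pmean p) \<bullet> ?d) = 0"
  proof -
    have "integral {0..1} (\<lambda>s. (p s - pmean p) \<bullet> ?d) = integral {0..1} (\<lambda>s. p s - pmean p) \<bullet> ?d"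
      using integral_linear[OF integrable_continuous_real bounded_linear_inner_left, of 0 1 "\<lambda>s. p s - pmean p" ?d]
        p by (simp add: o_def continuous_intros)
    also have "integral {0..1} (\<lambda>s. p s - pmean p) = pmean p - pmean p"
      by (subst integral_diff) (auto intro!: integrable_continuous_real p simp: pmean_def)
    finally show ?thesis by simp
  qed
  have e: "(norm (p s - p 0))\<^sup>2 = (norm (p s - pmean p))\<^sup>2 + (2 * ((p s - pmean p) \<bullet> ?d) + (norm ?d)\<^sup>2)" for s
  proof -
    have "p s - p 0 = (p s - pmean p) + ?d" by simp
    then have "(norm (p s - p 0))\<^sup>2 = (norm ((p s - pmean p) + ?d))\<^sup>2" by presburger
    then show ?thesis by (simp only: power2_norm_eq_inner inner_add_left inner_add_right inner_commute)
  qed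
  have ints: "(\<lambda>s. (norm (p s - pmean p))\<^sup>2) integrable_on {0..1}" "(\<lambda>s. 2 * ((p s - pmean p) \<bullet> ?d)) integrable_on {0..1}"
    by (intro integrable_continuous_real continuous_intros p)+
  have "Qinc p = integral {0..1} (\<lambda>s. (norm (p s - pmean p))\<^sup>2) + (integral {0..1} (\<lambda>s. 2 * ((p s - pmean p) \<bullet> ?d)) + integral {0..1} (\<lambda>s::real. (norm ?d)\<^sup>2))"
    unfolding Qinc_def e
    by (simp only: integral_add[OF ints(1) integrable_add[OF ints(2) integrable_const_ivl]] integral_add[OF ints(2) integrable_const_ivl])
  also have "\<dots> = integral {0..1} (\<lambda>s. (norm (p s - pmean p))\<^sup>2) + (norm ?d)\<^sup>2"
    by (simp add: lin)
  finally show ?thesis by simp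
qed

lemma pd_quad_le:
  assumes "(\<nu>, p, p', k) \<in> path_data c C"
  shows "pd_quad (\<nu>, p, p', k) \<le> 3 * (Qinc p + Qinc (\<lambda>s. (p' s - p s) /\<^sub>R \<nu>) + Qinc k)"
proof -
  define f where "f = (\<lambda>s. (p' s - p s) /\<^sub>R \<nu>)"
  have cont: "continuous_on {0..1} p" "continuous_on {0..1} f" "continuous_on {0..1} k"
    using assms by (auto simp: path_data_def f_def intro!: continuous_intros)
  let ?v = "\<lambda>p s. (norm (p s - pmean p))\<^sup>2"
  have ints: "(\<lambda>s. ?v q s) integrable_on {0..1}" if "continuous_on {0..1} q" for q :: "real \<Rightarrow> 'a"
    by (intro integrable_continuous_real continuous_intros that)
  have "(x + y + z)\<^sup>2 \<le> 3 * (x\<^sup>2 + y\<^sup>2 + z\<^sup>2)" for x y z :: real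
    using zero_le_power2[of "x - y"] zero_le_power2[of "y - z"] zero_le_power2[of "x - z"]
    by (simp add: power2_eq_square algebra_simps)
  then have "(pd_inc (\<nu>, p, p', k) s)\<^sup>2 \<le> 3 * (?v p s + ?v f s + ?v k s)" for s
    by (simp add: pd_inc_def f_def)
  then have "pd_quad (\<nu>, p, p', k) \<le> integral {0..1} (\<lambda>s. 3 * (?v p s + ?v f s + ?v k s))"
    unfolding pd_quad_def
    by (intro integral_le integrable_continuous_real continuous_intros cont pd_inc_continuous[OF assms])
  also have "\<dots> = 3 * (integral {0..1} (?v p) + integral {0..1} (?v f) + integral {0..1} (?v k))"
    by (simp add: integral_add ints cont integrable_add)
  also have "\<dots> \<le> 3 * (Qinc p + Qinc f + Qinc k)"
    using variance_le_Qinc[OF cont(1)] variance_le_Qinc[OF cont(2)] variance_le_Qinc[OF cont(3)] by simp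
  finally show ?thesis unfolding f_def .
qed

lemma Psi_bounds:
  fixes c C :: real
  assumes "0 < c" "c \<le> C"
  obtains K where "K \<ge> 0"
    "\<And>\<nu> p p' k :: real \<Rightarrow> 'a::euclidean_space. (\<nu>, p, p', k) \<in> path_data_mean c C \<Longrightarrow>
       \<bar>Phi \<alpha> p\<bar> \<le> K * (Qinc p + Qinc (\<lambda>s. (p' s - p s) /\<^sub>R \<nu>) + Qinc k)"
    "\<And>\<nu> p p' k :: real \<Rightarrow> 'a::euclidean_space. (\<nu>, p, p', k) \<in> path_data_mean c C \<Longrightarrow>
       \<bar>Psi \<alpha> p k\<bar> \<le> K * (Qinc p + Qinc (\<lambda>s. (p' s - p s) /\<^sub>R \<nu>) + Qinc k)"
    "\<And>\<nu> p p' k :: real \<Rightarrow> 'a::euclidean_space. (\<nu>, p, p', k) \<in> path_data_mean c C \<Longrightarrow>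
       \<bar>Psi \<alpha> p' k - Psi \<alpha> p k\<bar> \<le> K * \<nu> * (Qinc p + Qinc (\<lambda>s. (p' s - p s) /\<^sub>R \<nu>) + Qinc k)"
proof -
  obtain K1 where K1: "K1 \<ge> 0" "\<And>i t. i \<in> path_data_mean c C \<Longrightarrow> norm (Phi \<alpha> (pd_path i t :: real \<Rightarrow> 'a)) \<le> K1 * pd_quad i"
    using lip_Phi[OF assms, of \<alpha>] by (rule lip_familyE) (rule that; blast)
  obtain K2 where K2: "K2 \<ge> 0" "\<And>i t. i \<in> path_data_mean c C \<Longrightarrow> norm (Psi \<alpha> (pd_path i t :: real \<Rightarrow> 'a) (pd_dir i)) \<le> K2 * pd_quad i"
    "\<And>i. i \<in> path_data_mean c C \<Longrightarrow> norm (Psi \<alpha> (pd_path i True :: real \<Rightarrow> 'a) (pd_dir i) - Psi \<alpha> (pd_path i False) (pd_dir i)) \<le> K2 * (fst i * pd_quad i)"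
    using lip_Psi[OF assms, of \<alpha>] by (rule lip_familyE) (rule that; blast)
  define K where "K = 3 * (K1 + K2)"
  have K: "K \<ge> 0" using K1 K2 by (simp add: K_def)
  have le: "x \<le> K * q" if "x \<le> L * pd_quad (\<nu>, p, p', k)" "L = K1 \<or> L = K2" "(\<nu>, p, p', k) \<in> path_data_mean c C"
      "q = Qinc p + Qinc (\<lambda>s. (p' s - p s) /\<^sub>R \<nu>) + Qinc k" for x L q \<nu> and p p' k :: "real \<Rightarrow> 'a"
  proof -
    have L: "0 \<le> L" "L \<le> K1 + K2" using that(2) K1 K2 by auto
    have pd: "(\<nu>, p, p', k) \<in> path_data c C" using that(3) by (rule path_data_meanD)
    have q: "pd_quad (\<nu>, p, p', k) \<le> 3 * q" using pd_quad_le[OF pd] that(4) by simp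
    have q0: "0 \<le> q" using pd unfolding that(4) path_data_def
      by (auto intro!: add_nonneg_nonneg Qinc_nonneg continuous_intros)
    have "x \<le> L * (3 * q)" using that(1) mult_left_mono[OF q L(1)] by linarith
    also have "\<dots> \<le> (K1 + K2) * (3 * q)" using L q0 by (intro mult_right_mono) auto
    finally show ?thesis by (simp add: K_def mult_ac)
  qed
  show ?thesis
  proof (rule that[OF K])
    fix \<nu> and p p' k :: "real \<Rightarrow> 'a" assume i: "(\<nu>, p, p', k) \<in> path_data_mean c C"
    let ?q = "Qinc p + Qinc (\<lambda>s. (p' s - p s) /\<^sub>R \<nu>) + Qinc k"
    show "\<bar>Phi \<alpha> p\<bar> \<le> K * ?q"
      by (rule le[OF _ _ i refl, where L=K1]) (use K1(2)[OF i, of False] in \<open>auto simp: pd_path_def\<close>)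
    show "\<bar>Psi \<alpha> p k\<bar> \<le> K * ?q"
      by (rule le[OF _ _ i refl, where L=K2]) (use K2(2)[OF i, of False] in \<open>auto simp: pd_path_def pd_dir_def\<close>)
    have nu: "0 < \<nu>" using path_dataD(1)[OF path_data_meanD(1)[OF i]] by simp
    \<comment> \<open>Divided by \<open>\<nu>\<close>, the bound on differences has the same shape
      as the bounds on values, so \<open>le\<close> covers it.\<close>
    have "\<bar>Psi \<alpha> p' k - Psi \<alpha> p k\<bar> / \<nu> \<le> K * ?q"
      by (rule le[OF _ _ i refl, where L=K2]) (use K2(3)[OF i] nu in \<open>auto simp: pd_path_def pd_dir_def field_simps\<close>)
    then show "\<bar>Psi \<alpha> p' k - Psi \<alpha> p k\<bar> \<le> K * \<nu> * ?q"
      using nu by (simp add: field_simps)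
  qed
qed

lemma drho_bounds:
  fixes c C :: real
  assumes "0 < c" "c \<le> C"
  obtains K where "K \<ge> 0"
    "\<And>\<nu> p p' k :: real \<Rightarrow> 'a::euclidean_space. (\<nu>, p, p', k) \<in> path_data c C \<Longrightarrow> \<bar>drho \<alpha> p k\<bar> \<le> K"
    "\<And>\<nu> p p' k :: real \<Rightarrow> 'a::euclidean_space. (\<nu>, p, p', k) \<in> path_data c C \<Longrightarrow> \<bar>drho \<alpha> p' k - drho \<alpha> p k\<bar> \<le> K * \<nu>"
proof -
  obtain K2 where K2: "K2 \<ge> 0" "\<And>i t. i \<in> path_data c C \<Longrightarrow> norm (drho \<alpha> (pd_path i t :: real \<Rightarrow> 'a) (pd_dir i)) \<le> K2 * 1"
    "\<And>i. i \<in> path_data c C \<Longrightarrow> norm (drho \<alpha> (pd_path i True :: real \<Rightarrow> 'a) (pd_dir i) - drho \<alpha> (pd_path i False) (pd_dir i)) \<le> K2 * (fst i * 1)"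
    using lip_drho[OF assms, of \<alpha>] by (rule lip_familyE) (rule that; blast)
  show ?thesis
  proof (rule that[OF K2(1)])
    fix \<nu> and p p' k :: "real \<Rightarrow> 'a" assume i: "(\<nu>, p, p', k) \<in> path_data c C"
    show "\<bar>drho \<alpha> p k\<bar> \<le> K2" using K2(2)[OF i, of False] by (simp add: pd_path_def pd_dir_def)
    show "\<bar>drho \<alpha> p' k - drho \<alpha> p k\<bar> \<le> K2 * \<nu>" using K2(3)[OF i] by (simp add: pd_path_def pd_dir_def)
  qed
qed

definition seg :: "(real \<Rightarrow> 'a) \<Rightarrow> real \<Rightarrow> real \<Rightarrow> real \<Rightarrow> 'a" where
  "seg g u w s = g (u + s * w)"

lemma seg_continuous: "continuous_on UNIV g \<Longrightarrow> continuous_on S (seg g u w)"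
  unfolding seg_def[abs_def] by (rule continuous_on_compose2[of UNIV g]) (auto intro!: continuous_intros)

text \<open>For fixed \<open>s\<close> the substitution of \<open>s * w\<close> for \<open>w\<close>
  produces the factor \<open>s powr (\<alpha> - 1)\<close>, which is at most 1, and a smaller range
  of integration. Averaging over \<open>s\<close> in the unit interval therefore costs no
  constant.\<close>

lemma nn_integral_Qinc_le:
  fixes g :: "real \<Rightarrow> real^'n"
  assumes g: "continuous_on UNIV g" and \<alpha>: "1 < \<alpha>"
  shows "(\<integral>\<^sup>+w\<in>{-1/2..1/2}. ennreal (\<bar>w\<bar> powr (-\<alpha>) * Qinc (seg g u w)) \<partial>lborel)
    \<le> (\<integral>\<^sup>+w\<in>{-1/2..1/2}. ennreal ((norm (g (u + w) - g u))\<^sup>2 / \<bar>w\<bar> powr \<alpha>) \<partial>lborel)"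
proof -
  have [measurable]: "g \<in> borel_measurable borel" using g by (rule borel_measurable_continuous_onI)
  let ?G = "\<lambda>w. ennreal ((norm (g (u + w) - g u))\<^sup>2 / \<bar>w\<bar> powr \<alpha>)"
  let ?F = "\<lambda>w s. ennreal (\<bar>w\<bar> powr (-\<alpha>) * (norm (g (u + s * w) - g u))\<^sup>2)"
  have 1: "ennreal (\<bar>w\<bar> powr (-\<alpha>) * Qinc (seg g u w)) = (\<integral>\<^sup>+s. indicator {0..1} s * ?F w s \<partial>lborel)" for w
  proof -
    have cont: "continuous_on {0..1} (\<lambda>s. (norm (g (u + s * w) - g u))\<^sup>2)"
      using seg_continuous[OF g, of "{0..1}" u w] unfolding seg_def[abs_def] by (intro continuous_intros)
    have "((\<lambda>s. \<bar>w\<bar> powr (-\<alpha>) * (norm (g (u + s * w) - g u))\<^sup>2) has_integral \<bar>w\<bar> powr (-\<alpha>) * Qinc (seg g u w)) {0..1}"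
      using integrable_integral[OF integrable_continuous_real[OF cont]]
      unfolding Qinc_def seg_def by (intro has_integral_mult_right) simp
    from nn_integral_has_integral_lebesgue'[OF _ this]
    show ?thesis by (simp add: mult.commute)
  qed
  have "(\<integral>\<^sup>+w\<in>{-1/2..1/2}. ennreal (\<bar>w\<bar> powr (-\<alpha>) * Qinc (seg g u w)) \<partial>lborel)
     = (\<integral>\<^sup>+w. (\<integral>\<^sup>+s. indicator {0..1} s * ?F w s * indicator {-1/2..1/2} w \<partial>lborel) \<partial>lborel)"
    unfolding 1 by (intro nn_integral_cong nn_integral_multc[symmetric]) measurable
  also have "\<dots> = (\<integral>\<^sup>+s. (\<integral>\<^sup>+w. indicator {0..1} s * ?F w s * indicator {-1/2..1/2} w \<partial>lborel) \<partial>lborel)"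
    by (rule lborel_pair.Fubini') measurable
  also have "\<dots> \<le> (\<integral>\<^sup>+s. indicator {0..1} (s::real) * (\<integral>\<^sup>+w\<in>{-1/2..1/2}. ?G w \<partial>lborel) \<partial>lborel)"
  proof (rule nn_integral_mono)
    fix s :: real
    show "(\<integral>\<^sup>+w. indicator {0..1} s * ?F w s * indicator {-1/2..1/2} w \<partial>lborel)
       \<le> indicator {0..1} s * (\<integral>\<^sup>+w\<in>{-1/2..1/2}. ?G w \<partial>lborel)"
    proof (cases "s \<in> {0<..1}")
      case False
      have "?F w 0 = 0" for w by simp
      with False show ?thesis by (cases "s = 0") (auto simp: indicator_def)
    next
      case True
      then have s: "0 < s" "s \<le> 1" by auto
      have "(\<integral>\<^sup>+w. ?F w s * indicator {-1/2..1/2} w \<partial>lborel)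
         \<le> (\<integral>\<^sup>+w. ennreal s * (?G (s * w) * indicator {-s/2..s/2} (s * w)) \<partial>lborel)"
      proof (rule nn_integral_mono)
        fix w :: real
        have i: "indicator {-s/2..s/2} (s * w) = (indicator {-1/2..1/2} w :: ennreal)"
          using mult_le_cancel_left_pos[OF s(1), of "-1/2" w] mult_le_cancel_left_pos[OF s(1), of w "1/2"]
          by (auto simp: indicator_def)
        \<comment> \<open>The factor \<open>s\<close> to be extracted is the Jacobian of the
          substitution; the surplus \<open>s powr (1 - \<alpha>)\<close> is at least 1 and may be
          inserted.\<close>
        have "s powr (1 - \<alpha>) \<ge> 1" using s \<alpha> by (simp add: ge_one_powr_ge_zero powr_mono2' [of "1-\<alpha>" s 1, simplified])
        then have "\<bar>w\<bar> powr (-\<alpha>) * (norm (g (u + s * w) - g u))\<^sup>2 \<le> s powr (1 - \<alpha>) * (\<bar>w\<bar> powr (-\<alpha>) * (norm (g (u + s * w) - g u))\<^sup>2)"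
          using mult_right_mono[of 1 "s powr (1 - \<alpha>)" "\<bar>w\<bar> powr (-\<alpha>) * (norm (g (u + s * w) - g u))\<^sup>2"] by simp
        also have "\<dots> = s * ((norm (g (u + s * w) - g u))\<^sup>2 / \<bar>s * w\<bar> powr \<alpha>)"
          using s by (simp add: abs_mult powr_mult powr_minus powr_diff field_simps)
        finally have "?F w s \<le> ennreal s * ?G (s * w)"
          using s by (simp add: ennreal_mult'[symmetric] ennreal_leI)
        then show "?F w s * indicator {-1/2..1/2} w \<le> ennreal s * (?G (s * w) * indicator {-s/2..s/2} (s * w))"
          unfolding i by (simp add: mult.assoc[symmetric] mult_right_mono)
      qed
      also have "\<dots> = \<bar>s\<bar> * (\<integral>\<^sup>+w. ?G (0 + s * w) * indicator {-s/2..s/2} (0 + s * w) \<partial>lborel)"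
        using s by (simp add: nn_integral_cmult)
      also have "\<dots> = (\<integral>\<^sup>+w. ?G w * indicator {-s/2..s/2} w \<partial>lborel)"
        using s by (intro nn_integral_real_affine[symmetric]) auto
      also have "\<dots> \<le> (\<integral>\<^sup>+w\<in>{-1/2..1/2}. ?G w \<partial>lborel)"
        using s by (intro nn_integral_mono) (auto simp: indicator_def)
      finally show ?thesis using s by simp
    qed
  qed
  also have "\<dots> = (\<integral>\<^sup>+w\<in>{-1/2..1/2}. ?G w \<partial>lborel)"
    by (subst nn_integral_multc) auto
  finally show ?thesis .
qed

section \<open>The Sobolev embedding\<close>

lemma periodic1_int: "periodic1 F \<Longrightarrow> F (x + of_int n) = F x"
proof (induction n arbitrary: x)
  case (nonneg n)
  then show ?case
  proof (induction n arbitrary: x)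
    case (Suc n)
    have "F (x + of_int (int (Suc n))) = F ((x + of_int (int n)) + 1)" by (simp add: algebra_simps)
    then show ?case using Suc by (simp add: periodic1_def)
  qed simp
next
  case (neg n)
  have pos: "F (y + real m) = F y" for y and m :: nat
  proof (induction m arbitrary: y)
    case (Suc m)
    have "F (y + real (Suc m)) = F ((y + real m) + 1)" by (simp add: algebra_simps)
    then show ?case using Suc neg by (simp add: periodic1_def)
  qed simp
  show ?case using pos[of "x - real (Suc n)" "Suc n"] by (simp add: algebra_simps)
qed

lemma nn_integral_shift:
  fixes F :: "real \<Rightarrow> ennreal"
  assumes [measurable]: "F \<in> borel_measurable borel"
  shows "(\<integral>\<^sup>+x. F (c + x) \<partial>lborel) = (\<integral>\<^sup>+x. F x \<partial>lborel)"
  using nn_integral_real_affine[of F 1 c] by simp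

lemma nn_integral_Ico_Icc:
  fixes F :: "real \<Rightarrow> ennreal"
  shows "(\<integral>\<^sup>+x\<in>{a..<b}. F x \<partial>lborel) = (\<integral>\<^sup>+x\<in>{a..b}. F x \<partial>lborel)"
proof (rule nn_integral_cong_AE)
  have "AE x in lborel. x \<noteq> b" by (rule AE_lborel_singleton)
  then show "AE x in lborel. F x * indicator {a..<b} x = F x * indicator {a..b} x"
    by eventually_elim (auto simp: indicator_def)
qed

lemma nn_integral_periodic:
  fixes F :: "real \<Rightarrow> ennreal"
  assumes [measurable]: "F \<in> borel_measurable borel" and per: "periodic1 F"
  shows "(\<integral>\<^sup>+x\<in>{a..a+1}. F x \<partial>lborel) = (\<integral>\<^sup>+x\<in>{0..1}. F x \<partial>lborel)"
proof -
  define n where "n = \<lfloor>a\<rfloor>"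
  define t where "t = a - n"
  have t: "0 \<le> t" "t < 1" "a = n + t" unfolding t_def n_def by linarith+
  have sh: "(\<integral>\<^sup>+x\<in>{of_int m + b..<of_int m + c}. F x \<partial>lborel) = (\<integral>\<^sup>+x\<in>{b..<c}. F x \<partial>lborel)" for m b c
  proof -
    have "(\<integral>\<^sup>+x\<in>{of_int m + b..<of_int m + c}. F x \<partial>lborel)
       = (\<integral>\<^sup>+x. F (of_int m + x) * indicator {of_int m + b..<of_int m + c} (of_int m + x) \<partial>lborel)"
      by (rule nn_integral_shift[symmetric]) auto
    also have "\<dots> = (\<integral>\<^sup>+x\<in>{b..<c}. F x \<partial>lborel)"
      using periodic1_int[OF per] by (intro nn_integral_cong) (auto simp: indicator_def add.commute)
    finally show ?thesis .
  qed
  \<comment> \<open>Half-open intervals make the pieces disjoint; the endpoints are restored at the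
    end as null sets.\<close>
  have split: "(\<integral>\<^sup>+x\<in>{b..<d}. F x \<partial>lborel) = (\<integral>\<^sup>+x\<in>{b..<c}. F x \<partial>lborel) + (\<integral>\<^sup>+x\<in>{c..<d}. F x \<partial>lborel)"
    if "b \<le> c" "c \<le> d" for b c d
    using that by (subst nn_integral_add[symmetric]) (auto intro!: nn_integral_cong simp: indicator_def)
  have "(\<integral>\<^sup>+x\<in>{a..<a+1}. F x \<partial>lborel) = (\<integral>\<^sup>+x\<in>{t..<t+1}. F x \<partial>lborel)"
    using sh[of n t "t + 1"] t(3) by (simp add: add.assoc)
  also have "\<dots> = (\<integral>\<^sup>+x\<in>{t..<1}. F x \<partial>lborel) + (\<integral>\<^sup>+x\<in>{1..<t+1}. F x \<partial>lborel)"
    using t by (intro split) auto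
  also have "(\<integral>\<^sup>+x\<in>{1..<t+1}. F x \<partial>lborel) = (\<integral>\<^sup>+x\<in>{0..<t}. F x \<partial>lborel)"
    using sh[of 1 0 t] by (simp add: add.commute)
  also have "(\<integral>\<^sup>+x\<in>{t..<1}. F x \<partial>lborel) + (\<integral>\<^sup>+x\<in>{0..<t}. F x \<partial>lborel) = (\<integral>\<^sup>+x\<in>{0..<1}. F x \<partial>lborel)"
    using t split[of 0 t 1] by (simp add: add.commute)
  finally show ?thesis by (simp add: nn_integral_Ico_Icc)
qed

section \<open>Uniqueness of weak derivatives almost everywhere\<close>

lemma AE_eq_0_if_interval_integrals_0:
  fixes d :: "real \<Rightarrow> 'a::euclidean_space"
  assumes d: "integrable lborel d" and z: "\<And>a. set_lebesgue_integral lborel {..a} d = 0"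
    and all: "integral\<^sup>L lborel d = 0"
  shows "AE x in lborel. d x = 0"
proof -
  have "set_lebesgue_integral lborel A d = 0" if "A \<in> sets borel" for A
  proof -
    \<comment> \<open>Half-lines form an intersection-stable generator of the Borel sets, so a
      Dynkin argument extends the vanishing of integrals; complements are handled by the total
      integral in \<open>all\<close>.\<close>
    have G: "Int_stable (range (\<lambda>a::real. {..a}))" "range (\<lambda>a::real. {..a}) \<subseteq> Pow UNIV"
      by (auto simp: Int_stable_def)
    have "A \<in> sigma_sets UNIV (range (\<lambda>a::real. {..a}))"
      using that by (simp add: borel_eq_atMost)
    with G show ?thesis
    proof (induction rule: sigma_sets_induct_disjoint)
      case (basic A)
      then show ?case using z by auto
    next
      case empty
      then show ?case by (simp add: set_lebesgue_integral_def)
    next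
      case (compl A)
      then have A: "A \<in> sets lborel" by (simp add: borel_eq_atMost)
      have "set_lebesgue_integral lborel (UNIV - A) d = integral\<^sup>L lborel (\<lambda>x. d x - indicator A x *\<^sub>R d x)"
        unfolding set_lebesgue_integral_def by (intro Bochner_Integration.integral_cong) (auto simp: indicator_def)
      also have "\<dots> = integral\<^sup>L lborel d - set_lebesgue_integral lborel A d"
        unfolding set_lebesgue_integral_def using A d
        by (intro Bochner_Integration.integral_diff integrable_mult_indicator) auto
      finally show ?case using compl all by simp
    next
      case (union A)
      then have A: "\<And>i. A i \<in> sets lborel" by (auto simp: borel_eq_atMost)
      have "set_lebesgue_integral lborel (\<Union>i. A i) d = (\<Sum>i. set_lebesgue_integral lborel (A i) d)"
        using union(1) A d
        by (intro lebesgue_integral_countable_add) (auto simp: disjoint_family_on_def set_integrable_def intro!: integrable_mult_indicator)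
      then show ?case using union by simp
    qed
  qed
  then show ?thesis by (intro sigma_finite_measure.density_zero[OF lborel.sigma_finite_measure_axioms d]) auto
qed

text \<open>\<open>Hnorm\<close> chooses a weak derivative by \<open>SOME\<close>, so nothing is
  known about it beyond its integrals. This identifies it with the classical derivative up to a null
  set, working on bounded intervals to have integrability.\<close>

lemma weak_deriv_unique_AE:
  fixes f :: "real \<Rightarrow> real^'n"
  assumes w: "weak_deriv f g" and c: "continuous_on UNIV g'" and f': "\<And>x. (f has_vector_derivative g' x) (at x)"
  shows "AE x in lborel. g x = g' x"
proof -
  have 1: "AE x in lborel. x \<in> {-real n..real n} \<longrightarrow> g x = g' x" for n
  proof -
    let ?I = "{-real n..real n}"
    let ?d = "\<lambda>x. indicator ?I x *\<^sub>R (g x - g' x)"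
    have gi: "set_integrable lborel {a..b} g" for a b
      using w unfolding weak_deriv_def by (cases "a \<le> b") (auto simp: set_integrable_def)
    have g'i: "set_integrable lborel {a..b} g'" for a b
      by (rule borel_integrable_atLeastAtMost'[OF continuous_on_subset[OF c]]) auto
    have zero: "set_lebesgue_integral lborel {a..b} (\<lambda>x. g x - g' x) = 0" for a b
    proof (cases "a \<le> b")
      case True
      have "set_lebesgue_integral lborel {a..b} g = f b - f a"
        using w True unfolding weak_deriv_def by auto
      moreover have "set_lebesgue_integral lborel {a..b} g' = f b - f a"
        using set_borel_integral_eq_integral(2)[OF g'i] fundamental_theorem_of_calculus[OF True, of f g'] f'
        by (auto intro: has_vector_derivative_at_within simp: integral_unique)
      ultimately show ?thesis by (subst set_integral_diff(2)) (auto intro: gi g'i)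
    qed (simp add: set_lebesgue_integral_def)
    have di: "integrable lborel ?d"
      using set_integral_diff(1)[OF gi g'i] unfolding set_integrable_def .
    have "AE x in lborel. ?d x = 0"
    proof (rule AE_eq_0_if_interval_integrals_0[OF di])
      fix a
      have "set_lebesgue_integral lborel {..a} ?d = set_lebesgue_integral lborel {-real n..min a (real n)} (\<lambda>x. g x - g' x)"
        unfolding set_lebesgue_integral_def by (intro Bochner_Integration.integral_cong) (auto simp: indicator_def)
      then show "set_lebesgue_integral lborel {..a} ?d = 0" using zero by simp
    next
      show "integral\<^sup>L lborel ?d = 0" using zero[of "-real n" "real n"] by (simp add: set_lebesgue_integral_def)
    qed
    then show ?thesis by eventually_elim (auto simp: indicator_def)
  qed
  then have "AE x in lborel. \<forall>n::nat. x \<in> {-real n..real n} \<longrightarrow> g x = g' x"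
    unfolding AE_all_countable by blast
  then show ?thesis
  proof eventually_elim
    case (elim x)
    obtain n :: nat where "\<bar>x\<bar> \<le> real n" using real_arch_simple by blast
    then show ?case using elim by (auto simp: abs_le_iff)
  qed
qed

lemma AE_shift:
  assumes "AE x in lborel. P (x::real)"
  shows "AE x in lborel. P (c + x)"
proof -
  from assms obtain N where N: "N \<in> null_sets lborel" "{x. \<not> P x} \<subseteq> N"
    by (auto elim!: AE_E simp: null_sets_def)
  then have [measurable]: "N \<in> sets borel" by auto
  have "emeasure lborel {x. c + x \<in> N} = (\<integral>\<^sup>+x. indicator N (c + x) \<partial>lborel)"
    using nn_integral_indicator[of "{x. c + x \<in> N}" lborel] by (simp add: indicator_def of_bool_def)
  also have "\<dots> = (\<integral>\<^sup>+x. indicator N x \<partial>lborel)" by (rule nn_integral_shift) auto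
  also have "\<dots> = 0" using N by auto
  finally have "{x. c + x \<in> N} \<in> null_sets lborel" by (auto simp: null_sets_def)
  then show ?thesis by (rule AE_I') (use N in auto)
qed

text \<open>For almost every \<open>u\<close> the values at \<open>u\<close> agree, and a translated
  null set is null, so the values at \<open>u + w\<close> agree for almost every
  \<open>w\<close>.\<close>

lemma gagliardo_cong_AE:
  fixes g g' :: "real \<Rightarrow> real^'n"
  assumes "AE x in lborel. g x = g' x"
  shows "gagliardo \<sigma> g = gagliardo \<sigma> g'"
  unfolding gagliardo_def
proof (rule nn_integral_cong_AE)
  from assms show "AE u in lborel.
     (\<integral>\<^sup>+w\<in>{-1/2..1/2}. ennreal ((norm (g (u + w) - g u))\<^sup>2 / \<bar>w\<bar> powr (1 + 2 * \<sigma>)) \<partial>lborel) * indicator {0..1} u =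
     (\<integral>\<^sup>+w\<in>{-1/2..1/2}. ennreal ((norm (g' (u + w) - g' u))\<^sup>2 / \<bar>w\<bar> powr (1 + 2 * \<sigma>)) \<partial>lborel) * indicator {0..1} u"
  proof eventually_elim
    case (elim u)
    have "AE w in lborel. g (u + w) = g' (u + w)" by (rule AE_shift[OF assms])
    then have "AE w in lborel. ennreal ((norm (g (u + w) - g u))\<^sup>2 / \<bar>w\<bar> powr (1 + 2 * \<sigma>)) * indicator {-1/2..1/2} w
       = ennreal ((norm (g' (u + w) - g' u))\<^sup>2 / \<bar>w\<bar> powr (1 + 2 * \<sigma>)) * indicator {-1/2..1/2} w"
      by eventually_elim (simp add: elim)
    then have "(\<integral>\<^sup>+w\<in>{-1/2..1/2}. ennreal ((norm (g (u + w) - g u))\<^sup>2 / \<bar>w\<bar> powr (1 + 2 * \<sigma>)) \<partial>lborel)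
       = (\<integral>\<^sup>+w\<in>{-1/2..1/2}. ennreal ((norm (g' (u + w) - g' u))\<^sup>2 / \<bar>w\<bar> powr (1 + 2 * \<sigma>)) \<partial>lborel)"
      by (rule nn_integral_cong_AE)
    then show ?case by simp
  qed
qed

section \<open>Dyadic difference quotients of Sobolev functions\<close>

lemma integral_norm_le_nn:
  fixes g :: "real \<Rightarrow> 'a::euclidean_space"
  assumes "set_integrable lborel A g"
  shows "ennreal (norm (set_lebesgue_integral lborel A g)) \<le> (\<integral>\<^sup>+x\<in>A. ennreal (norm (g x)) \<partial>lborel)"
proof -
  have "ennreal (norm (set_lebesgue_integral lborel A g)) \<le> (\<integral>\<^sup>+x. norm (indicator A x *\<^sub>R g x) \<partial>lborel)"
    using assms unfolding set_lebesgue_integral_def set_integrable_def by (rule integral_norm_bound_ennreal)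
  also have "\<dots> = (\<integral>\<^sup>+x\<in>A. ennreal (norm (g x)) \<partial>lborel)"
    by (intro nn_integral_cong) (auto simp: indicator_def)
  finally show ?thesis .
qed

text \<open>Stands in for the Cauchy-Schwarz inequality: linear in the square, hence easily
  integrated in extended reals, and equally strong up to constants when \<open>l\<close> has the
  expected size of \<open>a\<close>.\<close>

lemma weighted_am_gm: "0 < l \<Longrightarrow> a \<le> l / 2 + a\<^sup>2 / (2 * l)" for a l :: real
proof -
  assume l: "0 < l"
  have "0 \<le> (a - l)\<^sup>2 / (2 * l)" using l by simp
  also have "\<dots> = l / 2 + a\<^sup>2 / (2 * l) - a" using l by (simp add: field_simps power2_eq_square)
  finally show ?thesis by simp
qed

text \<open>Comparing every \<open>g t\<close> on the left half with every \<open>g s\<close> on the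
  right half, at distance at most \<open>r\<close>, gains the factor \<open>r powr \<alpha>\<close>
  against the Gagliardo kernel. After division by \<open>r\<close> this is the decay of consecutive
  dyadic quotients.\<close>

lemma average_difference:
  fixes g :: "real \<Rightarrow> real^'n"
  assumes gm: "g \<in> borel_measurable lborel" and per: "periodic1 g"
    and gi: "\<And>a b. set_integrable lborel {a..b} g"
    and S: "gagliardo \<sigma> g \<le> ennreal (\<kappa>\<^sup>2)" and \<kappa>: "0 < \<kappa>" and \<alpha>: "\<alpha> = 1 + 2 * \<sigma>" "0 < \<alpha>"
    and r: "0 < r" "r \<le> 1 / 2"
  shows "norm (set_lebesgue_integral lborel {x..x + r / 2} g - set_lebesgue_integral lborel {x + r / 2..x + r} g)
    \<le> 5 / 4 * \<kappa> * r powr (\<alpha> / 2)"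
proof -
  have [measurable]: "g \<in> borel_measurable borel" using gm by simp
  define d where "d = r / 2"
  define I where "I = {x..x + r / 2}"
  define J where "J = {x + r / 2..x + r}"
  define m where "m = set_lebesgue_integral lborel J g"
  \<comment> \<open>With this choice both terms of \<open>weighted_am_gm\<close> integrate to
    multiples of \<open>\<kappa> * r powr (\<alpha> / 2 + 1)\<close>.\<close>
  define l where "l = \<kappa> * r powr (\<alpha> / 2 - 1)"
  have l: "0 < l" using \<kappa> r by (simp add: l_def)
  have d: "0 < d" using r by (simp add: d_def)
  have [measurable]: "I \<in> sets borel" "J \<in> sets borel" by (auto simp: I_def J_def)
  have eI: "emeasure lborel I = ennreal d" "emeasure lborel J = ennreal d" "measure lborel I = d" "measure lborel J = d"
    using r by (auto simp: I_def J_def d_def)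
  have ci: "set_integrable lborel I (\<lambda>_. v)" "set_integrable lborel J (\<lambda>_. v)" for v :: "real^'n"
    unfolding I_def J_def by (intro borel_integrable_atLeastAtMost' continuous_on_const)+
  have iI: "set_integrable lborel I g" and iJ: "set_integrable lborel J g" by (auto simp: I_def J_def gi)
  let ?K = "\<lambda>t s. ennreal ((norm (g s - g t))\<^sup>2 / \<bar>s - t\<bar> powr \<alpha>)"
  let ?G = "\<lambda>t w. ennreal ((norm (g (t + w) - g t))\<^sup>2 / \<bar>w\<bar> powr \<alpha>)"
  have inner: "ennreal (norm (d *\<^sub>R g t - m)) \<le> (\<integral>\<^sup>+s\<in>J. ennreal (norm (g s - g t)) \<partial>lborel)" for t
  proof -
    have "d *\<^sub>R g t - m = set_lebesgue_integral lborel J (\<lambda>s. g t - g s)"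
      using set_integral_diff(2)[OF ci(2)[of "g t"] iJ] eI unfolding m_def
      by (simp add: set_lebesgue_integral_def)
    then show ?thesis
      using integral_norm_le_nn[OF set_integral_diff(1)[OF ci(2)[of "g t"] iJ]] by (simp add: norm_minus_commute)
  qed
  have point: "ennreal (norm (g s - g t)) \<le> ennreal (l / 2) + ennreal (r powr \<alpha> / (2 * l)) * ?K t s"
    if "t \<in> I" "s \<in> J" for s t
  proof -
    have st: "\<bar>s - t\<bar> \<le> r" using that by (auto simp: I_def J_def)
    have "(norm (g s - g t))\<^sup>2 \<le> r powr \<alpha> * ((norm (g s - g t))\<^sup>2 / \<bar>s - t\<bar> powr \<alpha>)"
    proof (cases "s = t")
      case False
      then have "\<bar>s - t\<bar> powr \<alpha> \<le> r powr \<alpha>" "0 < \<bar>s - t\<bar> powr \<alpha>" using st \<alpha> by (auto intro!: powr_mono2)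
      then have "1 \<le> r powr \<alpha> / \<bar>s - t\<bar> powr \<alpha>" by simp
      from mult_right_mono[OF this, of "(norm (g s - g t))\<^sup>2"] show ?thesis by simp
    qed simp
    then have "(norm (g s - g t))\<^sup>2 / (2 * l) \<le> r powr \<alpha> * ((norm (g s - g t))\<^sup>2 / \<bar>s - t\<bar> powr \<alpha>) / (2 * l)"
      using l by (intro divide_right_mono) auto
    with weighted_am_gm[OF l, of "norm (g s - g t)"]
    have "norm (g s - g t) \<le> l / 2 + r powr \<alpha> / (2 * l) * ((norm (g s - g t))\<^sup>2 / \<bar>s - t\<bar> powr \<alpha>)" by (simp add: mult_ac)
    then have "ennreal (norm (g s - g t)) \<le> ennreal (l / 2 + r powr \<alpha> / (2 * l) * ((norm (g s - g t))\<^sup>2 / \<bar>s - t\<bar> powr \<alpha>))"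
      by (rule ennreal_leI)
    also have "\<dots> = ennreal (l / 2) + ennreal (r powr \<alpha> / (2 * l)) * ?K t s"
      using l by (subst ennreal_plus) (auto simp: ennreal_mult[symmetric])
    finally show ?thesis .
  qed
  \<comment> \<open>Setting \<open>s = t + w\<close> gives \<open>\<bar>w\<bar> \<le> r\<close>, and
    \<open>r \<le> 1 / 2\<close> places the pairs inside the window of the seminorm; periodicity
    moves the base interval to \<open>{0..1}\<close>.\<close>
  have Kbound: "(\<integral>\<^sup>+t\<in>I. (\<integral>\<^sup>+s\<in>J. ?K t s \<partial>lborel) \<partial>lborel) \<le> ennreal (\<kappa>\<^sup>2)"
  proof -
    have "(\<integral>\<^sup>+s\<in>J. ?K t s \<partial>lborel) * indicator I t \<le> (\<integral>\<^sup>+w\<in>{-1/2..1/2}. ?G t w \<partial>lborel) * indicator {x..x+1} t" for t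
    proof (cases "t \<in> I")
      case True
      have "(\<integral>\<^sup>+s\<in>J. ?K t s \<partial>lborel) = (\<integral>\<^sup>+w. ?K t (t + w) * indicator J (t + w) \<partial>lborel)"
        by (rule nn_integral_shift[symmetric]) measurable
      also have "\<dots> \<le> (\<integral>\<^sup>+w\<in>{-1/2..1/2}. ?G t w \<partial>lborel)"
        using True r by (intro nn_integral_mono) (auto simp: indicator_def I_def J_def)
      finally show ?thesis using True r by (auto simp: indicator_def I_def)
    qed simp
    then have "(\<integral>\<^sup>+t\<in>I. (\<integral>\<^sup>+s\<in>J. ?K t s \<partial>lborel) \<partial>lborel) \<le> (\<integral>\<^sup>+t\<in>{x..x+1}. (\<integral>\<^sup>+w\<in>{-1/2..1/2}. ?G t w \<partial>lborel) \<partial>lborel)"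
      by (intro nn_integral_mono)
    also have "\<dots> = (\<integral>\<^sup>+t\<in>{0..1}. (\<integral>\<^sup>+w\<in>{-1/2..1/2}. ?G t w \<partial>lborel) \<partial>lborel)"
    proof (rule nn_integral_periodic)
      show "(\<lambda>t. \<integral>\<^sup>+w\<in>{-1/2..1/2}. ?G t w \<partial>lborel) \<in> borel_measurable borel" by measurable
      have "g ((t + 1) + w) = g (t + w)" "g (t + 1) = g t" for t w
        using per periodic1_int[OF per, of "t + w" 1] by (auto simp: periodic1_def add_ac)
      then show "periodic1 (\<lambda>t. \<integral>\<^sup>+w\<in>{-1/2..1/2}. ?G t w \<partial>lborel)" by (simp add: periodic1_def)
    qed
    also have "\<dots> = gagliardo \<sigma> g" unfolding gagliardo_def \<alpha> by simp
    finally show ?thesis using S by simp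
  qed
  have "d *\<^sub>R (set_lebesgue_integral lborel I g - m) = set_lebesgue_integral lborel I (\<lambda>t. d *\<^sub>R g t - m)"
  proof -
    have "set_lebesgue_integral lborel I (\<lambda>t. d *\<^sub>R g t - m) = set_lebesgue_integral lborel I (\<lambda>t. d *\<^sub>R g t) - set_lebesgue_integral lborel I (\<lambda>t. m)"
      using iI ci by (intro set_integral_diff set_integrable_scaleR_right) auto
    then show ?thesis using eI by (simp add: set_lebesgue_integral_def scaleR_diff_right mult.commute scaleR_left_commute)
  qed
  then have "ennreal (d * norm (set_lebesgue_integral lborel I g - m)) = ennreal (norm (set_lebesgue_integral lborel I (\<lambda>t. d *\<^sub>R g t - m)))"
    using d by (metis abs_of_pos norm_scaleR)
  also have "\<dots> \<le> (\<integral>\<^sup>+t\<in>I. ennreal (norm (d *\<^sub>R g t - m)) \<partial>lborel)"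
    using iI ci by (intro integral_norm_le_nn set_integral_diff set_integrable_scaleR_right) auto
  also have "\<dots> \<le> (\<integral>\<^sup>+t\<in>I. (\<integral>\<^sup>+s\<in>J. ennreal (norm (g s - g t)) \<partial>lborel) \<partial>lborel)"
    using inner by (intro nn_integral_mono mult_right_mono) auto
  also have "\<dots> \<le> (\<integral>\<^sup>+t\<in>I. (\<integral>\<^sup>+s. ennreal (l / 2) * indicator J s + ennreal (r powr \<alpha> / (2 * l)) * (?K t s * indicator J s) \<partial>lborel) \<partial>lborel)"
    using point by (intro nn_integral_mono) (auto simp: indicator_def intro!: nn_integral_mono)
  also have "\<dots> = (\<integral>\<^sup>+t. ennreal (l / 2) * ennreal d * indicator I t + ennreal (r powr \<alpha> / (2 * l)) * ((\<integral>\<^sup>+s\<in>J. ?K t s \<partial>lborel) * indicator I t) \<partial>lborel)"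
    by (intro nn_integral_cong) (simp add: nn_integral_add nn_integral_cmult eI distrib_right mult.assoc)
  also have "\<dots> = ennreal (l / 2) * ennreal d * ennreal d + ennreal (r powr \<alpha> / (2 * l)) * (\<integral>\<^sup>+t\<in>I. (\<integral>\<^sup>+s\<in>J. ?K t s \<partial>lborel) \<partial>lborel)"
    by (simp add: nn_integral_add nn_integral_cmult eI)
  also have "\<dots> \<le> ennreal (l / 2) * ennreal d * ennreal d + ennreal (r powr \<alpha> / (2 * l)) * ennreal (\<kappa>\<^sup>2)"
    using Kbound by (intro add_left_mono mult_left_mono) auto
  also have "\<dots> = ennreal (l / 2 * d * d + r powr \<alpha> / (2 * l) * \<kappa>\<^sup>2)"
    using l d by (simp add: ennreal_mult[symmetric] ennreal_plus[symmetric] del: ennreal_plus)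
  finally have "d * norm (set_lebesgue_integral lborel I g - m) \<le> l / 2 * d * d + r powr \<alpha> / (2 * l) * \<kappa>\<^sup>2"
    using l d by (subst (asm) ennreal_le_iff) (auto intro!: add_nonneg_nonneg)
  \<comment> \<open>The constant is \<open>1/4 + 1\<close>: the two terms are 1/8 and 1/2 of
    \<open>\<kappa> * r powr (\<alpha> / 2 + 1)\<close>, and \<open>d = r / 2\<close>.\<close>
  also have "\<dots> = d * (5 / 4 * \<kappa> * r powr (\<alpha> / 2))"
  proof -
    have "r powr \<alpha> = r powr (\<alpha> / 2) * r powr (\<alpha> / 2)" by (simp add: powr_add[symmetric])
    moreover have "r powr (\<alpha> / 2 - 1) = r powr (\<alpha> / 2) / r" using r by (simp add: powr_diff)
    ultimately show ?thesis using r \<kappa> by (simp add: l_def d_def field_simps power2_eq_square)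
  qed
  finally show ?thesis using d by (simp add: I_def J_def m_def)
qed

text \<open>Convergence along the steps \<open>1 / 2 ^ n\<close> alone does not control other
  difference quotients. Passing to an antiderivative \<open>F\<close> helps: its dyadic quotients
  are differentiable, converge to \<open>f\<close>, and have as derivatives the quotients of
  \<open>f\<close>, which converge uniformly. Limit and derivative may then be interchanged.\<close>

lemma dyadic_differentiable:
  fixes f :: "real \<Rightarrow> 'a::euclidean_space"
  assumes f: "continuous_on UNIV f"
    and ul: "uniform_limit UNIV (\<lambda>n x. (2::real) ^ n *\<^sub>R (f (x + 1 / 2 ^ n) - f x)) g sequentially"
  shows "(f has_vector_derivative g x) (at x)"
proof -
  let ?G = "\<lambda>n x. (2::real) ^ n *\<^sub>R (f (x + 1 / 2 ^ n) - f x)"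
  obtain F where F: "\<And>y. y \<in> {x-1..x+2} \<Longrightarrow> (F has_vector_derivative f y) (at y within {x-1..x+2})"
    using antiderivative_continuous[OF continuous_on_subset[OF f subset_UNIV], of "x-1" "x+2"] by blast
  let ?S = "{x-1<..<x+1}"
  have Fd: "(F has_vector_derivative f y) (at y)" if "y \<in> {x-1<..<x+2}" for y
    using F[of y] that by (auto simp: at_within_Icc_at)
  let ?H = "\<lambda>n y. (2::real) ^ n *\<^sub>R (F (y + 1 / 2 ^ n) - F y)"
  have Hd: "(?H n has_vector_derivative ?G n y) (at y within ?S)" if "y \<in> ?S" "n \<ge> 1" for n y
  proof -
    have "1 / (2::real) ^ n \<le> 1 / 2 ^ 1" using that(2) by (intro divide_left_mono power_increasing) auto
    then have "1 / (2::real) ^ n \<le> 1 / 2" by simp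
    moreover have "0 < 1 / (2::real) ^ n" by simp
    moreover have "x - 1 < y" "y < x + 1" using that(1) by auto
    ultimately have "x - 1 < y + 1 / 2 ^ n" "y + 1 / 2 ^ n < x + 2" "x - 1 < y" "y < x + 2" by linarith+
    then have "y + 1 / 2 ^ n \<in> {x-1<..<x+2}" "y \<in> {x-1<..<x+2}" by (simp_all only: greaterThanLessThan_iff)
    note F12 = Fd[OF this(1)] Fd[OF this(2)]
    have "((\<lambda>y. y + 1 / 2 ^ n) has_vector_derivative 1) (at y)" by (auto intro!: derivative_eq_intros)
    from vector_diff_chain_at[OF this F12(1)]
    have "((\<lambda>y. F (y + 1 / 2 ^ n)) has_vector_derivative f (y + 1 / 2 ^ n)) (at y)" by (simp add: o_def)
    then have "((\<lambda>y. F (y + 1 / 2 ^ n) - F y) has_vector_derivative (f (y + 1 / 2 ^ n) - f y)) (at y)"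
      by (intro has_vector_derivative_diff F12(2))
    then have "(?H n has_vector_derivative ?G n y) (at y)"
      by (intro has_vector_derivative_scaleR[THEN has_vector_derivative_eq_rhs]) (auto intro!: derivative_eq_intros)
    then show ?thesis by (rule has_vector_derivative_at_within)
  qed
  have Hl: "(\<lambda>n. ?H n y) \<longlonglongrightarrow> f y" if "y \<in> ?S" for y
  proof -
    have "(F has_vector_derivative f y) (at y)" using Fd that by auto
    then have 0: "((\<lambda>h. norm (F (y + h) - F y - h *\<^sub>R f y) / norm h) \<longlongrightarrow> 0) (at 0)"
      by (simp add: has_vector_derivative_def has_derivative_at)
    have "norm (F (y + h) - F y - h *\<^sub>R f y) / norm h = norm ((F (y + h) - F y) /\<^sub>R h - f y)" if "h \<noteq> 0" for h
    proof -
      have "(F (y + h) - F y) /\<^sub>R h - f y = (F (y + h) - F y - h *\<^sub>R f y) /\<^sub>R h"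
        using that by (simp add: scaleR_diff_right)
      then show ?thesis by (simp add: divide_inverse mult.commute)
    qed
    then have "\<forall>\<^sub>F h in at 0. norm (F (y + h) - F y - h *\<^sub>R f y) / norm h = norm ((F (y + h) - F y) /\<^sub>R h - f y)"
      by (simp add: eventually_at_filter)
    from tendsto_cong[OF this] 0 have "((\<lambda>h. (F (y + h) - F y) /\<^sub>R h - f y) \<longlongrightarrow> 0) (at 0)"
      by (simp add: tendsto_norm_zero_iff)
    then have 1: "((\<lambda>h. (F (y + h) - F y) /\<^sub>R h) \<longlongrightarrow> f y) (at 0)" by (rule LIM_zero_cancel)
    have 2: "filterlim (\<lambda>n. 1 / (2::real) ^ n) (at 0) sequentially"
      unfolding filterlim_at by (auto intro!: LIMSEQ_divide_realpow_zero)
    from filterlim_compose[OF 1 2] show ?thesis by (simp add: field_simps)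
  qed
  \<comment> \<open>The index starts at 1 so that \<open>y + 1 / 2 ^ n\<close> remains inside the
    interval on which \<open>F\<close> was obtained.\<close>
  have "\<exists>h. \<forall>y\<in>?S. (\<lambda>n. ?H (n + 1) y) \<longlonglongrightarrow> h y \<and> (h has_derivative (\<lambda>r. r *\<^sub>R g y)) (at y within ?S)"
  proof (rule has_derivative_sequence[where f'="\<lambda>n y r. r *\<^sub>R ?G (n + 1) y" and ?x0.0=x and l="f x"])
    fix e :: real assume e: "e > 0"
    have "\<forall>\<^sub>F n in sequentially. \<forall>y. dist (?G n y) (g y) < e" using uniform_limitD[OF ul e] by simp
    then have "\<forall>\<^sub>F n in sequentially. \<forall>y. dist (?G (n + 1) y) (g y) < e"
      by (rule eventually_sequentially_Suc[THEN iffD2, of "\<lambda>n. \<forall>y. dist (?G n y) (g y) < e", unfolded Suc_eq_plus1])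
    then show "\<forall>\<^sub>F n in sequentially. \<forall>y\<in>?S. \<forall>h. norm (h *\<^sub>R ?G (n + 1) y - h *\<^sub>R g y) \<le> e * norm h"
    proof eventually_elim
      case (elim n)
      have "norm (h *\<^sub>R ?G (n + 1) y - h *\<^sub>R g y) = \<bar>h\<bar> * dist (?G (n + 1) y) (g y)" for h y
        unfolding scaleR_diff_right[symmetric] norm_scaleR dist_norm ..
      moreover have "\<bar>h\<bar> * dist (?G (n + 1) y) (g y) \<le> e * \<bar>h\<bar>" for h y
        using elim[rule_format, of y] by (subst mult.commute) (intro mult_right_mono, auto)
      ultimately show ?case by simp
    qed
  next
    fix n y assume "y \<in> ?S"
    then show "(?H (n + 1) has_derivative (\<lambda>r. r *\<^sub>R ?G (n + 1) y)) (at y within ?S)"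
      using Hd[of y "n + 1"] unfolding has_vector_derivative_def by simp
  next
    show "(\<lambda>n. ?H (n + 1) x) \<longlonglongrightarrow> f x" using LIMSEQ_ignore_initial_segment[OF Hl[of x], of 1] by simp
  qed auto
  then obtain h where h: "\<And>y. y \<in> ?S \<Longrightarrow> (\<lambda>n. ?H (n + 1) y) \<longlonglongrightarrow> h y"
    "\<And>y. y \<in> ?S \<Longrightarrow> (h has_derivative (\<lambda>r. r *\<^sub>R g y)) (at y within ?S)" by blast
  have hf: "h y = f y" if "y \<in> ?S" for y
    using LIMSEQ_unique[OF h(1)[OF that] LIMSEQ_ignore_initial_segment[OF Hl[OF that], of 1]] by simp
  have "(f has_derivative (\<lambda>r. r *\<^sub>R g x)) (at x within ?S)"
    by (rule has_derivative_transform[OF _ _ h(2)[of x]]) (auto simp: hf)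
  then show ?thesis unfolding has_vector_derivative_def by (subst (asm) at_within_open) auto
qed

text \<open>The dyadic difference quotients of \<open>f\<close> converge geometrically, uniformly in the base point.\<close>

lemma sobolev_embedding:
  fixes f :: "real \<Rightarrow> real^'n"
  assumes w: "weak_deriv f g" and S: "gagliardo \<sigma> g \<le> ennreal (\<kappa>\<^sup>2)" and \<kappa>: "0 < \<kappa>"
    and L2: "(\<integral>\<^sup>+x\<in>{0..1}. ennreal ((norm (g x))\<^sup>2) \<partial>lborel) \<le> ennreal (\<kappa>\<^sup>2)"
    and \<alpha>: "\<alpha> = 1 + 2 * \<sigma>" "2 < \<alpha>"
  obtains g' where "continuous_on UNIV g'" "\<And>x. (f has_vector_derivative g' x) (at x)"
    "\<And>x. norm (g' x) \<le> (2 + 5 / 4 * (1 / (1 - (1/2) powr (\<alpha> / 2 - 1)))) * \<kappa>"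
proof -
  define q where "q = (1/2::real) powr (\<alpha> / 2 - 1)"
  \<comment> \<open>The hypothesis \<open>2 < \<alpha>\<close> makes the geometric ratio smaller
    than 1.\<close>
  have q: "0 < q" "q < 1" using \<alpha>(2) powr_less_mono2[of "\<alpha> / 2 - 1" "1/2" 1] by (auto simp: q_def)
  have per: "periodic1 g" and gm: "g \<in> borel_measurable lborel" using w by (auto simp: weak_deriv_def)
  have gi: "set_integrable lborel {a..b} g" for a b
    using w unfolding weak_deriv_def by (cases "a \<le> b") (auto simp: set_integrable_def)
  have fi: "f b - f a = set_lebesgue_integral lborel {a..b} g" if "a \<le> b" for a b
    using w that unfolding weak_deriv_def by auto
  have fc: "continuous_on UNIV f"
  proof -
    have "continuous_on {x-1..x+1} f" for x
    proof -
      have "continuous_on {x-1..x+1} (\<lambda>y. f (x - 1) + integral {x-1..y} g)"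
        by (intro continuous_intros indefinite_integral_continuous_1 set_borel_integral_eq_integral(1)[OF gi])
      moreover have "f (x - 1) + integral {x-1..y} g = f y" if "y \<in> {x-1..x+1}" for y
        using fi[of "x-1" y] that set_borel_integral_eq_integral(2)[OF gi, of "x-1" y] by (simp add: algebra_simps)
      ultimately show ?thesis by (rule continuous_on_eq)
    qed
    then have "isCont f x" for x
      by (rule continuous_on_interior[of "{x-1..x+1}"]) auto
    then show ?thesis by (simp add: continuous_at_imp_continuous_on)
  qed
  let ?G = "\<lambda>n x. (2::real) ^ n *\<^sub>R (f (x + 1 / 2 ^ n) - f x)"
  \<comment> \<open>The indices begin at \<open>Suc n\<close> so that \<open>r\<close> is at most
    1/2, as \<open>average_difference\<close> demands. Doubling the shorter increment and
    subtracting the longer one leaves the difference of the integrals over adjacent halves.\<close>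
  have step: "norm (?G (Suc (Suc n)) x - ?G (Suc n) x) \<le> 5 / 4 * \<kappa> * q ^ n" for n x
  proof -
    define r where "r = 1 / (2::real) ^ Suc n"
    have r: "0 < r" "r \<le> 1 / 2" by (auto simp: r_def field_simps)
    have r2: "1 / (2::real) ^ Suc (Suc n) = r / 2" "(2::real) ^ Suc n = 1 / r" "(2::real) ^ Suc (Suc n) = 2 / r" by (auto simp: r_def)
    let ?A = "set_lebesgue_integral lborel {x..x + r / 2} g" and ?B = "set_lebesgue_integral lborel {x + r / 2..x + r} g"
    have A: "f (x + r / 2) - f x = ?A" "f (x + r) - f (x + r / 2) = ?B" using r by (auto intro!: fi)
    have "?G (Suc (Suc n)) x - ?G (Suc n) x = (1 / r) *\<^sub>R (2 *\<^sub>R (f (x + r / 2) - f x) - (f (x + r) - f x))"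
      unfolding r2 r_def[symmetric] by (simp add: scaleR_diff_right)
    also have "2 *\<^sub>R (f (x + r / 2) - f x) - (f (x + r) - f x) = ?A - ?B"
      unfolding A[symmetric] by (simp add: scaleR_2)
    also have "norm ((1 / r) *\<^sub>R (?A - ?B)) \<le> (1 / r) * (5 / 4 * \<kappa> * r powr (\<alpha> / 2))"
      unfolding norm_scaleR using average_difference[OF gm per gi S \<kappa> \<alpha>(1) _ r, of x] \<alpha>(2) r
      by (simp only: abs_of_pos zero_less_divide_1_iff) (intro mult_left_mono; simp)
    also have "\<dots> = 5 / 4 * \<kappa> * r powr (\<alpha> / 2 - 1)" using r by (simp add: powr_diff)
    also have "r powr (\<alpha> / 2 - 1) = q ^ Suc n"
    proof -
      have "r = (1/2) powr real (Suc n)" by (simp only: powr_realpow r_def power_one_over zero_less_divide_1_iff zero_less_numeral)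
      moreover have "q ^ Suc n = q powr real (Suc n)" using q by (simp only: powr_realpow)
      ultimately show ?thesis by (simp only: q_def powr_powr mult.commute)
    qed
    also have "5 / 4 * \<kappa> * q ^ Suc n \<le> 5 / 4 * \<kappa> * q ^ n"
      using \<kappa> q by (intro mult_left_mono power_decreasing) auto
    finally show ?thesis .
  qed
  define T where "T n x = ?G (Suc (Suc n)) x - ?G (Suc n) x" for n x
  have Tb: "norm (T n x) \<le> 5 / 4 * \<kappa> * q ^ n" for n x unfolding T_def by (rule step)
  have sm: "summable (\<lambda>n. 5 / 4 * \<kappa> * q ^ n)" using q by (intro summable_mult summable_geometric) auto
  have ul0: "uniform_limit UNIV (\<lambda>n x. \<Sum>i<n. T i x) (\<lambda>x. suminf (\<lambda>i. T i x)) sequentially"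
    by (rule Weierstrass_m_test[OF _ sm]) (rule Tb)
  have tel: "(\<Sum>i<n. T i x) = ?G (Suc n) x - ?G 1 x" for n x
    unfolding T_def by (induction n) auto
  define g' where "g' x = ?G 1 x + suminf (\<lambda>i. T i x)" for x
  have "uniform_limit UNIV (\<lambda>n x. ?G 1 x + (\<Sum>i<n. T i x)) g' sequentially"
    unfolding g'_def by (intro uniform_limit_intros ul0)
  then have "uniform_limit UNIV (\<lambda>n x. ?G (Suc n) x) g' sequentially" unfolding tel by simp
  then have ul: "uniform_limit UNIV ?G g' sequentially"
    unfolding uniform_limit_iff
    using eventually_sequentially_Suc[of "\<lambda>n. \<forall>x\<in>UNIV. dist (?G n x) (g' x) < e" for e] by blast
  have cg: "continuous_on UNIV g'"
  proof (rule uniform_limit_theorem[OF _ ul])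
    have "continuous_on UNIV (\<lambda>x. f (x + c))" for c
      by (rule continuous_on_compose2[OF fc]) (auto intro!: continuous_intros)
    then show "\<forall>\<^sub>F n in sequentially. continuous_on UNIV (?G n)"
      by (intro always_eventually allI continuous_intros fc)
  qed simp
  have bound: "norm (g' x) \<le> (2 + 5 / 4 * (1 / (1 - q))) * \<kappa>" for x
  proof -
    have "norm (suminf (\<lambda>i. T i x)) \<le> (\<Sum>i. 5 / 4 * \<kappa> * q ^ i)"
      by (rule norm_suminf_le[OF _ sm]) (rule Tb)
    also have "\<dots> = 5 / 4 * \<kappa> * (1 / (1 - q))" using q by (subst suminf_mult) (auto simp: suminf_geometric summable_geometric)
    finally have 1: "norm (suminf (\<lambda>i. T i x)) \<le> 5 / 4 * \<kappa> * (1 / (1 - q))" .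
    \<comment> \<open>The series of corrections does not see the first quotient, with step 1/2; it
      is controlled by the mean square of \<open>g\<close> and accounts for the \<open>2\<close> in
      the constant.\<close>
    have "ennreal (norm (f (x + 1/2) - f x)) \<le> (\<integral>\<^sup>+y\<in>{x..x+1/2}. ennreal (norm (g y)) \<partial>lborel)"
      using integral_norm_le_nn[OF gi, of x "x + 1/2"] fi[of x "x + 1/2"] by simp
    also have "\<dots> \<le> (\<integral>\<^sup>+y\<in>{x..x+1}. ennreal (norm (g y)) \<partial>lborel)"
      by (intro nn_integral_mono) (auto simp: indicator_def)
    also have "\<dots> \<le> (\<integral>\<^sup>+y. ennreal (\<kappa> / 2) * indicator {x..x+1} y + ennreal (1 / (2 * \<kappa>)) * (ennreal ((norm (g y))\<^sup>2) * indicator {x..x+1} y) \<partial>lborel)"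
    proof (rule nn_integral_mono)
      fix y
      have "norm (g y) \<le> \<kappa> / 2 + 1 / (2 * \<kappa>) * (norm (g y))\<^sup>2" using weighted_am_gm[OF \<kappa>, of "norm (g y)"] by simp
      then have "ennreal (norm (g y)) \<le> ennreal (\<kappa> / 2 + 1 / (2 * \<kappa>) * (norm (g y))\<^sup>2)" by (rule ennreal_leI)
      also have "\<dots> = ennreal (\<kappa> / 2) + ennreal (1 / (2 * \<kappa>)) * ennreal ((norm (g y))\<^sup>2)"
        using \<kappa> by (subst ennreal_plus) (auto simp: ennreal_mult[symmetric])
      finally show "ennreal (norm (g y)) * indicator {x..x+1} y \<le> ennreal (\<kappa> / 2) * indicator {x..x+1} y + ennreal (1 / (2 * \<kappa>)) * (ennreal ((norm (g y))\<^sup>2) * indicator {x..x+1} y)"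
        by (auto simp: indicator_def)
    qed
    also have "\<dots> = ennreal (\<kappa> / 2) + ennreal (1 / (2 * \<kappa>)) * (\<integral>\<^sup>+y\<in>{x..x+1}. ennreal ((norm (g y))\<^sup>2) \<partial>lborel)"
      using gm by (simp add: nn_integral_add nn_integral_cmult)
    also have "(\<integral>\<^sup>+y\<in>{x..x+1}. ennreal ((norm (g y))\<^sup>2) \<partial>lborel) = (\<integral>\<^sup>+y\<in>{0..1}. ennreal ((norm (g y))\<^sup>2) \<partial>lborel)"
      using gm per by (intro nn_integral_periodic) (auto simp: periodic1_def)
    also have "ennreal (\<kappa> / 2) + ennreal (1 / (2 * \<kappa>)) * \<dots> \<le> ennreal (\<kappa> / 2) + ennreal (1 / (2 * \<kappa>)) * ennreal (\<kappa>\<^sup>2)"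
      using L2 by (intro add_left_mono mult_left_mono) auto
    also have "\<dots> = ennreal \<kappa>"
      using \<kappa> by (simp add: ennreal_mult[symmetric] ennreal_plus[symmetric] power2_eq_square del: ennreal_plus)
    finally have "norm (f (x + 1/2) - f x) \<le> \<kappa>" using \<kappa> by (subst (asm) ennreal_le_iff) auto
    then have "norm (?G 1 x) \<le> 2 * \<kappa>" by simp
    then have "norm (g' x) \<le> 2 * \<kappa> + 5 / 4 * \<kappa> * (1 / (1 - q))"
      unfolding g'_def using 1 norm_triangle_ineq[of "?G 1 x" "suminf (\<lambda>i. T i x)"] by linarith
    then show ?thesis by (simp add: algebra_simps)
  qed
  show ?thesis
    by (rule that[OF cg dyadic_differentiable[OF fc ul]]) (use bound in \<open>simp add: q_def\<close>)
qed

section \<open>Admissible curves\<close>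

abbreviation (input) vd :: "(real \<Rightarrow> real^'n) \<Rightarrow> real \<Rightarrow> real^'n" where
  "vd f \<equiv> (\<lambda>x. vector_derivative f (at x))"

text \<open>From \<open>(a + b) ^ 2 \<le> 2 * a ^ 2 + 2 * b ^ 2\<close>; a crude inequality, aimed
  only at finiteness for linear combinations.\<close>

lemma gagliardo_add_scaleR:
  fixes g k :: "real \<Rightarrow> real^'n"
  assumes [measurable]: "g \<in> borel_measurable borel" "k \<in> borel_measurable borel"
  shows "gagliardo \<sigma> (\<lambda>x. g x + c *\<^sub>R k x) \<le> 2 * gagliardo \<sigma> g + ennreal (2 * c\<^sup>2) * gagliardo \<sigma> k"
proof -
  let ?I = "\<lambda>g u w. ennreal ((norm (g (u + w) - g u))\<^sup>2 / \<bar>w\<bar> powr (1 + 2 * \<sigma>)) * indicator {-1/2..1/2} w"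
  have p: "?I (\<lambda>x. g x + c *\<^sub>R k x) u w \<le> 2 * ?I g u w + ennreal (2 * c\<^sup>2) * ?I k u w" for u w
  proof -
    let ?a = "g (u + w) - g u" and ?b = "c *\<^sub>R (k (u + w) - k u)"
    have "(norm (?a + ?b))\<^sup>2 \<le> (norm ?a + norm ?b)\<^sup>2" by (intro power_mono norm_triangle_ineq) auto
    also have "\<dots> \<le> 2 * (norm ?a)\<^sup>2 + 2 * (norm ?b)\<^sup>2"
      using zero_le_power2[of "norm ?a - norm ?b"] by (simp add: power2_eq_square algebra_simps)
    also have "(norm ?b)\<^sup>2 = c\<^sup>2 * (norm (k (u + w) - k u))\<^sup>2" by (simp add: power_mult_distrib)
    finally have "(norm (g (u + w) + c *\<^sub>R k (u + w) - (g u + c *\<^sub>R k u)))\<^sup>2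
       \<le> 2 * (norm ?a)\<^sup>2 + 2 * c\<^sup>2 * (norm (k (u + w) - k u))\<^sup>2" by (simp add: algebra_simps)
    from divide_right_mono[OF this, of "\<bar>w\<bar> powr (1 + 2 * \<sigma>)"]
    have "ennreal ((norm (g (u + w) + c *\<^sub>R k (u + w) - (g u + c *\<^sub>R k u)))\<^sup>2 / \<bar>w\<bar> powr (1 + 2 * \<sigma>))
      \<le> ennreal (2 * ((norm ?a)\<^sup>2 / \<bar>w\<bar> powr (1 + 2 * \<sigma>)) + (2 * c\<^sup>2) * ((norm (k (u + w) - k u))\<^sup>2 / \<bar>w\<bar> powr (1 + 2 * \<sigma>)))"
      by (intro ennreal_leI) (simp add: add_divide_distrib)
    also have "\<dots> = 2 * ennreal ((norm ?a)\<^sup>2 / \<bar>w\<bar> powr (1 + 2 * \<sigma>)) + ennreal (2 * c\<^sup>2) * ennreal ((norm (k (u + w) - k u))\<^sup>2 / \<bar>w\<bar> powr (1 + 2 * \<sigma>))"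
      by (subst ennreal_plus) (auto simp: ennreal_mult[symmetric] numeral_mult_ennreal)
    finally show ?thesis by (auto simp: indicator_def)
  qed
  have "gagliardo \<sigma> (\<lambda>x. g x + c *\<^sub>R k x) \<le> (\<integral>\<^sup>+u. (\<integral>\<^sup>+w. 2 * ?I g u w + ennreal (2 * c\<^sup>2) * ?I k u w \<partial>lborel) * indicator {0..1} u \<partial>lborel)"
    unfolding gagliardo_def by (intro nn_integral_mono mult_right_mono) (use p in auto)
  also have "\<dots> = (\<integral>\<^sup>+u. 2 * ((\<integral>\<^sup>+w. ?I g u w \<partial>lborel) * indicator {0..1} u) + ennreal (2 * c\<^sup>2) * ((\<integral>\<^sup>+w. ?I k u w \<partial>lborel) * indicator {0..1} u) \<partial>lborel)"
    by (intro nn_integral_cong) (simp add: nn_integral_add nn_integral_cmult distrib_right mult.assoc)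
  also have "\<dots> = 2 * gagliardo \<sigma> g + ennreal (2 * c\<^sup>2) * gagliardo \<sigma> k"
    unfolding gagliardo_def by (simp add: nn_integral_add nn_integral_cmult)
  finally show ?thesis .
qed

lemma C1_periodic_deriv:
  assumes "periodic1 f" "\<And>x. (f has_vector_derivative g x) (at x)"
  shows "periodic1 g"
  unfolding periodic1_def
proof
  fix x
  have "((\<lambda>y. y + 1) has_vector_derivative 1) (at x)" by (auto intro!: derivative_eq_intros)
  from vector_diff_chain_at[OF this assms(2)]
  have "((\<lambda>y. f (y + 1)) has_vector_derivative g (x + 1)) (at x)" by (simp add: o_def)
  then have "(f has_vector_derivative g (x + 1)) (at x)" using assms(1) by (simp add: periodic1_def)
  then show "g (x + 1) = g x" using assms(2) vector_derivative_unique_at by blast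
qed

lemma C1_weak_deriv:
  fixes f :: "real \<Rightarrow> real^'n"
  assumes "periodic1 f" "\<And>x. (f has_vector_derivative g x) (at x)" and c: "continuous_on UNIV g"
  shows "weak_deriv f g"
proof -
  have ci: "set_integrable lborel {a..b} g" for a b
    by (rule borel_integrable_atLeastAtMost'[OF continuous_on_subset[OF c]]) auto
  have "f b - f a = set_lebesgue_integral lborel {a..b} g" if "a \<le> b" for a b
  proof -
    have "(g has_integral (f b - f a)) {a..b}"
      by (rule fundamental_theorem_of_calculus[OF that]) (rule has_vector_derivative_at_within[OF assms(2)])
    then show ?thesis using set_borel_integral_eq_integral(2)[OF ci, of a b] by (simp add: integral_unique)
  qed
  moreover have "set_nn_integral lborel {0..1} (\<lambda>x. ennreal ((norm (g x))\<^sup>2)) < \<infinity>"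
  proof -
    have "((\<lambda>x. (norm (g x))\<^sup>2) has_integral integral {0..1} (\<lambda>x. (norm (g x))\<^sup>2)) {0..1}"
      by (intro integrable_integral integrable_continuous_real continuous_intros continuous_on_subset[OF c]) auto
    from nn_integral_has_integral_lebesgue'[OF _ this] show ?thesis by simp
  qed
  ultimately show ?thesis
    unfolding weak_deriv_def using C1_periodic_deriv[OF assms(1,2)] ci borel_measurable_continuous_onI[OF c] by auto
qed

lemma HsobI:
  fixes f :: "real \<Rightarrow> real^'n"
  assumes "periodic1 f" "\<And>x. (f has_vector_derivative g x) (at x)" "continuous_on UNIV g" "gagliardo \<sigma> g < \<infinity>"
  shows "Hsob \<sigma> f"
  unfolding Hsob_def using assms C1_weak_deriv[OF assms(1-3)] by auto

text \<open>The constant of \<open>sobolev_embedding\<close>: 2 for the first dyadic quotient, and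
  5/4 times the sum of the geometric series of corrections.\<close>

definition emb :: "real \<Rightarrow> real" where
  "emb \<alpha> = 2 + 5 / 4 * (1 / (1 - (1/2) powr (\<alpha> / 2 - 1)))"

lemma emb_ge: "2 < \<alpha> \<Longrightarrow> 2 \<le> emb \<alpha>"
  using powr_less_mono2[of "\<alpha> / 2 - 1" "1/2" 1] by (simp add: emb_def)

lemma Hsob_C1:
  fixes f :: "real \<Rightarrow> real^'n"
  assumes \<alpha>: "2 < \<alpha>" and H: "Hsob ((\<alpha> - 1) / 2) f"
  shows "(f has_vector_derivative vd f x) (at x)" "continuous_on UNIV (vd f)" "periodic1 (vd f)"
    "gagliardo ((\<alpha> - 1) / 2) (vd f) \<le> ennreal ((Hnorm ((\<alpha> - 1) / 2) f)\<^sup>2)" "0 \<le> Hnorm ((\<alpha> - 1) / 2) f"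
    "norm (vd f x) \<le> emb \<alpha> * Hnorm ((\<alpha> - 1) / 2) f"
proof -
  let ?\<sigma> = "(\<alpha> - 1) / 2"
  obtain g where w: "weak_deriv f g" and gg: "gagliardo ?\<sigma> g < \<infinity>" and per: "periodic1 f" using H by (auto simp: Hsob_def)
  let ?N = "\<lambda>g. (\<integral>\<^sup>+x\<in>{0..1}. ennreal ((norm (g x))\<^sup>2) \<partial>lborel)"
  have L2: "?N g < \<infinity>" using w by (simp add: weak_deriv_def)
  \<comment> \<open>A crude positive bound, from which only the existence of a continuous derivative
    is drawn. The bound by the norm has to wait until the derivative chosen in \<open>Hnorm\<close>
    is identified with it.\<close>
  define \<kappa> where "\<kappa> = 1 + enn2real (gagliardo ?\<sigma> g) + enn2real (?N g)"
  have k1: "1 \<le> \<kappa>" by (simp add: \<kappa>_def)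
  have "enn2real (gagliardo ?\<sigma> g) \<le> \<kappa>\<^sup>2" "enn2real (?N g) \<le> \<kappa>\<^sup>2"
    using power_increasing[of 1 2 \<kappa>] k1 by (auto simp: \<kappa>_def intro: order_trans[of _ \<kappa>])
  note this[THEN ennreal_leI]
  moreover have "ennreal (enn2real (gagliardo ?\<sigma> g)) = gagliardo ?\<sigma> g" "ennreal (enn2real (?N g)) = ?N g"
    using gg L2 by simp_all
  ultimately have b: "gagliardo ?\<sigma> g \<le> ennreal (\<kappa>\<^sup>2)" "?N g \<le> ennreal (\<kappa>\<^sup>2)" by (simp_all only:)
  have s: "\<alpha> = 1 + 2 * ?\<sigma>" by (simp add: field_simps)
  have k0: "0 < \<kappa>" using k1 by simp
  obtain g' where g': "continuous_on UNIV g'" "\<And>x. (f has_vector_derivative g' x) (at x)"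
    using sobolev_embedding[OF w b(1) k0 b(2) s \<alpha>] by metis
  have v: "vd f = g'" using g'(2) vector_derivative_at by blast
  show D: "(f has_vector_derivative vd f x) (at x)" for x using g'(2)[of x] vector_derivative_at[OF g'(2), of x] by simp
  show C: "continuous_on UNIV (vd f)" using g'(1) unfolding v[symmetric] .
  show "periodic1 (vd f)" by (rule C1_periodic_deriv[OF per D])
  define gs where "gs = (SOME g. weak_deriv f g)"
  have ws: "weak_deriv f gs" unfolding gs_def by (rule someI[of "weak_deriv f", OF w])
  have ae: "AE x in lborel. gs x = vd f x" by (rule weak_deriv_unique_AE[OF ws C D])
  have "AE x in lborel. g x = vd f x" by (rule weak_deriv_unique_AE[OF w C D])
  then have gag_fin: "gagliardo ?\<sigma> (vd f) < \<infinity>" using gagliardo_cong_AE gg by metis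
  have gag_eq: "gagliardo ?\<sigma> gs = gagliardo ?\<sigma> (vd f)" by (rule gagliardo_cong_AE[OF ae])
  have [measurable]: "gs \<in> borel_measurable borel" using ws by (simp add: weak_deriv_def)
  have N: "?N gs = ennreal (set_lebesgue_integral lborel {0..1} (\<lambda>x. (norm (gs x))\<^sup>2))"
  proof -
    have fin: "(\<integral>\<^sup>+x. ennreal (indicator {0..1} x *\<^sub>R (norm (gs x))\<^sup>2) \<partial>lborel) = ?N gs"
      by (intro nn_integral_cong) (auto simp: indicator_def)
    have "integrable lborel (\<lambda>x. indicator {0..1} x *\<^sub>R (norm (gs x))\<^sup>2)"
      using ws fin by (intro integrableI_nonneg) (auto simp: weak_deriv_def)
    from nn_integral_eq_integral[OF this] fin show ?thesis
      by (simp add: set_lebesgue_integral_def)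
  qed
  define A where "A = set_lebesgue_integral lborel {0..1} (\<lambda>x. (norm (f x))\<^sup>2)"
  define B where "B = set_lebesgue_integral lborel {0..1} (\<lambda>x. (norm (gs x))\<^sup>2)"
  define G where "G = enn2real (gagliardo ?\<sigma> (vd f))"
  have Hn: "Hnorm ?\<sigma> f = sqrt A + sqrt B + sqrt G"
    unfolding Hnorm_def Let_def gs_def[symmetric] gag_eq A_def B_def G_def ..
  have nn: "0 \<le> A" "0 \<le> B" "0 \<le> G"
    unfolding A_def B_def G_def set_lebesgue_integral_def by (auto intro!: Bochner_Integration.integral_nonneg)
  show H0: "0 \<le> Hnorm ?\<sigma> f" unfolding Hn using nn by simp
  have le: "sqrt B \<le> Hnorm ?\<sigma> f" "sqrt G \<le> Hnorm ?\<sigma> f" unfolding Hn using nn by simp_all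
  have le2: "B \<le> (Hnorm ?\<sigma> f)\<^sup>2" "G \<le> (Hnorm ?\<sigma> f)\<^sup>2"
    using power_mono[OF le(1), of 2] power_mono[OF le(2), of 2] nn by auto
  have gagG: "gagliardo ?\<sigma> (vd f) = ennreal G" unfolding G_def using gag_fin by simp
  show gH: "gagliardo ?\<sigma> (vd f) \<le> ennreal ((Hnorm ?\<sigma> f)\<^sup>2)" unfolding gagG by (rule ennreal_leI[OF le2(2)])
  \<comment> \<open>The embedding requires a positive \<open>\<kappa>\<close> while
    \<open>Hnorm\<close> may vanish, so it is applied to every number above the norm, and then the
    infimum is taken.\<close>
  have "norm (vd f x) \<le> emb \<alpha> * \<kappa>" if "Hnorm ?\<sigma> f < \<kappa>" for \<kappa>
  proof -
    have k: "0 < \<kappa>" "(Hnorm ?\<sigma> f)\<^sup>2 \<le> \<kappa>\<^sup>2" using that H0 by (auto intro!: power_mono)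
    have "gagliardo ?\<sigma> gs \<le> ennreal (\<kappa>\<^sup>2)" "?N gs \<le> ennreal (\<kappa>\<^sup>2)"
      using le2 k gagG gag_eq N by (auto simp: B_def intro!: ennreal_leI)
    then obtain g2 where "\<And>x. (f has_vector_derivative g2 x) (at x)" "\<And>x. norm (g2 x) \<le> emb \<alpha> * \<kappa>"
      using sobolev_embedding[OF ws _ k(1) _ s \<alpha>] unfolding emb_def by metis
    then show ?thesis using vector_derivative_at by metis
  qed
  then have "norm (vd f x) / emb \<alpha> \<le> \<kappa>" if "Hnorm ?\<sigma> f < \<kappa>" for \<kappa>
    using that emb_ge[OF \<alpha>] by (simp add: field_simps)
  then have "norm (vd f x) / emb \<alpha> \<le> Hnorm ?\<sigma> f" by (rule dense_ge)
  then show "norm (vd f x) \<le> emb \<alpha> * Hnorm ?\<sigma> f" using emb_ge[OF \<alpha>] by (simp add: field_simps)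
qed

lemma Hsob_add_scaleR:
  fixes f h :: "real \<Rightarrow> real^'n"
  assumes \<alpha>: "2 < \<alpha>" and f: "Hsob ((\<alpha> - 1) / 2) f" and h: "Hsob ((\<alpha> - 1) / 2) h"
  shows "Hsob ((\<alpha> - 1) / 2) (\<lambda>x. f x + c *\<^sub>R h x)" "vd (\<lambda>x. f x + c *\<^sub>R h x) = (\<lambda>x. vd f x + c *\<^sub>R vd h x)"
proof -
  note F = Hsob_C1[OF \<alpha> f] and K = Hsob_C1[OF \<alpha> h]
  have d: "((\<lambda>x. f x + c *\<^sub>R h x) has_vector_derivative vd f x + c *\<^sub>R vd h x) (at x)" for x
    using F(1)[of x] K(1)[of x] by (auto intro!: derivative_eq_intros)
  then show "vd (\<lambda>x. f x + c *\<^sub>R h x) = (\<lambda>x. vd f x + c *\<^sub>R vd h x)"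
    using vector_derivative_at by blast
  have "gagliardo ((\<alpha> - 1) / 2) (\<lambda>x. vd f x + c *\<^sub>R vd h x) \<le> 2 * gagliardo ((\<alpha> - 1) / 2) (vd f) + ennreal (2 * c\<^sup>2) * gagliardo ((\<alpha> - 1) / 2) (vd h)"
    by (intro gagliardo_add_scaleR borel_measurable_continuous_onI F K)
  also have "\<dots> < \<infinity>" using le_less_trans[OF F(4)] le_less_trans[OF K(4)]
    by (simp add: ennreal_mult_less_top)
  finally have "gagliardo ((\<alpha> - 1) / 2) (\<lambda>x. vd f x + c *\<^sub>R vd h x) < \<infinity>" .
  moreover have "periodic1 (\<lambda>x. f x + c *\<^sub>R h x)" using f h by (simp add: Hsob_def periodic1_def)
  ultimately show "Hsob ((\<alpha> - 1) / 2) (\<lambda>x. f x + c *\<^sub>R h x)"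
    using d F(2) K(2) by (intro HsobI) (auto intro!: continuous_intros)
qed

text \<open>Regularity and injectivity in one quantitative condition: the mean over the segment is
  the velocity at \<open>u\<close> when \<open>w = 0\<close> and the chord divided by
  \<open>w\<close> otherwise. By periodicity \<open>\<bar>w\<bar> \<le> 1/2\<close> captures all
  pairs of points.\<close>

definition nondeg :: "real \<Rightarrow> (real \<Rightarrow> 'a::euclidean_space) \<Rightarrow> bool" where
  "nondeg c g \<longleftrightarrow> (\<forall>u. \<forall>w\<in>{-1/2..1/2}. c \<le> norm (pmean (seg g u w)))"

lemma seg_pmean_diff:
  fixes f :: "real \<Rightarrow> 'a::euclidean_space"
  assumes d: "\<And>x. (f has_vector_derivative g x) (at x)"
  shows "f (u + w) - f u = w *\<^sub>R pmean (seg g u w)"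
proof -
  have "((\<lambda>s. w *\<^sub>R g (u + s * w)) has_integral (f (u + 1 * w) - f (u + 0 * w))) {0..1}"
  proof (rule fundamental_theorem_of_calculus)
    fix s :: real
    have "((\<lambda>s. u + s * w) has_vector_derivative w) (at s)" by (auto intro!: derivative_eq_intros)
    from vector_diff_chain_at[OF this d]
    show "((\<lambda>s. f (u + s * w)) has_vector_derivative w *\<^sub>R g (u + s * w)) (at s within {0..1})"
      by (auto simp: o_def intro: has_vector_derivative_at_within)
  qed simp
  then have "integral {0..1} (\<lambda>s. w *\<^sub>R g (u + s * w)) = f (u + w) - f u" by (intro integral_unique) simp
  then show ?thesis by (simp add: pmean_def seg_def[abs_def])
qed

lemma pmean_seg_continuous:
  fixes g :: "real \<Rightarrow> 'a::euclidean_space"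
  assumes "continuous_on UNIV g"
  shows "continuous_on UNIV (\<lambda>x. pmean (seg g (fst x) (snd x)))"
proof -
  have "continuous_on (UNIV \<times> cbox 0 1) (\<lambda>(x, s). g (fst x + s * snd x))"
    unfolding split_def by (rule continuous_on_compose2[OF assms]) (auto intro!: continuous_intros)
  from integral_continuous_on_param[OF this] show ?thesis by (simp add: pmean_def seg_def[abs_def])
qed

lemma seg_periodic: "periodic1 g \<Longrightarrow> seg g (u + of_int n) w = seg g u w"
  using periodic1_int[of g] by (auto simp: seg_def fun_eq_iff) (metis add.commute add.left_commute)

text \<open>The mean over the segment is jointly continuous across \<open>w = 0\<close> and never
  zero, so its norm has a positive minimum on a compact box; periodicity in \<open>u\<close> spreads
  this to the line.\<close>

lemma admissible_imp_nondeg: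
  fixes \<gamma> :: "real \<Rightarrow> real^'n"
  assumes \<alpha>: "2 < \<alpha>" and a: "admissible ((\<alpha> - 1) / 2) \<gamma>"
  obtains c where "0 < c" "nondeg c (vd \<gamma>)"
proof -
  have H: "Hsob ((\<alpha> - 1) / 2) \<gamma>" and R: "regular_curve \<gamma>" and I: "injective_RZ \<gamma>" using a by (auto simp: admissible_def)
  note F = Hsob_C1[OF \<alpha> H]
  have nz: "pmean (seg (vd \<gamma>) u w) \<noteq> 0" if "w \<in> {-1/2..1/2}" for u w
  proof (cases "w = 0")
    case True
    then have "pmean (seg (vd \<gamma>) u w) = vd \<gamma> u" by (simp add: pmean_def seg_def[abs_def])
    then show ?thesis using R by (simp add: regular_curve_def)
  next
    case False
    \<comment> \<open>Injectivity holds modulo integers, and the only integer in the window is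
      0.\<close>
    have "w \<notin> \<int>"
    proof
      assume "w \<in> \<int>"
      then obtain n where "w = of_int n" by (auto elim: Ints_cases)
      with that False show False by auto
    qed
    then have "\<gamma> (u + w) \<noteq> \<gamma> u" using I unfolding injective_RZ_def by (metis add_diff_cancel_left')
    then show ?thesis using seg_pmean_diff[OF F(1), of u w] by auto
  qed
  let ?B = "{0..1::real} \<times> {-1/2..1/2::real}"
  have co: "continuous_on ?B (\<lambda>x. norm (pmean (seg (vd \<gamma>) (fst x) (snd x))))"
    by (intro continuous_intros continuous_on_subset[OF pmean_seg_continuous[OF F(2)]]) auto
  have "compact ?B" "?B \<noteq> {}" by (auto intro!: compact_Times)
  then obtain x where x: "x \<in> ?B" "\<forall>y\<in>?B. norm (pmean (seg (vd \<gamma>) (fst x) (snd x))) \<le> norm (pmean (seg (vd \<gamma>) (fst y) (snd y)))"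
    using continuous_attains_inf[OF _ _ co] by blast
  show ?thesis
  proof (rule that)
    show "0 < norm (pmean (seg (vd \<gamma>) (fst x) (snd x)))" using nz x(1) by auto
    show "nondeg (norm (pmean (seg (vd \<gamma>) (fst x) (snd x)))) (vd \<gamma>)"
      unfolding nondeg_def
    proof (intro allI ballI)
      fix u w :: real assume w: "w \<in> {-1/2..1/2}"
      have "seg (vd \<gamma>) u w = seg (vd \<gamma>) (frac u) w"
        using seg_periodic[OF F(3), of "frac u" "\<lfloor>u\<rfloor>" w] by (simp add: frac_def)
      moreover have "(frac u, w) \<in> ?B" using w frac_ge_0[of u] frac_lt_1[of u] by auto
      ultimately show "norm (pmean (seg (vd \<gamma>) (fst x) (snd x))) \<le> norm (pmean (seg (vd \<gamma>) u w))"
        using x(2) by fastforce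
    qed
  qed
qed

lemma nondeg_norm_ge:
  assumes "nondeg c g" shows "c \<le> norm (g u)"
  using assms[unfolded nondeg_def, rule_format, of 0 u] by (simp add: pmean_def seg_def[abs_def])

lemma nondeg_imp_admissible:
  fixes \<gamma> :: "real \<Rightarrow> real^'n"
  assumes \<alpha>: "2 < \<alpha>" and H: "Hsob ((\<alpha> - 1) / 2) \<gamma>" and c: "0 < c" "nondeg c (vd \<gamma>)"
  shows "admissible ((\<alpha> - 1) / 2) \<gamma>"
proof -
  note F = Hsob_C1[OF \<alpha> H]
  have "regular_curve \<gamma>"
    unfolding regular_curve_def C1_curve_def
  proof (intro conjI allI)
    show "\<gamma> differentiable (at u)" for u by (rule differentiableI_vector[OF F(1)])
    show "vd \<gamma> u \<noteq> 0" for u using nondeg_norm_ge[OF c(2), of u] c(1) by auto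
  qed (rule F(2))
  moreover have "injective_RZ \<gamma>"
    unfolding injective_RZ_def
  proof (intro allI impI)
    fix u v assume eq: "\<gamma> u = \<gamma> v"
    \<comment> \<open>Rounding shifts the parameter difference into the window by whole
      periods.\<close>
    define n where "n = round (u - v)"
    define w where "w = u - v - of_int n"
    have "\<bar>of_int n - (u - v)\<bar> \<le> 1/2" unfolding n_def by (rule of_int_round_abs_le)
    then have "-1/2 \<le> w" "w \<le> 1/2" unfolding w_def by arith+
    then have w: "w \<in> {-1/2..1/2}" by simp
    have "\<gamma> (v + w) = \<gamma> (u - of_int n)" by (simp add: w_def)
    also have "\<dots> = \<gamma> u" using periodic1_int[of \<gamma> "u - of_int n" n] H by (simp add: Hsob_def)
    finally have "\<gamma> (v + w) - \<gamma> v = 0" using eq by simp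
    then have "w = 0 \<or> pmean (seg (vd \<gamma>) v w) = 0" using seg_pmean_diff[OF F(1), of v w] by simp
    moreover have "pmean (seg (vd \<gamma>) v w) \<noteq> 0" using c(1) c(2)[unfolded nondeg_def, rule_format, OF w, of v] by auto
    ultimately have "u - v = of_int n" by (simp add: w_def)
    then show "u - v \<in> \<int>" by simp
  qed
  ultimately show ?thesis using H by (simp add: admissible_def)
qed

text \<open>Means do not increase the sup norm, so the constant drops by at most the distance of the
  velocities. With the embedding this gives openness of the set of admissible curves.\<close>

lemma nondeg_perturb:
  fixes g g' :: "real \<Rightarrow> 'a::euclidean_space"
  assumes "nondeg c g" "continuous_on UNIV g" "continuous_on UNIV g'" "\<And>u. norm (g' u - g u) \<le> d"
  shows "nondeg (c - d) g'"
  unfolding nondeg_def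
proof (intro allI ballI)
  fix u w :: real assume w: "w \<in> {-1/2..1/2}"
  have "pmean (seg g' u w) - pmean (seg g u w) = pmean (\<lambda>s. seg g' u w s - seg g u w s)"
    by (intro pmean_diff[symmetric] seg_continuous assms)
  also have "norm \<dots> \<le> d" by (intro pmean_norm_le continuous_intros seg_continuous assms) (simp add: seg_def assms(4))
  finally show "c - d \<le> norm (pmean (seg g' u w))"
    using assms(1)[unfolded nondeg_def, rule_format, OF w, of u]
      norm_triangle_ineq2[of "pmean (seg g u w)" "pmean (seg g' u w)"]
    by (simp add: norm_minus_commute)
qed

section \<open>Integrated estimates\<close>

lemma seg_0 [simp]: "seg g u w 0 = g u" and seg_1 [simp]: "seg g u w 1 = g (u + w)"
  by (simp_all add: seg_def)

text \<open>The second half of the period starting at \<open>u\<close> lies over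
  \<open>[u + 1/2, u + 1]\<close>, which by periodicity is the arc that precedes
  \<open>u\<close>.\<close>

lemma seg_half: "(\<lambda>s. seg g u 1 (s / 2)) = seg g u (1/2)" "(\<lambda>s. seg g u 1 ((1 + s) / 2)) = seg g (u + 1/2) (1/2)"
  by (auto simp: seg_def fun_eq_iff add_divide_distrib intro!: arg_cong[of _ _ g])

lemma seg_integral_continuous:
  fixes F :: "real \<Rightarrow> real \<Rightarrow> 'a::euclidean_space"
  assumes "continuous_on UNIV (\<lambda>x. F (fst x) (snd x))"
  shows "continuous_on UNIV (\<lambda>x. integral {0..1} (\<lambda>s. F (fst x) (fst x + s * snd x)))"
proof -
  have "continuous_on (UNIV \<times> cbox 0 1) (\<lambda>(x, s). F (fst x) (fst x + s * snd x))"
    unfolding split_def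
    by (rule continuous_on_compose2[OF assms, of _ "\<lambda>y. (fst (fst y), fst (fst y) + snd y * snd (fst y))", simplified])
       (auto intro!: continuous_intros)
  from integral_continuous_on_param[OF this] show ?thesis by simp
qed

lemma continuous_on_snd_comp: "continuous_on UNIV g \<Longrightarrow> continuous_on UNIV (\<lambda>x. g (snd x))"
  and continuous_on_fst_comp: "continuous_on UNIV g \<Longrightarrow> continuous_on UNIV (\<lambda>x. g (fst x))"
  by (rule continuous_on_compose2[of UNIV g]; auto intro!: continuous_intros)+

lemma plen_seg_continuous: "continuous_on UNIV g \<Longrightarrow> continuous_on UNIV (\<lambda>x. plen (seg g (fst x) (snd x)))"
  unfolding plen_def seg_def
  by (rule seg_integral_continuous[of "\<lambda>u v. norm (g v)"]) (intro continuous_intros continuous_on_snd_comp)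

lemma dplen_seg_continuous:
  assumes "continuous_on UNIV g" "continuous_on UNIV k" "\<And>u. g u \<noteq> 0"
  shows "continuous_on UNIV (\<lambda>x. dplen (seg g (fst x) (snd x)) (seg k (fst x) (snd x)))"
  unfolding dplen_def seg_def using assms(3)
  by (intro seg_integral_continuous[of "\<lambda>u v. sgn (g v) \<bullet> k v"]) (intro continuous_intros continuous_on_snd_comp assms)

lemma Qinc_seg_continuous:
  assumes "continuous_on UNIV g"
  shows "continuous_on UNIV (\<lambda>x. Qinc (seg g (fst x) (snd x)))"
  unfolding Qinc_def seg_0 unfolding seg_def
  by (intro seg_integral_continuous[of "\<lambda>u v. (norm (g v - g u))\<^sup>2"])
     (intro continuous_intros continuous_on_snd_comp continuous_on_fst_comp assms)

section \<open>Integration against the singular weight\<close>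

definition bx :: "(real \<times> real) set" where "bx = {0..1} \<times> {-1/2..1/2}"

lemma bx_borel [measurable]: "bx \<in> sets borel"
  unfolding bx_def by (intro borel_closed closed_Times) auto

lemma weight_measurable: "(\<lambda>x::real \<times> real. \<bar>snd x\<bar> powr a) \<in> borel_measurable borel"
proof -
  have "snd \<in> borel_measurable (borel :: (real \<times> real) measure)"
    by (intro borel_measurable_continuous_onI continuous_intros)
  then show ?thesis by measurable
qed

text \<open>The singular weight is split off so that the functions \<open>H\<close> of interest are
  continuous on the whole box, including \<open>w = 0\<close>.\<close>

definition wint :: "real \<Rightarrow> (real \<Rightarrow> real \<Rightarrow> real) \<Rightarrow> real" where
  "wint \<alpha> H = set_lebesgue_integral lborel bx (\<lambda>x. \<bar>snd x\<bar> powr (-\<alpha>) * H (fst x) (snd x))"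

definition wintegrable :: "real \<Rightarrow> (real \<Rightarrow> real \<Rightarrow> real) \<Rightarrow> bool" where
  "wintegrable \<alpha> H \<longleftrightarrow> set_integrable lborel bx (\<lambda>x. \<bar>snd x\<bar> powr (-\<alpha>) * H (fst x) (snd x))"

lemma nn_bx_iterated:
  fixes F :: "real \<times> real \<Rightarrow> ennreal"
  assumes [measurable]: "(\<lambda>x. F x * indicator bx x) \<in> borel_measurable borel"
  shows "(\<integral>\<^sup>+x\<in>bx. F x \<partial>lborel) = (\<integral>\<^sup>+u\<in>{0..1}. (\<integral>\<^sup>+w\<in>{-1/2..1/2}. F (u, w) \<partial>lborel) \<partial>lborel)"
proof -
  have m: "(\<lambda>x. F x * indicator bx x) \<in> borel_measurable (lborel \<Otimes>\<^sub>M lborel)"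
    using assms by (simp add: lborel_prod)
  have "(\<integral>\<^sup>+x\<in>bx. F x \<partial>lborel) = (\<integral>\<^sup>+u. \<integral>\<^sup>+w. F (u, w) * indicator bx (u, w) \<partial>lborel \<partial>lborel)"
    using lborel.nn_integral_fst[OF m] by (simp add: lborel_prod)
  also have "\<dots> = (\<integral>\<^sup>+u\<in>{0..1}. (\<integral>\<^sup>+w\<in>{-1/2..1/2}. F (u, w) \<partial>lborel) \<partial>lborel)"
    by (intro nn_integral_cong) (auto simp: indicator_def bx_def)
  finally show ?thesis .
qed

text \<open>The place where the order of the Sobolev space is decisive: for
  \<open>\<sigma> = (\<alpha> - 1) / 2\<close> the Gagliardo exponent
  \<open>1 + 2 * \<sigma>\<close> equals the exponent \<open>\<alpha>\<close> of the energy.\<close>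

lemma nn_bx_Qinc:
  fixes g :: "real \<Rightarrow> real^'n"
  assumes g: "continuous_on UNIV g" and \<alpha>: "1 < \<alpha>"
  shows "(\<integral>\<^sup>+x\<in>bx. ennreal (\<bar>snd x\<bar> powr (-\<alpha>) * Qinc (seg g (fst x) (snd x))) \<partial>lborel) \<le> gagliardo ((\<alpha> - 1) / 2) g"
proof -
  have Q: "(\<lambda>x. Qinc (seg g (fst x) (snd x))) \<in> borel_measurable borel"
    by (rule borel_measurable_continuous_onI[OF Qinc_seg_continuous[OF g]])
  have e: "1 + 2 * ((\<alpha> - 1) / 2) = \<alpha>" by (simp add: field_simps)
  have m: "(\<lambda>x. ennreal (\<bar>snd x\<bar> powr (-\<alpha>) * Qinc (seg g (fst x) (snd x))) * indicator bx x) \<in> borel_measurable borel"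
    using borel_measurable_times[OF weight_measurable Q, of "-\<alpha>"] by simp
  show ?thesis unfolding gagliardo_def e nn_bx_iterated[OF m] fst_conv snd_conv
    by (intro nn_integral_mono mult_right_mono nn_integral_Qinc_le[OF g \<alpha>] zero_le)
qed

lemma wintegrable_bound:
  assumes H: "continuous_on bx (\<lambda>x. H (fst x) (snd x))"
    and HB: "\<And>u w. (u, w) \<in> bx \<Longrightarrow> \<bar>H u w\<bar> \<le> B (u, w)"
    and nn: "(\<integral>\<^sup>+x\<in>bx. ennreal (\<bar>snd x\<bar> powr (-\<alpha>) * B x) \<partial>lborel) \<le> ennreal b" and b: "0 \<le> b"
  shows "wintegrable \<alpha> H" "\<bar>wint \<alpha> H\<bar> \<le> b"
proof -
  have mH: "(\<lambda>x. indicator bx x *\<^sub>R H (fst x) (snd x)) \<in> borel_measurable borel"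
    by (intro borel_measurable_continuous_on_indicator H) simp
  let ?F = "\<lambda>x. indicator bx x *\<^sub>R (\<bar>snd x\<bar> powr (-\<alpha>) * H (fst x) (snd x))"
  have "(\<lambda>x. \<bar>snd x\<bar> powr (-\<alpha>) * (indicator bx x *\<^sub>R H (fst x) (snd x))) \<in> borel_measurable borel"
    by (rule borel_measurable_times[OF weight_measurable mH])
  then have m: "?F \<in> borel_measurable lborel" by (simp add: mult_ac)
  have "(\<integral>\<^sup>+x. ennreal (norm (?F x)) \<partial>lborel) \<le> (\<integral>\<^sup>+x\<in>bx. ennreal (\<bar>snd x\<bar> powr (-\<alpha>) * B x) \<partial>lborel)"
    using HB by (intro nn_integral_mono) (auto simp: indicator_def abs_mult intro!: ennreal_leI mult_left_mono)
  also note nn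
  finally have le: "(\<integral>\<^sup>+x. ennreal (norm (?F x)) \<partial>lborel) \<le> ennreal b" .
  then have i: "integrable lborel ?F" using m by (intro integrableI_bounded) (auto simp: le_less_trans)
  then show "wintegrable \<alpha> H" unfolding wintegrable_def set_integrable_def .
  have "ennreal (norm (integral\<^sup>L lborel ?F)) \<le> ennreal b"
    using integral_norm_bound_ennreal[OF i] le by (rule order_trans)
  then show "\<bar>wint \<alpha> H\<bar> \<le> b" using b unfolding wint_def set_lebesgue_integral_def by simp
qed

lemma wint_diff: "wintegrable \<alpha> H \<Longrightarrow> wintegrable \<alpha> H' \<Longrightarrow> wint \<alpha> (\<lambda>u w. H u w - H' u w) = wint \<alpha> H - wint \<alpha> H'"
  unfolding wint_def wintegrable_def by (simp add: right_diff_distrib set_integral_diff)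

lemma wint_add: "wintegrable \<alpha> H \<Longrightarrow> wintegrable \<alpha> H' \<Longrightarrow> wint \<alpha> (\<lambda>u w. H u w + c * H' u w) = wint \<alpha> H + c * wint \<alpha> H'"
proof -
  assume a: "wintegrable \<alpha> H" "wintegrable \<alpha> H'"
  then have "set_integrable lborel bx (\<lambda>x. c * (\<bar>snd x\<bar> powr (-\<alpha>) * H' (fst x) (snd x)))"
    unfolding wintegrable_def by (intro set_integrable_mult_right)
  from set_integral_add(2)[OF a(1)[unfolded wintegrable_def] this]
  show ?thesis unfolding wint_def by (simp add: algebra_simps)
qed

text \<open>The class of velocities over which the constants of \<open>Psi_bounds\<close> and
  \<open>drho_bounds\<close> are uniform.\<close>

definition nice :: "real \<Rightarrow> real \<Rightarrow> (real \<Rightarrow> 'a::euclidean_space) \<Rightarrow> bool" where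
  "nice c C g \<longleftrightarrow> continuous_on UNIV g \<and> periodic1 g \<and> nondeg c g \<and> (\<forall>u. norm (g u) \<le> C)"

lemma niceD:
  assumes "nice c C g"
  shows "continuous_on UNIV g" "periodic1 g" "nondeg c g" "norm (g u) \<le> C" "c \<le> norm (g u)" "c \<le> C"
    "w \<in> {-1/2..1/2} \<Longrightarrow> c \<le> norm (pmean (seg g u w))"
  using assms nondeg_norm_ge[of c g] order_trans[of c "norm (g 0)" C] unfolding nice_def nondeg_def by auto

text \<open>Directions in \<open>path_data\<close> have norm at most 1, hence the division by
  \<open>\<kappa>\<close>; the factor returns through the linearity of \<open>Psi\<close> and
  \<open>drho\<close> in the direction.\<close>

lemma seg_path_data:
  assumes g: "nice c C g" and g': "nice c C g'" and k: "continuous_on UNIV k" "\<And>u. norm (k u) \<le> \<kappa>"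
    and \<nu>: "0 < \<nu>" "\<nu> \<le> 1" "\<And>u. norm (g' u - g u) \<le> \<nu>" and \<kappa>: "0 < \<kappa>"
  shows "(\<nu>, seg g u w, seg g' u w, \<lambda>s. seg k u w s /\<^sub>R \<kappa>) \<in> path_data c C"
    "w \<in> {-1/2..1/2} \<Longrightarrow> (\<nu>, seg g u w, seg g' u w, \<lambda>s. seg k u w s /\<^sub>R \<kappa>) \<in> path_data_mean c C"
proof -
  have "norm (k v) / \<kappa> \<le> 1" for v using k(2)[of v] \<kappa> by simp
  then show 1: "(\<nu>, seg g u w, seg g' u w, \<lambda>s. seg k u w s /\<^sub>R \<kappa>) \<in> path_data c C"
    unfolding path_data_def mem_Collect_eq case_prod_conv
    using \<kappa> by (intro conjI ballI \<nu>(1,2) seg_continuous[OF niceD(1)[OF g]] seg_continuous[OF niceD(1)[OF g']]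
       continuous_on_scaleR[OF continuous_on_const seg_continuous[OF k(1)]])
       (simp_all add: seg_def niceD(4,5)[OF g] niceD(4,5)[OF g'] \<nu>(3) divide_inverse mult.commute)
  show "(\<nu>, seg g u w, seg g' u w, \<lambda>s. seg k u w s /\<^sub>R \<kappa>) \<in> path_data_mean c C" if "w \<in> {-1/2..1/2}"
    using 1 niceD(7)[OF g that] niceD(7)[OF g' that] by (simp add: path_data_mean_def)
qed

lemma Qinc_scaleR: "Qinc (\<lambda>s. c *\<^sub>R p s) = c\<^sup>2 * Qinc p"
  unfolding Qinc_def by (simp add: scaleR_diff_right[symmetric] power_mult_distrib del: scaleR_diff_right)

lemma dplen_add_scaleR:
  assumes "continuous_on {0..1} p" "\<And>s. s \<in> {0..1} \<Longrightarrow> p s \<noteq> 0" "continuous_on {0..1} k" "continuous_on {0..1} k'"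
  shows "dplen p (\<lambda>s. k s + c *\<^sub>R k' s) = dplen p k + c * dplen p k'"
proof -
  have "(\<lambda>s. sgn (p s) \<bullet> k s) integrable_on {0..1}" "(\<lambda>s. c * (sgn (p s) \<bullet> k' s)) integrable_on {0..1}"
    by (intro integrable_continuous_real continuous_intros assms; simp add: assms)+
  from integral_add[OF this] show ?thesis unfolding dplen_def by (simp add: inner_add_right)
qed

lemma Psi_add_scaleR:
  assumes "continuous_on {0..1} p" "\<And>s. s \<in> {0..1} \<Longrightarrow> p s \<noteq> 0" "continuous_on {0..1} k" "continuous_on {0..1} k'"
  shows "Psi \<alpha> p (\<lambda>s. k s + c *\<^sub>R k' s) = Psi \<alpha> p k + c * Psi \<alpha> p k'"
proof -
  have d: "dplen p (\<lambda>s. k s + c *\<^sub>R k' s) = dplen p k + c * dplen p k'"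
    by (rule dplen_add_scaleR[OF assms])
  show ?thesis unfolding Psi_def pmean_add_scaleR[OF assms(3,4)] d
    by (simp add: inner_add_right ring_distribs)
qed

lemma drho_add_scaleR:
  assumes p: "continuous_on {0..1} p" "\<And>s. s \<in> {0..1} \<Longrightarrow> p s \<noteq> 0" and k: "continuous_on {0..1} k" "continuous_on {0..1} k'"
  shows "drho \<alpha> p (\<lambda>s. k s + c *\<^sub>R k' s) = drho \<alpha> p k + c * drho \<alpha> p k'"
proof -
  have 1: "dplen (\<lambda>s. p (g s)) (\<lambda>s. k (g s) + c *\<^sub>R k' (g s)) = dplen (\<lambda>s. p (g s)) (\<lambda>s. k (g s)) + c * dplen (\<lambda>s. p (g s)) (\<lambda>s. k' (g s))"
    if g: "continuous_on {0..1} g" "\<And>s. s \<in> {0..1} \<Longrightarrow> g s \<in> {0..1}" for g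
    by (rule dplen_add_scaleR; (rule continuous_on_compose2[OF _ g(1)])?)
       (use p k g(2) in \<open>auto simp del: atLeastAtMost_iff\<close>)
  have g1: "continuous_on {0..1} (\<lambda>s::real. s / 2)" "\<And>s::real. s \<in> {0..1} \<Longrightarrow> s / 2 \<in> {0..1}"
   and g2: "continuous_on {0..1} (\<lambda>s::real. (1 + s) / 2)" "\<And>s::real. s \<in> {0..1} \<Longrightarrow> (1 + s) / 2 \<in> {0..1}"
    by (auto intro!: continuous_intros)
  have e: "(x + c * x') * q / r - n * (a * ((y + c * y') / 2) + b * ((z + c * z') / 2) - m * ((y + c * y') / 2 + (z + c * z') / 2))
     = (x * q / r - n * (a * (y / 2) + b * (z / 2) - m * (y / 2 + z / 2)))
       + c * (x' * q / r - n * (a * (y' / 2) + b * (z' / 2) - m * (y' / 2 + z' / 2)))"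
    for x x' q r n a b m y y' z z' :: real
    by (simp add: add_divide_distrib ring_distribs mult_ac)
  have a1: "dplen (\<lambda>s. p (s / 2)) (\<lambda>s. k (s / 2) + c *\<^sub>R k' (s / 2)) = dplen (\<lambda>s. p (s / 2)) (\<lambda>s. k (s / 2)) + c * dplen (\<lambda>s. p (s / 2)) (\<lambda>s. k' (s / 2))"
    by (rule 1[OF g1])
  have a2: "dplen (\<lambda>s. p ((1 + s) / 2)) (\<lambda>s. k ((1 + s) / 2) + c *\<^sub>R k' ((1 + s) / 2)) = dplen (\<lambda>s. p ((1 + s) / 2)) (\<lambda>s. k ((1 + s) / 2)) + c * dplen (\<lambda>s. p ((1 + s) / 2)) (\<lambda>s. k' ((1 + s) / 2))"
    by (rule 1[OF g2])
  show ?thesis unfolding drho_def Let_def inner_add_right inner_scaleR_right a1 a2 by (rule e)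
qed

text \<open>The candidate for the derivative, obtained from \<open>Eg\<close> by differentiating
  under both integrals. Energy and derivative depend on the curve through its velocity
  alone.\<close>

definition DEg :: "real \<Rightarrow> (real \<Rightarrow> real^'n) \<Rightarrow> (real \<Rightarrow> real^'n) \<Rightarrow> real" where
  "DEg \<alpha> g k = wint \<alpha> (\<lambda>u w. Psi \<alpha> (seg g u w) (seg k u w))
     - set_lebesgue_integral lborel {0..1} (\<lambda>u. drho \<alpha> (seg g u 1) (seg k u 1))"

definition Eg :: "real \<Rightarrow> (real \<Rightarrow> real^'n) \<Rightarrow> real" where
  "Eg \<alpha> g = wint \<alpha> (\<lambda>u w. Phi \<alpha> (seg g u w))
     - set_lebesgue_integral lborel {0..1} (\<lambda>u. rho \<alpha> (seg g u 1))"

lemma Psi_scaleR: "Psi \<alpha> p (\<lambda>s. c *\<^sub>R k s) = c * Psi \<alpha> p k"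
  unfolding Psi_def dplen_def pmean_scaleR by (simp add: ring_distribs mult_ac)

lemma drho_scaleR: "drho \<alpha> p (\<lambda>s. c *\<^sub>R k s) = c * drho \<alpha> p k"
  unfolding drho_def dplen_def Let_def by (simp add: ring_distribs mult_ac)

context
  fixes c C :: real and g :: "real \<Rightarrow> 'a::euclidean_space"
  assumes c: "0 < c" and g: "nice c C g"
begin

lemma nice_nz: "g u \<noteq> 0"
  using niceD(5)[OF g, of u] c by auto

lemma nice_plen_ge: "c \<le> plen (seg g u w)"
  using niceD[OF g] by (intro plen_ge seg_continuous) (auto simp: seg_def)

lemma nice_cont:
  shows "continuous_on S (\<lambda>x. g (fst x + snd x))" "continuous_on S (\<lambda>x. g (fst x))"
    "continuous_on S (\<lambda>x. pmean (seg g (fst x) (snd x)))" "continuous_on S (\<lambda>x. plen (seg g (fst x) (snd x)))"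
    "continuous_on T (\<lambda>u. g u)" "continuous_on T (\<lambda>u. plen (seg g u w))" "continuous_on T (\<lambda>u. plen (seg g (u + v) w))"
proof -
  note gc = niceD(1)[OF g]
  show "continuous_on S (\<lambda>x. g (fst x + snd x))" "continuous_on S (\<lambda>x. g (fst x))"
    by (rule continuous_on_compose2[OF gc]; auto intro!: continuous_intros)+
  show "continuous_on S (\<lambda>x. pmean (seg g (fst x) (snd x)))" "continuous_on S (\<lambda>x. plen (seg g (fst x) (snd x)))"
    using continuous_on_subset[OF pmean_seg_continuous[OF gc]] continuous_on_subset[OF plen_seg_continuous[OF gc]] by auto
  show "continuous_on T (\<lambda>u. g u)" by (rule continuous_on_subset[OF gc]) simp
  show 1: "continuous_on T (\<lambda>u. plen (seg g (u + v) w))" for v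
    by (rule continuous_on_compose2[OF plen_seg_continuous[OF gc], of _ "\<lambda>u. (u + v, w)", simplified]) (intro continuous_intros)
  show "continuous_on T (\<lambda>u. plen (seg g u w))" using 1[of 0] by simp
qed

lemma bx_nz: "x \<in> bx \<Longrightarrow> pmean (seg g (fst x) (snd x)) \<noteq> 0"
  using niceD(7)[OF g, of "snd x" "fst x"] c by (auto simp: bx_def)

lemma nice_plen_nz: "plen (seg g u w) \<noteq> 0"
  using nice_plen_ge[of u w] c by auto

lemma half_sum_pos: "0 < (plen (seg g u (1/2)) / 2 + plen (seg g (u + 1/2) (1/2)) / 2) / 2"
  by (intro divide_pos_pos add_pos_pos less_le_trans[OF c nice_plen_ge]) auto

lemma Phi_seg_continuous: "continuous_on bx (\<lambda>x. Phi \<alpha> (seg g (fst x) (snd x)))"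
  unfolding Phi_def seg_0 seg_1
  by (intro continuous_intros nice_cont ballI) (auto simp: bx_nz nice_plen_nz)

lemma rho_seg_continuous: "continuous_on T (\<lambda>u. rho \<alpha> (seg g u 1))"
proof -
  have n: "(plen (seg g u (1/2)) / 2 + plen (seg g (u + 1/2) (1/2)) / 2) / 2 \<noteq> 0" "plen (seg g u v) / 2 \<noteq> 0" for u v
    by (rule less_imp_neq[OF half_sum_pos, symmetric]) (simp add: nice_plen_nz)
  show ?thesis unfolding rho_def Let_def seg_half seg_0 divide_inverse[of _ "\<alpha> - 1"]
    by (intro continuous_intros nice_cont ballI n) simp_all
qed

context
  fixes k :: "real \<Rightarrow> 'a" assumes k: "continuous_on UNIV k"
begin

lemma nice_dcont:
  shows "continuous_on S (\<lambda>x. k (fst x + snd x))" "continuous_on S (\<lambda>x. k (fst x))"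
    "continuous_on S (\<lambda>x. pmean (seg k (fst x) (snd x)))"
    "continuous_on S (\<lambda>x. dplen (seg g (fst x) (snd x)) (seg k (fst x) (snd x)))"
    "continuous_on T (\<lambda>u. k u)" "continuous_on T (\<lambda>u. dplen (seg g u w) (seg k u w))"
    "continuous_on T (\<lambda>u. dplen (seg g (u + v) w) (seg k (u + v) w))"
proof -
  note dc = dplen_seg_continuous[OF niceD(1)[OF g] k nice_nz]
  show "continuous_on S (\<lambda>x. k (fst x + snd x))" "continuous_on S (\<lambda>x. k (fst x))"
    by (rule continuous_on_compose2[OF k]; auto intro!: continuous_intros)+
  show "continuous_on S (\<lambda>x. pmean (seg k (fst x) (snd x)))" "continuous_on S (\<lambda>x. dplen (seg g (fst x) (snd x)) (seg k (fst x) (snd x)))"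
    using continuous_on_subset[OF pmean_seg_continuous[OF k]] continuous_on_subset[OF dc] by auto
  show "continuous_on T (\<lambda>u. k u)" by (rule continuous_on_subset[OF k]) simp
  show 1: "continuous_on T (\<lambda>u. dplen (seg g (u + v) w) (seg k (u + v) w))" for v
    by (rule continuous_on_compose2[OF dc, of _ "\<lambda>u. (u + v, w)", simplified]) (intro continuous_intros)
  show "continuous_on T (\<lambda>u. dplen (seg g u w) (seg k u w))" using 1[of 0] by simp
qed

lemma Psi_seg_continuous: "continuous_on bx (\<lambda>x. Psi \<alpha> (seg g (fst x) (snd x)) (seg k (fst x) (snd x)))"
  unfolding Psi_def seg_0 seg_1
  by (intro continuous_intros nice_cont nice_dcont ballI) (auto simp: bx_nz nice_plen_nz nice_nz)

lemma drho_seg_continuous: "continuous_on T (\<lambda>u. drho \<alpha> (seg g u 1) (seg k u 1))"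
proof -
  have n: "(plen (seg g u (1/2)) / 2 + plen (seg g (u + 1/2) (1/2)) / 2) / 2 \<noteq> 0" "plen (seg g u v) / 2 \<noteq> 0" for u v
    by (rule less_imp_neq[OF half_sum_pos, symmetric]) (simp add: nice_plen_nz)
  show ?thesis unfolding drho_def Let_def seg_half seg_0 divide_inverse[of _ "\<alpha> - 1"]
    by (intro continuous_intros nice_cont nice_dcont ballI n nice_nz) simp_all
qed

end

end

lemma set_integral_unit_bound:
  fixes f :: "real \<Rightarrow> real"
  assumes "continuous_on {0..1} f" "\<And>u. u \<in> {0..1} \<Longrightarrow> \<bar>f u\<bar> \<le> B"
  shows "\<bar>set_lebesgue_integral lborel {0..1} f\<bar> \<le> B"
  using set_borel_integral_eq_integral(2)[OF borel_integrable_atLeastAtMost'[OF assms(1)]]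
    integral_bound[of 0 1 f B] assms by simp

text \<open>One Sobolev ball serves every purpose: \<open>\<nu>\<close> bounds the distance of the
  two velocities both uniformly and in the seminorm, and \<open>\<kappa>\<close> does the same for
  the direction. Only the base velocity \<open>g\<close> carries a seminorm bound
  \<open>\<Gamma>\<close> of arbitrary size.\<close>

definition curve_data :: "real \<Rightarrow> real \<Rightarrow> real \<Rightarrow> real \<Rightarrow> (real \<Rightarrow> real^'n) \<Rightarrow> (real \<Rightarrow> real^'n) \<Rightarrow> (real \<Rightarrow> real^'n) \<Rightarrow> real \<Rightarrow> real \<Rightarrow> bool" where
  "curve_data \<alpha> c C \<Gamma> g g' k \<nu> \<kappa> \<longleftrightarrow> nice c C g \<and> nice c C g' \<and> continuous_on UNIV k \<and> (\<forall>u. norm (k u) \<le> \<kappa>) \<and>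
     0 < \<kappa> \<and> 0 < \<nu> \<and> \<nu> \<le> 1 \<and> (\<forall>u. norm (g' u - g u) \<le> \<nu>) \<and> 0 \<le> \<Gamma> \<and>
     gagliardo ((\<alpha> - 1) / 2) g \<le> ennreal \<Gamma> \<and> gagliardo ((\<alpha> - 1) / 2) (\<lambda>u. g' u - g u) \<le> ennreal (\<nu>\<^sup>2) \<and>
     gagliardo ((\<alpha> - 1) / 2) k \<le> ennreal (\<kappa>\<^sup>2)"

definition cd_quad where
  "cd_quad g g' k \<nu> \<kappa> x = Qinc (seg g (fst x) (snd x)) + Qinc (\<lambda>s. (seg g' (fst x) (snd x) s - seg g (fst x) (snd x) s) /\<^sub>R \<nu>)
     + Qinc (\<lambda>s. seg k (fst x) (snd x) s /\<^sub>R \<kappa>)"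

text \<open>After rescaling by \<open>\<nu>\<close> and \<open>\<kappa>\<close> the difference and
  the direction have seminorm at most 1; these are the two units added to
  \<open>\<Gamma>\<close>.\<close>

lemma nn_cd_quad:
  fixes g :: "real \<Rightarrow> real^'n"
  assumes cd: "curve_data \<alpha> c C \<Gamma> g g' k \<nu> \<kappa>" and \<alpha>: "1 < \<alpha>" and L: "0 \<le> L"
  shows "(\<integral>\<^sup>+x\<in>bx. ennreal (\<bar>snd x\<bar> powr (-\<alpha>) * (L * cd_quad g g' k \<nu> \<kappa> x)) \<partial>lborel) \<le> ennreal (L * (\<Gamma> + 2))"
proof -
  let ?f = "\<lambda>u. g' u - g u"
  have nu: "0 < \<nu>" "0 < \<kappa>" "0 \<le> \<Gamma>" using cd by (auto simp: curve_data_def)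
  have co: "continuous_on UNIV g" "continuous_on UNIV ?f" "continuous_on UNIV k"
    using cd niceD(1) unfolding curve_data_def by (blast intro!: continuous_intros)+
  have q: "cd_quad g g' k \<nu> \<kappa> x = Qinc (seg g (fst x) (snd x)) + inverse (\<nu>\<^sup>2) * Qinc (seg ?f (fst x) (snd x)) + inverse (\<kappa>\<^sup>2) * Qinc (seg k (fst x) (snd x))" for x
  proof -
    have e: "(\<lambda>s. (seg g' (fst x) (snd x) s - seg g (fst x) (snd x) s) /\<^sub>R \<nu>) = (\<lambda>s. inverse \<nu> *\<^sub>R seg ?f (fst x) (snd x) s)"
      by (simp add: seg_def)
    show ?thesis unfolding cd_quad_def e Qinc_scaleR power_inverse by simp
  qed
  let ?X = "\<lambda>h x. ennreal (\<bar>snd x\<bar> powr (-\<alpha>) * Qinc (seg h (fst x) (snd x))) * indicator bx x"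
  have X[measurable]: "?X h \<in> borel_measurable borel" if "continuous_on UNIV h" for h :: "real \<Rightarrow> real^'n"
    using borel_measurable_times[OF weight_measurable borel_measurable_continuous_onI[OF Qinc_seg_continuous[OF that]], of "-\<alpha>"] by simp
  have Q0: "0 \<le> Qinc (seg h u w)" if "continuous_on UNIV h" for h :: "real \<Rightarrow> real^'n" and u w
    by (intro Qinc_nonneg seg_continuous that)
  have "ennreal (\<bar>snd x\<bar> powr (-\<alpha>) * (L * cd_quad g g' k \<nu> \<kappa> x)) * indicator bx x
     = ennreal L * (?X g x + (ennreal (inverse (\<nu>\<^sup>2)) * ?X ?f x + ennreal (inverse (\<kappa>\<^sup>2)) * ?X k x))" for x
  proof -
    let ?w = "\<bar>snd x\<bar> powr (-\<alpha>)" and ?a = "Qinc (seg g (fst x) (snd x))" and ?b = "Qinc (seg ?f (fst x) (snd x))" and ?d = "Qinc (seg k (fst x) (snd x))"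
    have e: "?w * (L * cd_quad g g' k \<nu> \<kappa> x) = L * (?w * ?a + (inverse (\<nu>\<^sup>2) * (?w * ?b) + inverse (\<kappa>\<^sup>2) * (?w * ?d)))"
      unfolding q by (simp add: algebra_simps)
    have "ennreal (?w * (L * cd_quad g g' k \<nu> \<kappa> x)) = ennreal L * (ennreal (?w * ?a) + (ennreal (inverse (\<nu>\<^sup>2)) * ennreal (?w * ?b) + ennreal (inverse (\<kappa>\<^sup>2)) * ennreal (?w * ?d)))"
      unfolding e using L Q0[OF co(1)] Q0[OF co(2)] Q0[OF co(3)]
      by (simp add: ennreal_mult ennreal_plus)
    then show ?thesis by (auto simp: indicator_def)
  qed
  note pw = this
  have gen: "(\<integral>\<^sup>+x. l * (A x + (m * B x + n * D x)) \<partial>lborel) = l * ((\<integral>\<^sup>+x. A x \<partial>lborel) + (m * (\<integral>\<^sup>+x. B x \<partial>lborel) + n * (\<integral>\<^sup>+x. D x \<partial>lborel)))"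
    if [measurable]: "A \<in> borel_measurable borel" "B \<in> borel_measurable borel" "D \<in> borel_measurable borel" for A B D :: "real \<times> real \<Rightarrow> ennreal" and l m n
    by (simp add: nn_integral_cmult nn_integral_add)
  from pw have "(\<integral>\<^sup>+x\<in>bx. ennreal (\<bar>snd x\<bar> powr (-\<alpha>) * (L * cd_quad g g' k \<nu> \<kappa> x)) \<partial>lborel)
     = (\<integral>\<^sup>+x. ennreal L * (?X g x + (ennreal (inverse (\<nu>\<^sup>2)) * ?X ?f x + ennreal (inverse (\<kappa>\<^sup>2)) * ?X k x)) \<partial>lborel)"
    by simp
  also have "\<dots> = ennreal L * ((\<integral>\<^sup>+x. ?X g x \<partial>lborel) + (ennreal (inverse (\<nu>\<^sup>2)) * (\<integral>\<^sup>+x. ?X ?f x \<partial>lborel) + ennreal (inverse (\<kappa>\<^sup>2)) * (\<integral>\<^sup>+x. ?X k x \<partial>lborel)))"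
    by (rule gen[OF X[OF co(1)] X[OF co(2)] X[OF co(3)]])
  also have "\<dots> \<le> ennreal L * (ennreal \<Gamma> + (ennreal (inverse (\<nu>\<^sup>2)) * ennreal (\<nu>\<^sup>2) + ennreal (inverse (\<kappa>\<^sup>2)) * ennreal (\<kappa>\<^sup>2)))"
    using cd unfolding curve_data_def
    by (intro mult_left_mono add_mono order_trans[OF nn_bx_Qinc[OF co(1) \<alpha>]] order_trans[OF nn_bx_Qinc[OF co(2) \<alpha>]]
        order_trans[OF nn_bx_Qinc[OF co(3) \<alpha>]] zero_le) auto
  also have "\<dots> = ennreal (L * (\<Gamma> + 2))"
  proof -
    have "ennreal (inverse (\<nu>\<^sup>2)) * ennreal (\<nu>\<^sup>2) = ennreal 1" "ennreal (inverse (\<kappa>\<^sup>2)) * ennreal (\<kappa>\<^sup>2) = ennreal 1"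
      using nu by (simp_all add: ennreal_mult[symmetric])
    moreover have "ennreal \<Gamma> + (ennreal 1 + ennreal 1) = ennreal (\<Gamma> + 2)"
    proof -
      have "ennreal \<Gamma> + (ennreal 1 + ennreal 1) = ennreal (\<Gamma> + (1 + 1))"
        using nu by (simp only: ennreal_plus add_nonneg_nonneg zero_le_one)
      then show ?thesis by simp
    qed
    ultimately show ?thesis using nu L by (simp only: ennreal_mult[of L "\<Gamma> + 2"])
  qed
  finally show ?thesis .
qed

lemma curve_dataD:
  assumes "curve_data \<alpha> c C \<Gamma> g g' k \<nu> \<kappa>"
  shows "nice c C g" "nice c C g'" "continuous_on UNIV k" "norm (k u) \<le> \<kappa>" "0 < \<kappa>" "0 < \<nu>" "\<nu> \<le> 1"
    "norm (g' u - g u) \<le> \<nu>" "0 \<le> \<Gamma>"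
  using assms by (auto simp: curve_data_def)

text \<open>The mean value inequality for \<open>\<phi> t - t * \<phi>' 0\<close>. A Lipschitz bound
  on the first derivative replaces any second derivative.\<close>

lemma MVT_linear_error:
  fixes \<phi> :: "real \<Rightarrow> real"
  assumes "\<And>t. t \<in> {0..1} \<Longrightarrow> (\<phi> has_real_derivative \<phi>' t) (at t within {0..1})"
    and "\<And>t. t \<in> {0..1} \<Longrightarrow> \<bar>\<phi>' t - \<phi>' 0\<bar> \<le> B"
  shows "\<bar>\<phi> 1 - \<phi> 0 - \<phi>' 0\<bar> \<le> B"
proof -
  have "norm ((\<phi> 1 - 1 * \<phi>' 0) - (\<phi> 0 - 0 * \<phi>' 0)) \<le> B * norm (1 - 0 :: real)"
    by (rule field_differentiable_bound[where S="{0..1}" and f'="\<lambda>t. \<phi>' t - \<phi>' 0"])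
       (use assms in \<open>auto intro!: derivative_eq_intros\<close>)
  then show ?thesis by simp
qed

lemma seg_line: "(\<lambda>s. seg g u w s + t *\<^sub>R seg k u w s) = seg (\<lambda>x. g x + t *\<^sub>R k x) u w"
  by (simp add: seg_def fun_eq_iff)

text \<open>Pointwise bounds are integrated against the weight; \<open>\<Gamma> + 3\<close>
  dominates both the \<open>\<Gamma> + 2\<close> of the singular part and the \<open>1\<close> of
  the part with \<open>rho\<close>. In the last clause the perturbation is also the direction, so
  \<open>\<nu>\<close> and \<open>\<kappa>\<close> coincide and the remainder is quadratic.\<close>

lemma energy_estimates:
  fixes c C \<alpha> :: real
  assumes c: "0 < c" "c \<le> C" and \<alpha>: "2 < \<alpha>"
  obtains K where "K \<ge> 0"
    "\<And>\<Gamma> g g' \<nu> \<kappa> (k :: real \<Rightarrow> real^'n). curve_data \<alpha> c C \<Gamma> g g' k \<nu> \<kappa> \<Longrightarrow> wintegrable \<alpha> (\<lambda>u w. Phi \<alpha> (seg g u w))"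
    "\<And>\<Gamma> g g' \<nu> \<kappa> (k :: real \<Rightarrow> real^'n). curve_data \<alpha> c C \<Gamma> g g' k \<nu> \<kappa> \<Longrightarrow> wintegrable \<alpha> (\<lambda>u w. Psi \<alpha> (seg g u w) (seg k u w))"
    "\<And>\<Gamma> g g' \<nu> \<kappa> (k :: real \<Rightarrow> real^'n). curve_data \<alpha> c C \<Gamma> g g' k \<nu> \<kappa> \<Longrightarrow> \<bar>DEg \<alpha> g k\<bar> \<le> K * (\<Gamma> + 3) * \<kappa>"
    "\<And>\<Gamma> g g' \<nu> \<kappa> (k :: real \<Rightarrow> real^'n). curve_data \<alpha> c C \<Gamma> g g' k \<nu> \<kappa> \<Longrightarrow> \<bar>DEg \<alpha> g' k - DEg \<alpha> g k\<bar> \<le> K * (\<Gamma> + 3) * (\<nu> * \<kappa>)"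
    "\<And>\<Gamma> g \<kappa> (k :: real \<Rightarrow> real^'n). curve_data \<alpha> c C \<Gamma> g (\<lambda>u. g u + k u) k \<kappa> \<kappa> \<Longrightarrow>
       (\<And>t. t \<in> {0..1} \<Longrightarrow> nice c C (\<lambda>u. g u + t *\<^sub>R k u)) \<Longrightarrow> wintegrable \<alpha> (\<lambda>u w. Phi \<alpha> (seg (\<lambda>u. g u + k u) u w)) \<Longrightarrow>
       \<bar>Eg \<alpha> (\<lambda>u. g u + k u) - Eg \<alpha> g - DEg \<alpha> g k\<bar> \<le> K * (\<Gamma> + 3) * (\<kappa> * \<kappa>)"
proof -
  have a1: "1 < \<alpha>" using \<alpha> by simp
  obtain K1 where K1: "K1 \<ge> 0"
    "\<And>\<nu> p p' k :: real \<Rightarrow> real^'n. (\<nu>, p, p', k) \<in> path_data_mean c C \<Longrightarrow>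
       \<bar>Phi \<alpha> p\<bar> \<le> K1 * (Qinc p + Qinc (\<lambda>s. (p' s - p s) /\<^sub>R \<nu>) + Qinc k)"
    "\<And>\<nu> p p' k :: real \<Rightarrow> real^'n. (\<nu>, p, p', k) \<in> path_data_mean c C \<Longrightarrow>
       \<bar>Psi \<alpha> p k\<bar> \<le> K1 * (Qinc p + Qinc (\<lambda>s. (p' s - p s) /\<^sub>R \<nu>) + Qinc k)"
    "\<And>\<nu> p p' k :: real \<Rightarrow> real^'n. (\<nu>, p, p', k) \<in> path_data_mean c C \<Longrightarrow>
       \<bar>Psi \<alpha> p' k - Psi \<alpha> p k\<bar> \<le> K1 * \<nu> * (Qinc p + Qinc (\<lambda>s. (p' s - p s) /\<^sub>R \<nu>) + Qinc k)"
    by (rule Psi_bounds[OF c, of \<alpha>]) (rule that; blast)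
  obtain K2 where K2: "K2 \<ge> 0"
    "\<And>\<nu> p p' k :: real \<Rightarrow> real^'n. (\<nu>, p, p', k) \<in> path_data c C \<Longrightarrow> \<bar>drho \<alpha> p k\<bar> \<le> K2"
    "\<And>\<nu> p p' k :: real \<Rightarrow> real^'n. (\<nu>, p, p', k) \<in> path_data c C \<Longrightarrow> \<bar>drho \<alpha> p' k - drho \<alpha> p k\<bar> \<le> K2 * \<nu>"
    by (rule drho_bounds[OF c, of \<alpha>]) (rule that; blast)
  define K where "K = K1 + K2"
  have K: "K \<ge> 0" using K1 K2 by (simp add: K_def)
  have fin: "K1 * x * (\<Gamma> + 2) + K2 * x \<le> K * (\<Gamma> + 3) * x" if "0 \<le> x" "0 \<le> \<Gamma>" for x \<Gamma>
  proof -
    have "K1 * x * (\<Gamma> + 2) + K2 * x * 1 \<le> K1 * x * (\<Gamma> + 3) + K2 * x * (\<Gamma> + 3)"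
      using that K1(1) K2(1) by (intro add_mono mult_left_mono) auto
    then show ?thesis by (simp add: K_def algebra_simps)
  qed
  have P: "(u, w) \<in> bx \<Longrightarrow> (\<nu>, seg g u w, seg g' u w, \<lambda>s. seg k u w s /\<^sub>R \<kappa>) \<in> path_data_mean c C"
    "(\<nu>, seg g u w, seg g' u w, \<lambda>s. seg k u w s /\<^sub>R \<kappa>) \<in> path_data c C"
    if cd: "curve_data \<alpha> c C \<Gamma> g g' k \<nu> \<kappa>" for \<Gamma> g g' \<nu> \<kappa> u w and k :: "real \<Rightarrow> real^'n"
    using seg_path_data[OF curve_dataD(1,2,3,4,6,7,8,5)[OF cd]] by (auto simp: bx_def)
  have B1: "\<bar>Phi \<alpha> (seg g u w)\<bar> \<le> K1 * cd_quad g g' k \<nu> \<kappa> (u, w)"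
    "\<bar>Psi \<alpha> (seg g u w) (seg k u w)\<bar> \<le> (K1 * \<kappa>) * cd_quad g g' k \<nu> \<kappa> (u, w)"
    "\<bar>Psi \<alpha> (seg g' u w) (seg k u w) - Psi \<alpha> (seg g u w) (seg k u w)\<bar> \<le> (K1 * (\<nu> * \<kappa>)) * cd_quad g g' k \<nu> \<kappa> (u, w)"
    if cd: "curve_data \<alpha> c C \<Gamma> g g' k \<nu> \<kappa>" and bx: "(u, w) \<in> bx" for \<Gamma> g g' \<nu> \<kappa> u w and k :: "real \<Rightarrow> real^'n"
  proof -
    note pd = P(1)[OF cd bx]
    have kap: "0 < \<kappa>" by (rule curve_dataD(5)[OF cd])
    show "\<bar>Phi \<alpha> (seg g u w)\<bar> \<le> K1 * cd_quad g g' k \<nu> \<kappa> (u, w)"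
      using K1(2)[OF pd] by (simp add: cd_quad_def)
    show "\<bar>Psi \<alpha> (seg g u w) (seg k u w)\<bar> \<le> (K1 * \<kappa>) * cd_quad g g' k \<nu> \<kappa> (u, w)"
      using K1(3)[OF pd] kap unfolding Psi_scaleR cd_quad_def fst_conv snd_conv by (simp add: abs_mult field_simps)
    show "\<bar>Psi \<alpha> (seg g' u w) (seg k u w) - Psi \<alpha> (seg g u w) (seg k u w)\<bar> \<le> (K1 * (\<nu> * \<kappa>)) * cd_quad g g' k \<nu> \<kappa> (u, w)"
      using K1(4)[OF pd] kap unfolding Psi_scaleR cd_quad_def fst_conv snd_conv right_diff_distrib[symmetric]
      by (simp add: abs_mult field_simps)
  qed
  have B2: "\<bar>drho \<alpha> (seg g u w) (seg k u w)\<bar> \<le> K2 * \<kappa>"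
    "\<bar>drho \<alpha> (seg g' u w) (seg k u w) - drho \<alpha> (seg g u w) (seg k u w)\<bar> \<le> K2 * (\<nu> * \<kappa>)"
    if cd: "curve_data \<alpha> c C \<Gamma> g g' k \<nu> \<kappa>" for \<Gamma> g g' \<nu> \<kappa> u w and k :: "real \<Rightarrow> real^'n"
  proof -
    note pd = P(2)[OF cd, of u w]
    have kap: "0 < \<kappa>" by (rule curve_dataD(5)[OF cd])
    show "\<bar>drho \<alpha> (seg g u w) (seg k u w)\<bar> \<le> K2 * \<kappa>"
      using K2(2)[OF pd] kap unfolding drho_scaleR by (simp add: abs_mult field_simps)
    show "\<bar>drho \<alpha> (seg g' u w) (seg k u w) - drho \<alpha> (seg g u w) (seg k u w)\<bar> \<le> K2 * (\<nu> * \<kappa>)"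
      using K2(3)[OF pd] kap unfolding drho_scaleR right_diff_distrib[symmetric] by (simp add: abs_mult field_simps)
  qed
  have W: "wintegrable \<alpha> H \<and> \<bar>wint \<alpha> H\<bar> \<le> L * (\<Gamma> + 2)"
    if "curve_data \<alpha> c C \<Gamma> g g' k \<nu> \<kappa>" "0 \<le> L" "continuous_on bx (\<lambda>x. H (fst x) (snd x))"
      "\<And>u w. (u, w) \<in> bx \<Longrightarrow> \<bar>H u w\<bar> \<le> L * cd_quad g g' k \<nu> \<kappa> (u, w)" for \<Gamma> g g' \<nu> \<kappa> L H and k :: "real \<Rightarrow> real^'n"
    using wintegrable_bound[OF that(3,4) nn_cd_quad[OF that(1) a1 that(2)]] that(2) curve_dataD(9)[OF that(1)] by simp
  show ?thesis
  proof (rule that[OF K])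
    fix \<Gamma> g g' \<nu> \<kappa> and k :: "real \<Rightarrow> real^'n" assume cd: "curve_data \<alpha> c C \<Gamma> g g' k \<nu> \<kappa>"
    note D = curve_dataD[OF cd]
    show "wintegrable \<alpha> (\<lambda>u w. Phi \<alpha> (seg g u w))"
      using W[OF cd K1(1) Phi_seg_continuous[OF c(1) D(1)] B1(1)[OF cd]] by simp
    have k1: "0 \<le> K1 * \<kappa>" "0 \<le> K1 * (\<nu> * \<kappa>)" using K1(1) D by simp_all
    note W1 = W[OF cd k1(1) Psi_seg_continuous[OF c(1) D(1) D(3)] B1(2)[OF cd]]
    show I: "wintegrable \<alpha> (\<lambda>u w. Psi \<alpha> (seg g u w) (seg k u w))" using W1 by simp
    have r1: "\<bar>set_lebesgue_integral lborel {0..1} (\<lambda>u. drho \<alpha> (seg g u 1) (seg k u 1))\<bar> \<le> K2 * \<kappa>"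
      by (intro set_integral_unit_bound drho_seg_continuous[OF c(1) D(1) D(3)] B2(1)[OF cd])
    have "\<bar>DEg \<alpha> g k\<bar> \<le> K1 * \<kappa> * (\<Gamma> + 2) + K2 * \<kappa>"
      using W1 r1 unfolding DEg_def by linarith
    then show "\<bar>DEg \<alpha> g k\<bar> \<le> K * (\<Gamma> + 3) * \<kappa>" using fin[of \<kappa> \<Gamma>] D by simp
    note W2 = W[OF cd k1(2) continuous_on_diff[OF Psi_seg_continuous[OF c(1) D(2) D(3)] Psi_seg_continuous[OF c(1) D(1) D(3)]] B1(3)[OF cd]]
    \<comment> \<open>\<open>curve_data\<close> bounds the seminorms of \<open>g\<close> and of
      \<open>g' - g\<close>; integrability at \<open>g'\<close> is recovered by adding the
      integrable difference.\<close>
    have "wintegrable \<alpha> (\<lambda>u w. (Psi \<alpha> (seg g' u w) (seg k u w) - Psi \<alpha> (seg g u w) (seg k u w)) + Psi \<alpha> (seg g u w) (seg k u w))"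
      using set_integral_add(1)[OF conjunct1[OF W2, unfolded wintegrable_def] I[unfolded wintegrable_def]]
      unfolding wintegrable_def by (simp add: algebra_simps)
    then have I': "wintegrable \<alpha> (\<lambda>u w. Psi \<alpha> (seg g' u w) (seg k u w))" by simp
    have dc: "continuous_on {0..1} (\<lambda>u. drho \<alpha> (seg g' u 1) (seg k u 1))" "continuous_on {0..1} (\<lambda>u. drho \<alpha> (seg g u 1) (seg k u 1))"
      by (rule drho_seg_continuous[OF c(1) D(2) D(3)] drho_seg_continuous[OF c(1) D(1) D(3)])+
    have r2: "\<bar>set_lebesgue_integral lborel {0..1} (\<lambda>u. drho \<alpha> (seg g' u 1) (seg k u 1) - drho \<alpha> (seg g u 1) (seg k u 1))\<bar> \<le> K2 * (\<nu> * \<kappa>)"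
      by (intro set_integral_unit_bound continuous_on_diff dc B2(2)[OF cd])
    have "DEg \<alpha> g' k - DEg \<alpha> g k = wint \<alpha> (\<lambda>u w. Psi \<alpha> (seg g' u w) (seg k u w) - Psi \<alpha> (seg g u w) (seg k u w))
       - set_lebesgue_integral lborel {0..1} (\<lambda>u. drho \<alpha> (seg g' u 1) (seg k u 1) - drho \<alpha> (seg g u 1) (seg k u 1))"
      unfolding DEg_def wint_diff[OF I' I] set_integral_diff(2)[OF dc[THEN borel_integrable_atLeastAtMost']] by simp
    then have "\<bar>DEg \<alpha> g' k - DEg \<alpha> g k\<bar> \<le> K1 * (\<nu> * \<kappa>) * (\<Gamma> + 2) + K2 * (\<nu> * \<kappa>)"
      using W2 r2 by linarith
    then show "\<bar>DEg \<alpha> g' k - DEg \<alpha> g k\<bar> \<le> K * (\<Gamma> + 3) * (\<nu> * \<kappa>)" using fin[of "\<nu> * \<kappa>" \<Gamma>] D by simp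
  next
    fix \<Gamma> g \<kappa> and k :: "real \<Rightarrow> real^'n"
    assume cd: "curve_data \<alpha> c C \<Gamma> g (\<lambda>u. g u + k u) k \<kappa> \<kappa>" and nt: "\<And>t. t \<in> {0..1} \<Longrightarrow> nice c C (\<lambda>u. g u + t *\<^sub>R k u)"
      and I1: "wintegrable \<alpha> (\<lambda>u w. Phi \<alpha> (seg (\<lambda>u. g u + k u) u w))"
    note D = curve_dataD[OF cd]
    let ?gt = "\<lambda>t u. g u + t *\<^sub>R k u"
    have pdt: "(\<kappa>, seg g u w, seg (?gt t) u w, \<lambda>s. seg k u w s /\<^sub>R \<kappa>) \<in> path_data c C"
      "w \<in> {-1/2..1/2} \<Longrightarrow> (\<kappa>, seg g u w, seg (?gt t) u w, \<lambda>s. seg k u w s /\<^sub>R \<kappa>) \<in> path_data_mean c C" if "t \<in> {0..1}" for t u w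
    proof -
      have "norm (?gt t u - g u) \<le> \<kappa>" for u
      proof -
        have "t * norm (k u) \<le> 1 * \<kappa>" using that D(4)[of u] by (intro mult_mono) auto
        then show ?thesis using that by simp
      qed
      then show "(\<kappa>, seg g u w, seg (?gt t) u w, \<lambda>s. seg k u w s /\<^sub>R \<kappa>) \<in> path_data c C"
        "w \<in> {-1/2..1/2} \<Longrightarrow> (\<kappa>, seg g u w, seg (?gt t) u w, \<lambda>s. seg k u w s /\<^sub>R \<kappa>) \<in> path_data_mean c C"
        using seg_path_data[OF D(1) nt[OF that] D(3,4,6,7) _ D(5)] by auto
    qed
    have sc: "continuous_on {0..1} (seg g u w)" "continuous_on {0..1} (seg k u w)" for u w
      by (intro seg_continuous niceD(1)[OF D(1)] D(3))+
    have kap: "0 < \<kappa>" by (rule D)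
    have gt0: "?gt 0 = g" by simp
    have gt1: "?gt 1 = (\<lambda>u. g u + k u)" by simp
    have pw: "\<bar>Phi \<alpha> (seg (\<lambda>u. g u + k u) u w) - Phi \<alpha> (seg g u w) - Psi \<alpha> (seg g u w) (seg k u w)\<bar>
       \<le> (K1 * (\<kappa> * \<kappa>)) * cd_quad g (\<lambda>u. g u + k u) k \<kappa> \<kappa> (u, w)" if bx: "(u, w) \<in> bx" for u w
    proof -
      have w: "w \<in> {-1/2..1/2}" using bx by (simp add: bx_def)
      have "\<bar>Phi \<alpha> (seg (?gt 1) u w) - Phi \<alpha> (seg (?gt 0) u w) - Psi \<alpha> (seg (?gt 0) u w) (seg k u w)\<bar>
          \<le> (K1 * (\<kappa> * \<kappa>)) * cd_quad g (\<lambda>u. g u + k u) k \<kappa> \<kappa> (u, w)"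
      proof (rule MVT_linear_error)
        fix t :: real assume t: "t \<in> {0..1}"
        have pm: "pmean (seg (?gt t) u w) \<noteq> 0" and pl: "0 < plen (seg (?gt t) u w)"
          using niceD(7)[OF nt[OF t] w, of u] nice_plen_ge[OF c(1) nt[OF t], of u w] c(1) by auto
        have nzs: "seg g u w s + t *\<^sub>R seg k u w s \<noteq> 0" if "t \<in> {0..1}" for t s
          using nice_nz[OF c(1) nt[OF that]] by (simp add: seg_def)
        show "((\<lambda>t. Phi \<alpha> (seg (?gt t) u w)) has_real_derivative Psi \<alpha> (seg (?gt t) u w) (seg k u w)) (at t within {0..1})"
          by (rule Phi_line_derivative[OF sc nzs t, unfolded seg_line, OF _ pm pl])
        let ?q = "Qinc (seg g u w) + Qinc (\<lambda>s. (seg (?gt t) u w s - seg g u w s) /\<^sub>R \<kappa>) + Qinc (\<lambda>s. seg k u w s /\<^sub>R \<kappa>)"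
        \<comment> \<open>Along the segment of curves the rescaled difference is \<open>t\<close>
          times the rescaled direction, so its increments are largest at \<open>t = 1\<close>. One
          dominating function thus serves all intermediate \<open>t\<close>.\<close>
        have "(\<lambda>s. (seg (?gt t) u w s - seg g u w s) /\<^sub>R \<kappa>) = (\<lambda>s. t *\<^sub>R (seg k u w s /\<^sub>R \<kappa>))"
          by (simp add: seg_def mult.commute)
        then have "Qinc (\<lambda>s. (seg (?gt t) u w s - seg g u w s) /\<^sub>R \<kappa>) = t\<^sup>2 * Qinc (\<lambda>s. seg k u w s /\<^sub>R \<kappa>)"
          by (simp only: Qinc_scaleR)
        also have "\<dots> \<le> 1 * Qinc (\<lambda>s. seg k u w s /\<^sub>R \<kappa>)"
          using t by (intro mult_right_mono Qinc_nonneg continuous_intros sc) (auto simp: power_le_one)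
        also have "\<dots> = Qinc (\<lambda>s. (seg (\<lambda>u. g u + k u) u w s - seg g u w s) /\<^sub>R \<kappa>)" by (simp add: seg_def)
        finally have q: "?q \<le> cd_quad g (\<lambda>u. g u + k u) k \<kappa> \<kappa> (u, w)" unfolding cd_quad_def by simp
        have "\<bar>Psi \<alpha> (seg (?gt t) u w) (seg k u w) - Psi \<alpha> (seg g u w) (seg k u w)\<bar> \<le> K1 * (\<kappa> * \<kappa>) * ?q"
          using K1(4)[OF pdt(2)[OF t w, of u]] kap unfolding Psi_scaleR right_diff_distrib[symmetric]
          by (simp add: abs_mult field_simps)
        also have "\<dots> \<le> K1 * (\<kappa> * \<kappa>) * cd_quad g (\<lambda>u. g u + k u) k \<kappa> \<kappa> (u, w)"
          using q K1(1) kap by (intro mult_left_mono) auto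
        finally show "\<bar>Psi \<alpha> (seg (?gt t) u w) (seg k u w) - Psi \<alpha> (seg (?gt 0) u w) (seg k u w)\<bar> \<le> K1 * (\<kappa> * \<kappa>) * cd_quad g (\<lambda>u. g u + k u) k \<kappa> \<kappa> (u, w)"
          unfolding gt0 .
      qed
      then show ?thesis unfolding gt0 gt1 .
    qed
    have pr: "\<bar>rho \<alpha> (seg (\<lambda>u. g u + k u) u 1) - rho \<alpha> (seg g u 1) - drho \<alpha> (seg g u 1) (seg k u 1)\<bar> \<le> K2 * (\<kappa> * \<kappa>)" for u
    proof -
      have "\<bar>rho \<alpha> (seg (?gt 1) u 1) - rho \<alpha> (seg (?gt 0) u 1) - drho \<alpha> (seg (?gt 0) u 1) (seg k u 1)\<bar> \<le> K2 * (\<kappa> * \<kappa>)"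
      proof (rule MVT_linear_error)
        fix t :: real assume t: "t \<in> {0..1}"
        show "((\<lambda>t. rho \<alpha> (seg (?gt t) u 1)) has_real_derivative drho \<alpha> (seg (?gt t) u 1) (seg k u 1)) (at t within {0..1})"
          using rho_line_derivative[OF sc(1) sc(2) c(1) _ t a1, of u 1 u 1] niceD(5)[OF nt]
          unfolding seg_line by (auto simp: seg_def simp flip: seg_line)
        show "\<bar>drho \<alpha> (seg (?gt t) u 1) (seg k u 1) - drho \<alpha> (seg (?gt 0) u 1) (seg k u 1)\<bar> \<le> K2 * (\<kappa> * \<kappa>)"
          using K2(3)[OF pdt(1)[OF t, of u 1]] kap unfolding drho_scaleR right_diff_distrib[symmetric] gt0
          by (simp add: abs_mult field_simps)
      qed
      then show ?thesis unfolding gt0 gt1 .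
    qed
    have n1: "nice c C (\<lambda>u. g u + k u)" by (rule D(2))
    have k1: "0 \<le> K1 * (\<kappa> * \<kappa>)" using K1(1) kap by simp
    have I0: "wintegrable \<alpha> (\<lambda>u w. Phi \<alpha> (seg g u w))"
      using W[OF cd K1(1) Phi_seg_continuous[OF c(1) D(1)] B1(1)[OF cd]] by simp
    have k2: "0 \<le> K1 * \<kappa>" using K1(1) D by simp
    have IP: "wintegrable \<alpha> (\<lambda>u w. Psi \<alpha> (seg g u w) (seg k u w))"
      using W[OF cd k2 Psi_seg_continuous[OF c(1) D(1) D(3)] B1(2)[OF cd]] by simp
    have I2: "wintegrable \<alpha> (\<lambda>u w. Phi \<alpha> (seg (\<lambda>u. g u + k u) u w) - Phi \<alpha> (seg g u w))"
      using set_integral_diff(1)[OF I1[unfolded wintegrable_def] I0[unfolded wintegrable_def]]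
      unfolding wintegrable_def by (simp add: algebra_simps)
    note W3 = W[OF cd k1 continuous_on_diff[OF continuous_on_diff[OF Phi_seg_continuous[OF c(1) n1] Phi_seg_continuous[OF c(1) D(1)]] Psi_seg_continuous[OF c(1) D(1) D(3)]] pw]
    have rc: "continuous_on {0..1} (\<lambda>u. rho \<alpha> (seg (\<lambda>u. g u + k u) u 1))" "continuous_on {0..1} (\<lambda>u. rho \<alpha> (seg g u 1))"
       "continuous_on {0..1} (\<lambda>u. drho \<alpha> (seg g u 1) (seg k u 1))"
      by (rule rho_seg_continuous[OF c(1) n1] rho_seg_continuous[OF c(1) D(1)] drho_seg_continuous[OF c(1) D(1) D(3)])+
    note ri = rc[THEN borel_integrable_atLeastAtMost']
    have r3: "\<bar>set_lebesgue_integral lborel {0..1} (\<lambda>u. rho \<alpha> (seg (\<lambda>u. g u + k u) u 1) - rho \<alpha> (seg g u 1) - drho \<alpha> (seg g u 1) (seg k u 1))\<bar> \<le> K2 * (\<kappa> * \<kappa>)"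
      by (intro set_integral_unit_bound continuous_on_diff rc pr)
    have "Eg \<alpha> (\<lambda>u. g u + k u) - Eg \<alpha> g - DEg \<alpha> g k =
       wint \<alpha> (\<lambda>u w. Phi \<alpha> (seg (\<lambda>u. g u + k u) u w) - Phi \<alpha> (seg g u w) - Psi \<alpha> (seg g u w) (seg k u w))
       - set_lebesgue_integral lborel {0..1} (\<lambda>u. rho \<alpha> (seg (\<lambda>u. g u + k u) u 1) - rho \<alpha> (seg g u 1) - drho \<alpha> (seg g u 1) (seg k u 1))"
      unfolding DEg_def Eg_def wint_diff[OF I2 IP] wint_diff[OF I1 I0]
        set_integral_diff(2)[OF set_integral_diff(1)[OF ri(1,2)] ri(3)] set_integral_diff(2)[OF ri(1,2)] by simp
    then have "\<bar>Eg \<alpha> (\<lambda>u. g u + k u) - Eg \<alpha> g - DEg \<alpha> g k\<bar> \<le> K1 * (\<kappa> * \<kappa>) * (\<Gamma> + 2) + K2 * (\<kappa> * \<kappa>)"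
      using W3 r3 by linarith
    then show "\<bar>Eg \<alpha> (\<lambda>u. g u + k u) - Eg \<alpha> g - DEg \<alpha> g k\<bar> \<le> K * (\<Gamma> + 3) * (\<kappa> * \<kappa>)"
      using fin[of "\<kappa> * \<kappa>" \<Gamma>] D by simp
  qed
qed

section \<open>The energy as an integral of path functionals\<close>

lemma integral_segment:
  fixes \<phi> :: "real \<Rightarrow> real"
  assumes "continuous_on UNIV \<phi>"
  shows "integral {min u (u + w)..max u (u + w)} \<phi> = \<bar>w\<bar> * integral {0..1} (\<lambda>s. \<phi> (u + s * w))"
proof -
  let ?c = "min u (u + w)" and ?d = "max u (u + w)"
  have im: "(\<lambda>s. u + s * w) ` {0..1} \<subseteq> {?c..?d}"
  proof
    fix y assume "y \<in> (\<lambda>s. u + s * w) ` {0..1}"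
    then obtain s where s: "0 \<le> s" "s \<le> 1" "y = u + s * w" by auto
    show "y \<in> {?c..?d}"
    proof (cases "0 \<le> w")
      case True
      then have "0 \<le> s * w" "s * w \<le> 1 * w" using s mult_right_mono[of s 1 w] by simp_all
      then show ?thesis using s True by auto
    next
      case False
      then have "s * w \<le> 0" "1 * w \<le> s * w" using s mult_right_mono_neg[of s 1 w] by (simp_all add: mult_nonneg_nonpos)
      then show ?thesis using s False by auto
    qed
  qed
  \<comment> \<open>The substitution rule produces both orientations; the integral over the reversed
    interval is zero, which covers both signs of \<open>w\<close>.\<close>
  have "((\<lambda>s. w *\<^sub>R \<phi> (u + s * w)) has_integral (integral {u + 0 * w..u + 1 * w} \<phi> - integral {u + 1 * w..u + 0 * w} \<phi>)) {0..1}"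
    by (rule has_integral_substitution_general[of "{}" _ _ _ ?c ?d])
       (use im in \<open>auto intro!: continuous_intros continuous_on_subset[OF assms] derivative_eq_intros\<close>)
  then have "integral {u..u + w} \<phi> - integral {u + w..u} \<phi> = w * integral {0..1} (\<lambda>s. \<phi> (u + s * w))"
    by (auto dest: integral_unique)
  moreover have "integral {u + w..u} \<phi> = 0" if "0 \<le> w" using that by (cases "w = 0") auto
  moreover have "integral {u..u + w} \<phi> = 0" if "\<not> 0 \<le> w" using that by auto
  ultimately show ?thesis by (cases "0 \<le> w") auto
qed

lemma integral_period:
  fixes \<phi> :: "real \<Rightarrow> real"
  assumes c: "continuous_on UNIV \<phi>" and p: "periodic1 \<phi>" and nn: "\<And>x. 0 \<le> \<phi> x"
  shows "integral {a..a + 1} \<phi> = integral {0..1} \<phi>"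
proof -
  have i: "\<phi> integrable_on {x..y}" for x y
    by (intro integrable_continuous_real continuous_on_subset[OF c]) auto
  have e: "(\<integral>\<^sup>+x\<in>{x..y}. ennreal (\<phi> x) \<partial>lborel) = ennreal (integral {x..y} \<phi>)" for x y
    using nn by (intro nn_integral_has_integral_lebesgue' integrable_integral i) auto
  have "(\<integral>\<^sup>+x\<in>{a..a+1}. ennreal (\<phi> x) \<partial>lborel) = (\<integral>\<^sup>+x\<in>{0..1}. ennreal (\<phi> x) \<partial>lborel)"
    using borel_measurable_continuous_onI[OF c] p by (intro nn_integral_periodic) (auto simp: periodic1_def)
  then have "ennreal (integral {a..a+1} \<phi>) = ennreal (integral {0..1} \<phi>)" unfolding e .
  then show ?thesis using nn by (subst (asm) ennreal_inj) (auto intro!: integral_nonneg i)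
qed

text \<open>For \<open>L / 2 \<le> B < L\<close> this is the integral of
  \<open>(L - a) powr (-\<alpha>) - a powr (-\<alpha>)\<close> over \<open>a\<close> from
  \<open>L / 2\<close> to \<open>B\<close>; the constant term makes it vanish at
  \<open>L / 2\<close>.\<close>

definition arc_defect :: "real \<Rightarrow> real \<Rightarrow> real \<Rightarrow> real" where
  "arc_defect \<alpha> L B = ((L - B) powr (1 - \<alpha>) + B powr (1 - \<alpha>) - 2 * (L / 2) powr (1 - \<alpha>)) / (\<alpha> - 1)"

text \<open>The substitution \<open>a = A w\<close>, written out through an explicit antiderivative.
  The integrand vanishes as long as \<open>A w \<le> L / 2\<close>.\<close>

lemma arc_defect_integral:
  fixes \<phi> :: "real \<Rightarrow> real"
  assumes c: "continuous_on UNIV \<phi>" and pos: "\<And>x. 0 < \<phi> x" and \<alpha>: "1 < \<alpha>"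
    and A: "\<And>w. A w = integral {0..w} \<phi>" and L: "A (1/2) < L"
  shows "((\<lambda>w. (min (A w) (L - A w) powr (-\<alpha>) - A w powr (-\<alpha>)) * \<phi> w) has_integral arc_defect \<alpha> L (max (A (1/2)) (L / 2))) {0..1/2}"
proof -
  have i: "\<phi> integrable_on {x..y}" for x y
    by (intro integrable_continuous_real continuous_on_subset[OF c]) auto
  have dA: "(A has_real_derivative \<phi> w) (at w)" if "w \<in> {0<..<1/2}" for w
  proof -
    have "(A has_real_derivative \<phi> w) (at w within {0..1/2})"
      unfolding A[abs_def] using integral_has_real_derivative[of 0 "1/2" \<phi> w] that continuous_on_subset[OF c] by auto
    then show ?thesis using that by (simp add: at_within_Icc_at)
  qed
  have cA: "continuous_on {0..1/2} A"
    unfolding A[abs_def] by (rule indefinite_integral_continuous_1[OF i])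
  have sm: "A x < A y" if "0 \<le> x" "x < y" "y \<le> 1/2" for x y
  proof -
    have "integral {0..x} \<phi> + integral {x..y} \<phi> = integral {0..y} \<phi>"
      using that by (intro Henstock_Kurzweil_Integration.integral_combine i) auto
    moreover have "0 < integral {x..y} \<phi>"
    proof -
      have "\<exists>m\<in>{x..y}. \<forall>t\<in>{x..y}. \<phi> m \<le> \<phi> t"
        by (rule continuous_attains_inf) (use continuous_on_subset[OF c] that in auto)
      then obtain m where m: "m \<in> {x..y}" "\<forall>t\<in>{x..y}. \<phi> m \<le> \<phi> t" by blast
      have "integral {x..y} (\<lambda>_. \<phi> m) \<le> integral {x..y} \<phi>" using m by (intro integral_le i) auto
      moreover have "0 < integral {x..y} (\<lambda>_. \<phi> m)" using pos[of m] that by simp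
      ultimately show ?thesis by linarith
    qed
    ultimately show ?thesis by (simp add: A)
  qed
  have A0: "A 0 = 0" by (simp add: A)
  have Ab: "0 \<le> A w" "A w \<le> A (1/2)" if "w \<in> {0..1/2}" for w
  proof -
    show "0 \<le> A w" unfolding A by (intro integral_nonneg i less_imp_le[OF pos])
    show "A w \<le> A (1/2)"
    proof (cases "w = 1/2")
      case False
      then have "A w < A (1/2)" using that by (intro sm) auto
      then show ?thesis by simp
    next
      case True
      show ?thesis unfolding True ..
    qed
  qed
  have Lp: "0 < L" using Ab[of "1/2"] L by simp
  \<comment> \<open>The maximum freezes the antiderivative at zero until the arc reaches half of the
    total length.\<close>
  let ?h = "\<lambda>w. arc_defect \<alpha> L (max (A w) (L / 2))"
  have "((\<lambda>w. (min (A w) (L - A w) powr (-\<alpha>) - A w powr (-\<alpha>)) * \<phi> w) has_integral (?h (1/2) - ?h 0)) {0..1/2}"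
  \<comment> \<open>Differentiability can fail only at the kink, which is at most one point since
    \<open>A\<close> is strictly increasing.\<close>
  proof (rule fundamental_theorem_of_calculus_interior_strong[where S="{w \<in> {0..1/2}. A w = L / 2}"])
    have "x = y" if "x \<in> {0..1/2}" "y \<in> {0..1/2}" "A x = A y" for x y
      using sm[of x y] sm[of y x] that by (cases x y rule: linorder_cases) auto
    then have "inj_on A {0..1/2}" by (auto simp: inj_on_def)
    then have "finite (A -` {L/2} \<inter> {0..1/2})" by (intro finite_vimage_IntI) auto
    moreover have "A -` {L/2} \<inter> {0..1/2} = {w \<in> {0..1/2}. A w = L / 2}" by auto
    ultimately show "finite {w \<in> {0..1/2}. A w = L / 2}" by simp
    show "continuous_on {0..1/2} ?h"
      unfolding arc_defect_def
    proof (intro continuous_intros cA ballI)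
      fix w :: real assume "w \<in> {0..1/2}"
      then have "max (A w) (L/2) < L" "0 < max (A w) (L/2)" using Ab[of w] L Lp by auto
      then show "L - max (A w) (L / 2) \<noteq> 0" "max (A w) (L / 2) \<noteq> 0" by auto
      show "\<alpha> - 1 \<noteq> 0" using \<alpha> by simp
    qed
    fix w :: real assume w: "w \<in> {0<..<1/2} - {w \<in> {0..1/2}. A w = L / 2}"
    then have w': "w \<in> {0<..<1/2}" and ne: "A w \<noteq> L / 2" by auto
    have Apos: "0 < A w" using sm[of 0 w] w' A0 by auto
    have AL: "A w < L" using Ab(2)[of w] L w' by auto
    have cont: "isCont A w" using dA[OF w'] by (rule DERIV_isCont)
    consider "A w < L / 2" | "A w > L / 2" using ne by linarith
    then have "(?h has_real_derivative (min (A w) (L - A w) powr (-\<alpha>) - A w powr (-\<alpha>)) * \<phi> w) (at w)"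
    proof cases
      case 1
      have "eventually (\<lambda>y. A y < L / 2) (at w)"
        using cont 1 unfolding isCont_def by (rule order_tendstoD(2))
      then have ev: "eventually (\<lambda>y. A y < L / 2) (nhds w)" using 1 by (simp add: eventually_nhds_conv_at)
      have "((\<lambda>y. arc_defect \<alpha> L (L / 2)) has_real_derivative 0) (at w)" by simp
      then have "(?h has_real_derivative 0) (at w)"
        by (rule DERIV_cong_ev[THEN iffD1, rotated -1]) (use ev in \<open>auto elim: eventually_mono simp: max_def\<close>)
      moreover have "min (A w) (L - A w) = A w" using 1 by simp
      ultimately show ?thesis by simp
    next
      case 2
      have "eventually (\<lambda>y. L / 2 < A y) (at w)"
        using cont 2 unfolding isCont_def by (rule order_tendstoD(1))
      then have ev: "eventually (\<lambda>y. L / 2 < A y) (nhds w)" using 2 by (simp add: eventually_nhds_conv_at)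
      have dP: "((\<lambda>y. X y powr (1 - \<alpha>)) has_real_derivative (1 - \<alpha>) * X w powr (-\<alpha>) * X') (at w)"
        if "(X has_real_derivative X') (at w)" "X w > 0" for X X'
        using DERIV_chain2[OF has_real_derivative_powr[OF that(2), of "1 - \<alpha>"] that(1)] by simp
      have p1: "((\<lambda>y. A y powr (1 - \<alpha>)) has_real_derivative (1 - \<alpha>) * A w powr (-\<alpha>) * \<phi> w) (at w)"
        by (rule dP[OF dA[OF w'] Apos])
      have "((\<lambda>y. L - A y) has_real_derivative - \<phi> w) (at w)" using dA[OF w'] by (auto intro!: derivative_eq_intros)
      then have p2: "((\<lambda>y. (L - A y) powr (1 - \<alpha>)) has_real_derivative (1 - \<alpha>) * (L - A w) powr (-\<alpha>) * - \<phi> w) (at w)"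
        using AL by (intro dP) auto
      have "((\<lambda>y. arc_defect \<alpha> L (A y)) has_real_derivative
          ((1 - \<alpha>) * (L - A w) powr (-\<alpha>) * - \<phi> w + (1 - \<alpha>) * A w powr (-\<alpha>) * \<phi> w - 0) / (\<alpha> - 1)) (at w)"
        unfolding arc_defect_def by (intro DERIV_cdivide DERIV_diff DERIV_add p1 p2 DERIV_const)
      moreover have "((1 - \<alpha>) * (L - A w) powr (-\<alpha>) * - \<phi> w + (1 - \<alpha>) * A w powr (-\<alpha>) * \<phi> w - 0) / (\<alpha> - 1)
         = ((L - A w) powr (-\<alpha>) - A w powr (-\<alpha>)) * \<phi> w"
        using \<alpha> by (simp add: field_simps)
      ultimately have d: "((\<lambda>y. arc_defect \<alpha> L (A y)) has_real_derivative ((L - A w) powr (-\<alpha>) - A w powr (-\<alpha>)) * \<phi> w) (at w)" by simp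
      then have "(?h has_real_derivative ((L - A w) powr (-\<alpha>) - A w powr (-\<alpha>)) * \<phi> w) (at w)"
        by (rule DERIV_cong_ev[THEN iffD1, rotated -1]) (use ev in \<open>auto elim: eventually_mono simp: max_def\<close>)
      moreover have "min (A w) (L - A w) = L - A w" using 2 by simp
      ultimately show ?thesis by simp
    qed
    then show "(?h has_vector_derivative (min (A w) (L - A w) powr (-\<alpha>) - A w powr (-\<alpha>)) * \<phi> w) (at w)"
      by (simp add: has_real_derivative_iff_has_vector_derivative)
  qed simp
  moreover have "?h 0 = 0" using Lp by (simp add: A0 arc_defect_def)
  ultimately show ?thesis by simp
qed

text \<open>At most one of two complementary arcs exceeds half the total, and
  \<open>arc_defect\<close> is symmetric in \<open>B\<close> and \<open>L - B\<close>. Whichever arc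
  is the longer one, the sum is the same expression, smooth in both lengths: here the kink
  cancels.\<close>

lemma arc_defect_sum:
  assumes "0 < a" "0 < b" "a + b = L"
  shows "arc_defect \<alpha> L (max a (L / 2)) + arc_defect \<alpha> L (max b (L / 2)) = (a powr (1 - \<alpha>) + b powr (1 - \<alpha>) - 2 * (L / 2) powr (1 - \<alpha>)) / (\<alpha> - 1)"
proof -
  have h: "arc_defect \<alpha> L (L / 2) = 0" by (simp add: arc_defect_def)
  have ab: "L - a = b" "L - b = a" using assms by auto
  show ?thesis
  proof (cases "a \<ge> L / 2")
    case True
    then have "max a (L / 2) = a" "max b (L / 2) = L / 2" using assms by (auto simp: max_def)
    then show ?thesis using h by (simp add: arc_defect_def ab add.commute)
  next
    case False
    then have "max b (L / 2) = b" "max a (L / 2) = L / 2" using assms by (auto simp: max_def)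
    then show ?thesis using h by (simp add: arc_defect_def ab)
  qed
qed

section \<open>Separating the intrinsic distance from the arc length\<close>

lemma nn_integral_reflect:
  fixes F :: "real \<Rightarrow> ennreal"
  assumes [measurable]: "F \<in> borel_measurable borel"
  shows "(\<integral>\<^sup>+w\<in>{-b..0}. F w \<partial>lborel) = (\<integral>\<^sup>+w\<in>{0..b}. F (- w) \<partial>lborel)"
proof -
  have "(\<integral>\<^sup>+w\<in>{-b..0}. F w \<partial>lborel) = (\<integral>\<^sup>+w. F (0 + (-1) * w) * indicator {-b..0} (0 + (-1) * w) \<partial>lborel)"
    using nn_integral_real_affine[of "\<lambda>w. F w * indicator {-b..0} w" "-1" 0] by simp
  also have "\<dots> = (\<integral>\<^sup>+w\<in>{0..b}. F (- w) \<partial>lborel)"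
    by (intro nn_integral_cong) (auto simp: indicator_def)
  finally show ?thesis .
qed

lemma nn_integral_split_0:
  fixes F :: "real \<Rightarrow> ennreal"
  assumes [measurable]: "F \<in> borel_measurable borel" and b: "0 \<le> b"
  shows "(\<integral>\<^sup>+w\<in>{-b..b}. F w \<partial>lborel) = (\<integral>\<^sup>+w\<in>{-b..0}. F w \<partial>lborel) + (\<integral>\<^sup>+w\<in>{0..b}. F w \<partial>lborel)"
proof -
  have "(\<integral>\<^sup>+w\<in>{-b..b}. F w \<partial>lborel) = (\<integral>\<^sup>+w. F w * indicator {-b..<0} w + F w * indicator {0..b} w \<partial>lborel)"
    using b by (intro nn_integral_cong) (auto simp: indicator_def)
  also have "\<dots> = (\<integral>\<^sup>+w\<in>{-b..<0}. F w \<partial>lborel) + (\<integral>\<^sup>+w\<in>{0..b}. F w \<partial>lborel)"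
    by (intro nn_integral_add) auto
  finally show ?thesis by (simp add: nn_integral_Ico_Icc)
qed

context
  fixes \<gamma> :: "real \<Rightarrow> real^'n" and g :: "real \<Rightarrow> real^'n" and c C \<alpha> :: real
  assumes c: "0 < c" and g: "nice c C g" and \<gamma>: "\<And>x. (\<gamma> has_vector_derivative g x) (at x)" "periodic1 \<gamma>"
    and \<alpha>: "1 < \<alpha>"
begin

private abbreviation (input) "speed \<equiv> (\<lambda>x. norm (g x))"
private abbreviation (input) "Arc \<equiv> (\<lambda>u w. \<bar>w\<bar> * plen (seg g u w))"
private abbreviation (input) "full_length \<equiv> integral {0..1} speed"

lemma vd_eq: "vector_derivative \<gamma> (at x) = g x"
  by (rule vector_derivative_at[OF \<gamma>(1)])

lemma speed_cont: "continuous_on S speed"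
  using niceD(1)[OF g] by (intro continuous_intros) (auto intro: continuous_on_subset)

lemma speed_pos: "0 < speed x"
  using nice_nz[OF c g, of x] by simp

lemma speed_int: "speed integrable_on {x..y}"
  by (intro integrable_continuous_real speed_cont)

lemma arc_eq: "arc_length \<gamma> u w = Arc u w" "integral {min u (u + w)..max u (u + w)} speed = Arc u w"
proof -
  show "integral {min u (u + w)..max u (u + w)} speed = Arc u w"
    using integral_segment[OF speed_cont, of u w] by (simp add: plen_def seg_def)
  then show "arc_length \<gamma> u w = Arc u w" by (simp add: arc_length_def vd_eq)
qed

lemma length_eq: "curve_length \<gamma> = full_length" "integral {x..x + 1} speed = full_length"
proof -
  show "curve_length \<gamma> = full_length" by (simp add: curve_length_def vd_eq)
  have "periodic1 speed" using niceD(2)[OF g] by (simp add: periodic1_def)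
  then show "integral {x..x + 1} speed = full_length" by (intro integral_period speed_cont) auto
qed

lemma chord_le_integral: "x \<le> y \<Longrightarrow> norm (\<gamma> y - \<gamma> x) \<le> integral {x..y} speed"
proof -
  assume xy: "x \<le> y"
  have "(g has_integral (\<gamma> y - \<gamma> x)) {x..y}"
    by (rule fundamental_theorem_of_calculus[OF xy]) (rule has_vector_derivative_at_within[OF \<gamma>(1)])
  then have "\<gamma> y - \<gamma> x = integral {x..y} g" by (simp add: integral_unique)
  then show ?thesis
    using integral_norm_bound_integral[of g "{x..y}" speed] \<open>(g has_integral (\<gamma> y - \<gamma> x)) {x..y}\<close> speed_int by auto
qed

lemma combine: "x \<le> y \<Longrightarrow> y \<le> z \<Longrightarrow> integral {x..y} speed + integral {y..z} speed = integral {x..z} speed"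
  by (intro Henstock_Kurzweil_Integration.integral_combine speed_int)

text \<open>A closed curve reaches the second point in either direction, so the chord is bounded by
  both arcs.\<close>

lemma chord_le:
  assumes w: "w \<in> {-1/2..1/2}"
  shows "norm (\<gamma> (u + w) - \<gamma> u) \<le> Arc u w" "norm (\<gamma> (u + w) - \<gamma> u) \<le> full_length - Arc u w"
proof -
  have per: "\<gamma> (x + 1) = \<gamma> x" for x using \<gamma>(2) by (simp add: periodic1_def)
  have "norm (\<gamma> (u + w) - \<gamma> u) \<le> Arc u w \<and> norm (\<gamma> (u + w) - \<gamma> u) \<le> full_length - Arc u w"
  proof (cases "0 \<le> w")
    case True
    have A: "Arc u w = integral {u..u + w} speed" using arc_eq(2)[of u w] True by simp
    have "full_length - Arc u w = integral {u + w..u + 1} speed"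
      using combine[of u "u + w" "u + 1"] True w length_eq(2)[of u] A by simp
    moreover have "norm (\<gamma> (u + 1) - \<gamma> (u + w)) \<le> integral {u + w..u + 1} speed" using w by (intro chord_le_integral) auto
    ultimately show ?thesis using A chord_le_integral[of u "u + w"] True per[of u] by (simp add: norm_minus_commute)
  next
    case False
    have A: "Arc u w = integral {u + w..u} speed" using arc_eq(2)[of u w] False by simp
    have "full_length - Arc u w = integral {u..u + w + 1} speed"
      using combine[of "u + w" u "u + w + 1"] False w length_eq(2)[of "u + w"] A by simp
    moreover have "norm (\<gamma> (u + w + 1) - \<gamma> u) \<le> integral {u..u + w + 1} speed" using w by (intro chord_le_integral) auto
    ultimately show ?thesis using A chord_le_integral[of "u + w" u] False per[of "u + w"] by (simp add: norm_minus_commute)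
  qed
  then show "norm (\<gamma> (u + w) - \<gamma> u) \<le> Arc u w" "norm (\<gamma> (u + w) - \<gamma> u) \<le> full_length - Arc u w" by auto
qed

lemma chord_eq: "norm (\<gamma> (u + w) - \<gamma> u) = \<bar>w\<bar> * norm (pmean (seg g u w))"
  using seg_pmean_diff[OF \<gamma>(1), of u w] by simp

lemma chord_pos: "w \<in> {-1/2..1/2} \<Longrightarrow> w \<noteq> 0 \<Longrightarrow> 0 < norm (\<gamma> (u + w) - \<gamma> u)"
  using niceD(7)[OF g, of w u] c unfolding chord_eq by (intro mult_pos_pos) auto

definition "arc_gap u w = (min (Arc u w) (full_length - Arc u w) powr (-\<alpha>) - Arc u w powr (-\<alpha>)) * norm (g (u + w)) * norm (g u)"
definition "chord_gap u w = (norm (\<gamma> (u + w) - \<gamma> u) powr (-\<alpha>) - min (Arc u w) (full_length - Arc u w) powr (-\<alpha>)) * norm (g (u + w)) * norm (g u)"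

lemma chord_gap_eq: "w \<in> {-1/2..1/2} \<Longrightarrow> w \<noteq> 0 \<Longrightarrow> ohara_integrand \<alpha> \<gamma> u w = ennreal (chord_gap u w)"
  using chord_pos[of w u] by (auto simp: ohara_integrand_def chord_gap_def vd_eq intr_dist_def arc_eq length_eq)

text \<open>The chord is at most the intrinsic distance, which is at most the arc length. Both gaps
  are therefore nonnegative, and their sum can be integrated termwise before anything is known to be
  finite.\<close>

lemma chord_gap_gap:
  assumes w: "w \<in> {-1/2..1/2}" "w \<noteq> 0"
  shows "0 \<le> chord_gap u w" "0 \<le> arc_gap u w" "chord_gap u w + arc_gap u w = \<bar>w\<bar> powr (-\<alpha>) * Phi \<alpha> (seg g u w)"
proof -
  have 1: "norm (\<gamma> (u + w) - \<gamma> u) \<le> min (Arc u w) (full_length - Arc u w)" "0 < norm (\<gamma> (u + w) - \<gamma> u)"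
    using chord_le[OF w(1), of u] chord_pos[OF w, of u] by auto
  have "min (Arc u w) (full_length - Arc u w) powr (-\<alpha>) \<le> norm (\<gamma> (u + w) - \<gamma> u) powr (-\<alpha>)"
    using 1 \<alpha> by (intro powr_mono2') auto
  then show "0 \<le> chord_gap u w" by (simp add: chord_gap_def)
  have "0 < min (Arc u w) (full_length - Arc u w)" by (rule less_le_trans[OF 1(2) 1(1)])
  then have "Arc u w powr (-\<alpha>) \<le> min (Arc u w) (full_length - Arc u w) powr (-\<alpha>)"
    using \<alpha> by (intro powr_mono2') auto
  then show "0 \<le> arc_gap u w" by (simp add: arc_gap_def)
  show "chord_gap u w + arc_gap u w = \<bar>w\<bar> powr (-\<alpha>) * Phi \<alpha> (seg g u w)"
    using less_le_trans[OF c nice_plen_ge[OF c g, of u w]] w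
    by (simp add: chord_gap_def arc_gap_def Phi_def chord_eq powr_mult algebra_simps)
qed

lemma Arc_measurable: "(\<lambda>w. plen (seg g u w)) \<in> borel_measurable borel" "(\<lambda>w. g (u + w)) \<in> borel_measurable borel"
  "(\<lambda>w. \<gamma> (u + w)) \<in> borel_measurable borel"
proof -
  have "continuous_on UNIV (\<lambda>w. plen (seg g u w))"
    by (rule continuous_on_compose2[OF plen_seg_continuous[OF niceD(1)[OF g]], of _ "\<lambda>w. (u, w)", simplified]) (intro continuous_intros)
  then show "(\<lambda>w. plen (seg g u w)) \<in> borel_measurable borel" by (rule borel_measurable_continuous_onI)
  have "continuous_on UNIV \<gamma>"
    by (intro continuous_at_imp_continuous_on ballI has_vector_derivative_continuous[OF \<gamma>(1)])
  note continuous_on_compose2[OF niceD(1)[OF g], of UNIV "\<lambda>w. u + w"] continuous_on_compose2[OF this, of UNIV "\<lambda>w. u + w"]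
  then have "continuous_on UNIV (\<lambda>w. g (u + w))" "continuous_on UNIV (\<lambda>w. \<gamma> (u + w))"
    by (simp_all add: continuous_intros)
  then show "(\<lambda>w. g (u + w)) \<in> borel_measurable borel" "(\<lambda>w. \<gamma> (u + w)) \<in> borel_measurable borel"
    by (auto intro: borel_measurable_continuous_onI)
qed

lemma arc_gap_measurable [measurable]: "arc_gap u \<in> borel_measurable borel" "chord_gap u \<in> borel_measurable borel"
proof -
  note [measurable] = Arc_measurable[of u]
  show "arc_gap u \<in> borel_measurable borel" "chord_gap u \<in> borel_measurable borel"
    unfolding arc_gap_def[abs_def] chord_gap_def[abs_def] by measurable
qed

lemma Arc_0_integral:
  assumes "0 \<le> w"
  shows "Arc u w = integral {0..w} (\<lambda>x. norm (g (u + x)))" "Arc u (- w) = integral {0..w} (\<lambda>x. norm (g (u - x)))"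
proof -
  have c1: "continuous_on UNIV (\<lambda>x. norm (g (u + x)))" "continuous_on UNIV (\<lambda>x. norm (g (u - x)))"
    by (rule continuous_on_compose2[OF speed_cont[of UNIV]]; auto intro!: continuous_intros)+
  show "Arc u w = integral {0..w} (\<lambda>x. norm (g (u + x)))" "Arc u (- w) = integral {0..w} (\<lambda>x. norm (g (u - x)))"
    using integral_segment[OF c1(1), of 0 w] integral_segment[OF c1(2), of 0 w] assms
    by (simp_all add: plen_def seg_def)
qed

lemma Arc_sum: "Arc u (1/2) + Arc u (- (1/2)) = full_length" "0 < Arc u (1/2)" "0 < Arc u (- (1/2))"
  "plen (seg g u (1/2)) / 2 = Arc u (1/2)" "plen (seg g (u + 1/2) (1/2)) / 2 = Arc u (- (1/2))"
proof -
  have a: "Arc u (1/2) = integral {u..u + 1/2} speed" "Arc u (- (1/2)) = integral {u - 1/2..u} speed"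
    using arc_eq(2)[of u "1/2"] arc_eq(2)[of u "- (1/2)"] by simp_all
  show 1: "Arc u (1/2) + Arc u (- (1/2)) = full_length"
    using a combine[of "u - 1/2" u "u + 1/2"] length_eq(2)[of "u - 1/2"] by (simp add: add.commute)
  show "0 < Arc u (1/2)" "0 < Arc u (- (1/2))"
    using less_le_trans[OF c nice_plen_ge[OF c g]] by auto
  show "plen (seg g u (1/2)) / 2 = Arc u (1/2)" by simp
  have "plen (seg g (u + 1/2) (1/2)) / 2 = integral {u + 1/2..u + 1} speed"
    using arc_eq(2)[of "u + 1/2" "1/2"] by (simp add: add.assoc)
  also have "\<dots> = full_length - Arc u (1/2)" using combine[of u "u + 1/2" "u + 1"] length_eq(2)[of u] a by simp
  finally show "plen (seg g (u + 1/2) (1/2)) / 2 = Arc u (- (1/2))" using 1 by simp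
qed

text \<open>Both powers have base 0, the total length being nonnegative, so they cancel whatever
  their value.\<close>

lemma arc_gap_0: "arc_gap u 0 = 0"
  using integral_nonneg[OF speed_int[of 0 1]] by (simp add: arc_gap_def)

text \<open>Handles both directions at once: \<open>z\<close> is 1 or -1, and \<open>h\<close> is
  the speed met when moving away from \<open>u\<close> in that direction.\<close>

lemma arc_gap_side:
  fixes h :: "real \<Rightarrow> real"
  assumes h: "continuous_on UNIV h" "\<And>x. 0 < h x" and e: "\<And>w. 0 \<le> w \<Longrightarrow> Arc u (z * w) = integral {0..w} h"
    and gh: "\<And>w. norm (g (u + z * w)) = h w" and L: "Arc u (z * (1/2)) < full_length" and z: "\<bar>z\<bar> = 1"
  shows "(\<integral>\<^sup>+w\<in>{0..1/2}. ennreal (arc_gap u (z * w)) \<partial>lborel) = ennreal (norm (g u) * arc_defect \<alpha> full_length (max (Arc u (z * (1/2))) (full_length / 2)))"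
    and "0 \<le> norm (g u) * arc_defect \<alpha> full_length (max (Arc u (z * (1/2))) (full_length / 2))"
proof -
  define A where "A w = integral {0..w} h" for w
  have "A (1/2) < full_length" using e[of "1/2"] L by (simp add: A_def)
  from arc_defect_integral[OF h \<alpha> A_def this]
  have "((\<lambda>w. (min (A w) (full_length - A w) powr (-\<alpha>) - A w powr (-\<alpha>)) * h w * norm (g u)) has_integral
      arc_defect \<alpha> full_length (max (A (1/2)) (full_length / 2)) * norm (g u)) {0..1/2}"
    by (rule has_integral_mult_left)
  then have "((\<lambda>w. arc_gap u (z * w)) has_integral arc_defect \<alpha> full_length (max (A (1/2)) (full_length / 2)) * norm (g u)) {0..1/2}"
    by (rule has_integral_eq[rotated]) (simp only: arc_gap_def e gh A_def atLeastAtMost_iff)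
  then have i: "((\<lambda>w. arc_gap u (z * w)) has_integral norm (g u) * arc_defect \<alpha> full_length (max (Arc u (z * (1/2))) (full_length / 2))) {0..1/2}"
    using e[of "1/2"] by (simp add: A_def mult.commute)
  have nn: "0 \<le> arc_gap u (z * w)" if "w \<in> {0..1/2}" for w
  proof (cases "w = 0")
    case False
    then have "\<bar>z * w\<bar> \<le> 1/2" "z * w \<noteq> 0" using that z by (auto simp: abs_mult)
    then show ?thesis by (intro chord_gap_gap(2)) (auto simp: abs_le_iff)
  qed (simp add: arc_gap_0)
  from nn_integral_has_integral_lebesgue'[OF nn i]
  show "(\<integral>\<^sup>+w\<in>{0..1/2}. ennreal (arc_gap u (z * w)) \<partial>lborel) = ennreal (norm (g u) * arc_defect \<alpha> full_length (max (Arc u (z * (1/2))) (full_length / 2)))" .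
  show "0 \<le> norm (g u) * arc_defect \<alpha> full_length (max (Arc u (z * (1/2))) (full_length / 2))"
    by (rule has_integral_nonneg[OF i nn])
qed

lemma arc_gap_integral: "(\<integral>\<^sup>+w\<in>{-1/2..1/2}. ennreal (arc_gap u w) \<partial>lborel) = ennreal (rho \<alpha> (seg g u 1))"
proof -
  have mg: "(\<lambda>w. ennreal (arc_gap u w)) \<in> borel_measurable borel" by measurable
  have c1: "continuous_on UNIV (\<lambda>x. norm (g (u + x)))" "continuous_on UNIV (\<lambda>x. norm (g (u - x)))"
    by (rule continuous_on_compose2[OF speed_cont[of UNIV]]; auto intro!: continuous_intros)+
  let ?a = "Arc u (1/2)" and ?b = "Arc u (- (1/2))"
  note S = Arc_sum[of u]
  have mult_m1: "(-1) * w = - w" for w :: real by simp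
  have e1: "Arc u (1 * w) = integral {0..w} (\<lambda>x. norm (g (u + x)))" if "0 \<le> w" for w
    unfolding mult_1 by (rule Arc_0_integral(1)[OF that])
  have e2: "Arc u ((-1) * w) = integral {0..w} (\<lambda>x. norm (g (u - x)))" if "0 \<le> w" for w
    unfolding mult_m1 by (rule Arc_0_integral(2)[OF that])
  have lt: "?a < full_length" "?b < full_length" using S(1-3) by linarith+
  have 1: "norm (g (u + 1 * w)) = norm (g (u + w))" "norm (g (u + (-1) * w)) = norm (g (u - w))" for w by simp_all
  have l1: "Arc u (1 * (1/2)) < full_length" "Arc u ((-1) * (1/2)) < full_length" using lt unfolding mult_1 mult_m1 .
  note p = arc_gap_side[OF c1(1) speed_pos e1 1(1) l1(1) abs_one, unfolded mult_1]
  have p1: "(\<integral>\<^sup>+w\<in>{0..1/2}. ennreal (arc_gap u w) \<partial>lborel) = ennreal (norm (g u) * arc_defect \<alpha> full_length (max ?a (full_length / 2)))"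
    by (rule p(1))
  have z: "\<bar>-1::real\<bar> = 1" by simp
  note m' = arc_gap_side[OF c1(2) speed_pos e2 1(2) l1(2) z, unfolded mult_m1]
  have pp: "0 \<le> norm (g u) * arc_defect \<alpha> full_length (max ?a (full_length / 2))" "0 \<le> norm (g u) * arc_defect \<alpha> full_length (max ?b (full_length / 2))"
    using p(2) m'(2) by (simp_all only: mult_m1)
  have m: "(\<integral>\<^sup>+w\<in>{-(1/2)..0}. ennreal (arc_gap u w) \<partial>lborel) = ennreal (norm (g u) * arc_defect \<alpha> full_length (max ?b (full_length / 2)))"
    unfolding nn_integral_reflect[OF mg] by (rule m'(1))
  have "(\<integral>\<^sup>+w\<in>{-(1/2)..1/2}. ennreal (arc_gap u w) \<partial>lborel) = ennreal (norm (g u) * arc_defect \<alpha> full_length (max ?b (full_length / 2))) + ennreal (norm (g u) * arc_defect \<alpha> full_length (max ?a (full_length / 2)))"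
    unfolding p1[symmetric] m[symmetric] by (rule nn_integral_split_0[OF mg]) simp
  also have "\<dots> = ennreal (norm (g u) * (arc_defect \<alpha> full_length (max ?a (full_length / 2)) + arc_defect \<alpha> full_length (max ?b (full_length / 2))))"
    unfolding distrib_left ennreal_plus[OF pp] by (rule add.commute)
  also have "norm (g u) * (arc_defect \<alpha> full_length (max ?a (full_length / 2)) + arc_defect \<alpha> full_length (max ?b (full_length / 2))) = rho \<alpha> (seg g u 1)"
    unfolding arc_defect_sum[OF S(2,3,1)] rho_def Let_def seg_half seg_0 S(4,5) S(1) by simp
  finally show ?thesis by (simp only: minus_divide_left)
qed

text \<open>Formulated as a sum, because for a single \<open>u\<close> the right-hand side may be
  infinite and subtraction of extended reals would need care.\<close>

lemma inner_OHara:
  "(\<integral>\<^sup>+w\<in>{-1/2..1/2}. ohara_integrand \<alpha> \<gamma> u w \<partial>lborel) + ennreal (rho \<alpha> (seg g u 1))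
    = (\<integral>\<^sup>+w\<in>{-1/2..1/2}. ennreal (\<bar>w\<bar> powr (-\<alpha>) * Phi \<alpha> (seg g u w)) \<partial>lborel)"
proof -
  have ae: "AE w in lborel. w \<noteq> (0::real)" by (rule AE_lborel_singleton)
  have 1: "(\<integral>\<^sup>+w\<in>{-1/2..1/2}. ohara_integrand \<alpha> \<gamma> u w \<partial>lborel) = (\<integral>\<^sup>+w\<in>{-1/2..1/2}. ennreal (chord_gap u w) \<partial>lborel)"
    using ae by (intro nn_integral_cong_AE, eventually_elim) (auto simp: indicator_def chord_gap_eq)
  have "(\<integral>\<^sup>+w\<in>{-1/2..1/2}. ennreal (\<bar>w\<bar> powr (-\<alpha>) * Phi \<alpha> (seg g u w)) \<partial>lborel)
     = (\<integral>\<^sup>+w. ennreal (chord_gap u w) * indicator {-1/2..1/2} w + ennreal (arc_gap u w) * indicator {-1/2..1/2} w \<partial>lborel)"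
    using ae by (intro nn_integral_cong_AE, eventually_elim)
      (auto simp: indicator_def chord_gap_gap(3)[symmetric] chord_gap_gap(1,2) ennreal_plus)
  also have "\<dots> = (\<integral>\<^sup>+w\<in>{-1/2..1/2}. ennreal (chord_gap u w) \<partial>lborel) + (\<integral>\<^sup>+w\<in>{-1/2..1/2}. ennreal (arc_gap u w) \<partial>lborel)"
    by (intro nn_integral_add) measurable
  finally show ?thesis unfolding 1 arc_gap_integral by simp
qed

text \<open>Convexity of \<open>x powr (1 - \<alpha>)\<close>, applied to the two half arcs. The
  sign cannot be read off from \<open>arc_gap_integral\<close>, as \<open>ennreal\<close> sends
  negative numbers to 0.\<close>

lemma rho_nonneg: "0 \<le> rho \<alpha> (seg g u 1)"
proof -
  note S = Arc_sum[of u]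
  let ?a = "Arc u (1/2)" and ?b = "Arc u (- (1/2))"
  have cvx: "convex_on {0<..} (\<lambda>x::real. x powr (1 - \<alpha>))"
    by (rule convex_on_realI[where f'="\<lambda>x. (1 - \<alpha>) * x powr (- \<alpha>)"])
       (use \<alpha> in \<open>auto intro!: derivative_eq_intros mult_left_mono_neg powr_mono2'\<close>)
  have "((1 - 1/2) *\<^sub>R ?a + (1/2) *\<^sub>R ?b) powr (1 - \<alpha>) \<le> (1 - 1/2) * ?a powr (1 - \<alpha>) + (1/2) * ?b powr (1 - \<alpha>)"
    using S(2,3) by (intro convex_onD[OF cvx]) auto
  then have "2 * ((?a + ?b) / 2) powr (1 - \<alpha>) \<le> ?a powr (1 - \<alpha>) + ?b powr (1 - \<alpha>)"
    by (simp add: add_divide_distrib)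
  then have "0 \<le> ?a powr (1 - \<alpha>) + ?b powr (1 - \<alpha>) - 2 * ((?a + ?b) / 2) powr (1 - \<alpha>)" by linarith
  then show ?thesis using \<alpha> unfolding rho_def Let_def seg_half seg_0 S(4,5) by (intro divide_nonneg_nonneg mult_nonneg_nonneg) auto
qed

lemma OHara_eq:
  assumes I: "wintegrable \<alpha> (\<lambda>u w. Phi \<alpha> (seg g u w))"
  shows "OHara \<alpha> \<gamma> < \<infinity>" "enn2real (OHara \<alpha> \<gamma>) = Eg \<alpha> g"
proof -
  let ?F = "\<lambda>x. ennreal (\<bar>snd x\<bar> powr (-\<alpha>) * Phi \<alpha> (seg g (fst x) (snd x)))"
  let ?f = "\<lambda>x. indicator bx x *\<^sub>R (\<bar>snd x\<bar> powr (-\<alpha>) * Phi \<alpha> (seg g (fst x) (snd x)))"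
  have int: "integrable lborel ?f" using I unfolding wintegrable_def set_integrable_def .
  have eq: "?F x * indicator bx x = ennreal (?f x)" for x by (auto simp: indicator_def)
  have m: "(\<lambda>x. ?F x * indicator bx x) \<in> borel_measurable borel"
    unfolding eq using borel_measurable_integrable[OF int] by simp
  have nonneg: "0 \<le> ?f x" for x
    using chord_gap_gap[of "snd x" "fst x"] by (cases "snd x = 0") (auto simp: indicator_def bx_def)
  have A: "(\<integral>\<^sup>+x\<in>bx. ?F x \<partial>lborel) = ennreal (wint \<alpha> (\<lambda>u w. Phi \<alpha> (seg g u w)))"
    unfolding eq wint_def set_lebesgue_integral_def by (rule nn_integral_eq_integral[OF int AE_I2[OF nonneg]])
  let ?I = "\<lambda>u. \<integral>\<^sup>+w\<in>{-1/2..1/2}. ?F (u, w) \<partial>lborel"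
  let ?O = "\<lambda>u. \<integral>\<^sup>+w\<in>{-1/2..1/2}. ohara_integrand \<alpha> \<gamma> u w \<partial>lborel"
  let ?r = "\<lambda>u. ennreal (rho \<alpha> (seg g u 1))"
  have B: "(\<integral>\<^sup>+u\<in>{0..1}. ?I u \<partial>lborel) = ennreal (wint \<alpha> (\<lambda>u w. Phi \<alpha> (seg g u w)))"
    using A nn_bx_iterated[OF m] by simp
  have sum: "?O u + ?r u = ?I u" for u using inner_OHara[of u] by simp
  have mI: "(\<lambda>u. ?I u * indicator {0..1} u) \<in> borel_measurable lborel"
  proof -
    have "(\<lambda>u. \<integral>\<^sup>+w. ?F (u, w) * indicator bx (u, w) \<partial>lborel) \<in> borel_measurable lborel"
      using m by (intro lborel.borel_measurable_nn_integral_fst) (simp add: lborel_prod)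
    moreover have "(\<integral>\<^sup>+w. ?F (u, w) * indicator bx (u, w) \<partial>lborel) = ?I u * indicator {0..1} u" for u
      by (auto simp: indicator_def bx_def intro!: nn_integral_cong)
    ultimately show ?thesis by simp
  qed
  have rc: "continuous_on S (\<lambda>u. rho \<alpha> (seg g u 1))" for S by (rule rho_seg_continuous[OF c g])
  have mr: "(\<lambda>u. ?r u * indicator {0..1} u) \<in> borel_measurable lborel"
    using borel_measurable_continuous_onI[OF rc] by simp
  \<comment> \<open>Since \<open>?r\<close> is finite, it can be subtracted pointwise; the inner
    energy integral becomes a difference of functions already known to be measurable.\<close>
  have "OHara \<alpha> \<gamma> = (\<integral>\<^sup>+u. ?I u * indicator {0..1} u - ?r u * indicator {0..1} u \<partial>lborel)"
    unfolding OHara_def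
  proof (rule nn_integral_cong)
    fix u :: real
    have "?O u = ?I u - ?r u" unfolding sum[symmetric] by simp
    then show "?O u * indicator {0..1} u = ?I u * indicator {0..1} u - ?r u * indicator {0..1} u"
      by (auto simp: indicator_def)
  qed
  also have "\<dots> = (\<integral>\<^sup>+u. ?I u * indicator {0..1} u \<partial>lborel) - (\<integral>\<^sup>+u. ?r u * indicator {0..1} u \<partial>lborel)"
  proof (rule nn_integral_diff[OF mI mr])
    have "(\<integral>\<^sup>+u. ?r u * indicator {0..1} u \<partial>lborel) \<le> (\<integral>\<^sup>+u\<in>{0..1}. ?I u \<partial>lborel)"
      unfolding sum[symmetric] by (intro nn_integral_mono mult_right_mono) auto
    then show "(\<integral>\<^sup>+u. ?r u * indicator {0..1} u \<partial>lborel) \<noteq> \<infinity>" unfolding B by (auto simp: top_unique)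
    show "AE u in lborel. ?r u * indicator {0..1} u \<le> ?I u * indicator {0..1} u"
      unfolding sum[symmetric] by (intro AE_I2 mult_right_mono) auto
  qed
  also have "(\<integral>\<^sup>+u. ?r u * indicator {0..1} u \<partial>lborel) = ennreal (integral {0..1} (\<lambda>u. rho \<alpha> (seg g u 1)))"
    by (intro nn_integral_has_integral_lebesgue' integrable_integral integrable_continuous_real rc rho_nonneg)
  also have "integral {0..1} (\<lambda>u. rho \<alpha> (seg g u 1)) = set_lebesgue_integral lborel {0..1} (\<lambda>u. rho \<alpha> (seg g u 1))"
    by (rule set_borel_integral_eq_integral(2)[OF borel_integrable_atLeastAtMost'[OF rc], symmetric])
  also have "(\<integral>\<^sup>+u. ?I u * indicator {0..1} u \<partial>lborel) = ennreal (wint \<alpha> (\<lambda>u w. Phi \<alpha> (seg g u w)))" by (rule B)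
  finally have O: "OHara \<alpha> \<gamma> = ennreal (wint \<alpha> (\<lambda>u w. Phi \<alpha> (seg g u w))) - ennreal (set_lebesgue_integral lborel {0..1} (\<lambda>u. rho \<alpha> (seg g u 1)))" .
  have le: "ennreal (set_lebesgue_integral lborel {0..1} (\<lambda>u. rho \<alpha> (seg g u 1))) \<le> ennreal (wint \<alpha> (\<lambda>u w. Phi \<alpha> (seg g u w)))"
  proof -
    have "(\<integral>\<^sup>+u. ?r u * indicator {0..1} u \<partial>lborel) \<le> (\<integral>\<^sup>+u\<in>{0..1}. ?I u \<partial>lborel)"
      unfolding sum[symmetric] by (intro nn_integral_mono mult_right_mono) auto
    moreover have "(\<integral>\<^sup>+u. ?r u * indicator {0..1} u \<partial>lborel) = ennreal (integral {0..1} (\<lambda>u. rho \<alpha> (seg g u 1)))"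
      by (intro nn_integral_has_integral_lebesgue' integrable_integral integrable_continuous_real rc rho_nonneg)
    ultimately show ?thesis unfolding B set_borel_integral_eq_integral(2)[OF borel_integrable_atLeastAtMost'[OF rc]] by simp
  qed
  have r0: "0 \<le> set_lebesgue_integral lborel {0..1} (\<lambda>u. rho \<alpha> (seg g u 1))"
    unfolding set_lebesgue_integral_def by (intro Bochner_Integration.integral_nonneg) (simp add: rho_nonneg)
  have w0: "0 \<le> wint \<alpha> (\<lambda>u w. Phi \<alpha> (seg g u w))"
    unfolding wint_def set_lebesgue_integral_def by (intro Bochner_Integration.integral_nonneg nonneg)
  have O': "OHara \<alpha> \<gamma> = ennreal (Eg \<alpha> g)" unfolding O Eg_def using r0 by (simp add: ennreal_minus)
  then show "OHara \<alpha> \<gamma> < \<infinity>" by simp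
  have "0 \<le> Eg \<alpha> g" using le w0 unfolding Eg_def by (simp add: ennreal_le_iff)
  then show "enn2real (OHara \<alpha> \<gamma>) = Eg \<alpha> g" unfolding O' by simp
qed

end

section \<open>Curves parametrized by arc length\<close>

lemma integral_periodic_shift:
  fixes p :: "real \<Rightarrow> real"
  assumes c: "continuous_on UNIV p" and per: "periodic1 p"
  shows "integral {0..1} (\<lambda>u. p (a + u)) = integral {0..1} p"
proof -
  \<comment> \<open>A bound is added to make the function nonnegative, the case treated by
    \<open>integral_period\<close>.\<close>
  have "compact (p ` {0..1})" by (intro compact_continuous_image continuous_on_subset[OF c]) auto
  then obtain B where B: "\<And>x. x \<in> {0..1} \<Longrightarrow> \<bar>p x\<bar> \<le> B" by (metis bounded_iff compact_imp_bounded image_eqI real_norm_def)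
  have Bx: "0 \<le> p x + B" for x
  proof -
    have "p x = p (frac x)" using periodic1_int[OF per, of "frac x" "\<lfloor>x\<rfloor>"] by (simp add: frac_def)
    moreover have "frac x \<in> {0..1}" using frac_ge_0[of x] frac_lt_1[of x] by simp
    ultimately show ?thesis using B[of "frac x"] by (simp add: abs_le_iff)
  qed
  have i: "p integrable_on {x..y}" for x y by (intro integrable_continuous_real continuous_on_subset[OF c]) auto
  have "integral {a..a + 1} (\<lambda>x. p x + B) = integral {0..1} (\<lambda>x. p x + B)"
    using per Bx by (intro integral_period continuous_intros c) (auto simp: periodic1_def)
  then have "integral {a..a + 1} p = integral {0..1} p" by (simp add: integral_add[OF i integrable_const_ivl])
  moreover have "integral {a..a + 1} p = integral {0..1} (\<lambda>u. p (a + u))" using integral_segment[OF c, of a 1] by simp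
  ultimately show ?thesis by simp
qed

definition Wset :: "real \<Rightarrow> real set" where "Wset \<epsilon> = {-1/2..-\<epsilon>} \<union> {\<epsilon>..1/2}"

lemma Wset_closed: "closed (Wset \<epsilon>)" "compact (Wset \<epsilon>)" "Wset \<epsilon> \<in> sets borel"
  by (auto simp: Wset_def intro!: borel_closed closed_Un compact_Un)

lemma Wset_uminus: "- w \<in> Wset \<epsilon> \<longleftrightarrow> w \<in> Wset \<epsilon>"
  by (auto simp: Wset_def)

lemma Wset_nz: "0 < \<epsilon> \<Longrightarrow> w \<in> Wset \<epsilon> \<Longrightarrow> w \<noteq> 0 \<and> w \<in> {-1/2..1/2}"
  by (auto simp: Wset_def)

text \<open>Away from \<open>w = 0\<close> the integrands are continuous on a compact set, so both
  orders of integration are available. The order with \<open>u\<close> inside is the one that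
  exploits periodicity.\<close>

lemma Fubini_strip:
  fixes H :: "real \<times> real \<Rightarrow> real"
  assumes "continuous_on ({0..1} \<times> Wset \<epsilon>) H"
  shows "set_integrable lborel ({0..1} \<times> Wset \<epsilon>) H"
    "set_lebesgue_integral lborel ({0..1} \<times> Wset \<epsilon>) H = set_lebesgue_integral lborel {0..1} (\<lambda>u. set_lebesgue_integral lborel (Wset \<epsilon>) (\<lambda>w. H (u, w)))"
    "set_lebesgue_integral lborel ({0..1} \<times> Wset \<epsilon>) H = set_lebesgue_integral lborel (Wset \<epsilon>) (\<lambda>w. set_lebesgue_integral lborel {0..1} (\<lambda>u. H (u, w)))"
proof -
  let ?S = "{0..1} \<times> Wset \<epsilon>"
  show i: "set_integrable lborel ?S H"
    unfolding set_integrable_def using Wset_closed by (intro borel_integrable_compact compact_Times assms) auto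
  then have i': "integrable (lborel \<Otimes>\<^sub>M lborel) (\<lambda>x. indicator ?S x *\<^sub>R H x)" by (simp add: set_integrable_def lborel_prod)
  have e: "indicator ?S (u, w) *\<^sub>R H (u, w) = indicator {0..1} u *\<^sub>R (indicator (Wset \<epsilon>) w *\<^sub>R H (u, w))" for u w
    by (auto simp: indicator_def)
  have e2: "indicator ?S (u, w) *\<^sub>R H (u, w) = indicator (Wset \<epsilon>) w *\<^sub>R (indicator {0..1} u *\<^sub>R H (u, w))" for u w
    by (auto simp: indicator_def)
  show "set_lebesgue_integral lborel ?S H = set_lebesgue_integral lborel {0..1} (\<lambda>u. set_lebesgue_integral lborel (Wset \<epsilon>) (\<lambda>w. H (u, w)))"
    using lborel_pair.integral_fst'[OF i'] unfolding e by (simp add: set_lebesgue_integral_def lborel_prod)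
  have "integrable (lborel \<Otimes>\<^sub>M lborel) (\<lambda>(u, w). indicator ?S (u, w) *\<^sub>R H (u, w))" using i' by (simp add: split_def)
  from lborel_pair.integral_snd[OF this]
  have "(LINT w|lborel. LINT u|lborel. indicator ?S (u, w) *\<^sub>R H (u, w)) = integral\<^sup>L (lborel \<Otimes>\<^sub>M lborel) (\<lambda>x. indicator ?S x *\<^sub>R H x)"
    by (simp add: split_def)
  then show "set_lebesgue_integral lborel ?S H = set_lebesgue_integral lborel (Wset \<epsilon>) (\<lambda>w. set_lebesgue_integral lborel {0..1} (\<lambda>u. H (u, w)))"
    unfolding e2 by (simp add: set_lebesgue_integral_def lborel_prod)
qed

lemma set_integral_reflect:
  fixes q :: "real \<Rightarrow> real"
  assumes "\<And>w. - w \<in> W \<longleftrightarrow> w \<in> W"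
  shows "set_lebesgue_integral lborel W (\<lambda>w. q (- w)) = set_lebesgue_integral lborel W q"
proof -
  have "set_lebesgue_integral lborel W q = (LINT w|lborel. indicator W (0 + (-1) * w) *\<^sub>R q (0 + (-1) * w))"
    unfolding set_lebesgue_integral_def using lborel_integral_real_affine[of "-1" "\<lambda>w. indicator W w *\<^sub>R q w" 0] by simp
  also have "\<dots> = set_lebesgue_integral lborel W (\<lambda>w. q (- w))"
    unfolding set_lebesgue_integral_def using assms by (intro Bochner_Integration.integral_cong) (auto simp: indicator_def)
  finally show ?thesis by simp
qed

lemma unit_set_integral:
  fixes f :: "real \<Rightarrow> real"
  assumes "continuous_on UNIV f"
  shows "set_lebesgue_integral lborel {0..1} f = integral {0..1} f"
  by (rule set_borel_integral_eq_integral(2)[OF borel_integrable_atLeastAtMost'[OF continuous_on_subset[OF assms]]]) auto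

context
  fixes \<gamma> h g k :: "real \<Rightarrow> real^'n" and c C \<alpha> :: real
  assumes c: "0 < c" and g: "nice c C g" and \<gamma>: "\<And>x. (\<gamma> has_vector_derivative g x) (at x)" "periodic1 \<gamma>"
    and k: "continuous_on UNIV k" and h: "\<And>x. (h has_vector_derivative k x) (at x)" "periodic1 h"
    and \<alpha>: "1 < \<alpha>" and arc: "\<And>u. norm (g u) = 1"
begin

private abbreviation (input) "gk \<equiv> (\<lambda>u. g u \<bullet> k u)"
private abbreviation (input) "gk_mean \<equiv> (\<lambda>u w. integral {0..1} (\<lambda>s. gk (u + s * w)))"
private abbreviation (input) "chord_pow \<equiv> (\<lambda>u w. norm (\<gamma> (u + w) - \<gamma> u) powr (-\<alpha>))"
private abbreviation (input) "weighted_Psi \<equiv> (\<lambda>u w. \<bar>w\<bar> powr (-\<alpha>) * Psi \<alpha> (seg g u w) (seg k u w))"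

lemma gk_cont: "continuous_on S gk" and gk_per: "periodic1 gk"
proof -
  have kp: "periodic1 k" by (rule C1_periodic_deriv[OF h(2,1)])
  show "continuous_on S gk" using niceD(1)[OF g] k by (intro continuous_intros) (auto intro: continuous_on_subset)
  show "periodic1 gk" using niceD(2)[OF g] kp by (simp add: periodic1_def)
qed

lemma sgn_g: "sgn (g u) = g u" by (simp add: sgn_div_norm arc)

lemma plen_1: "plen (seg g u w) = 1" by (simp add: plen_def seg_def arc)

lemma dplen_arc: "dplen (seg g u w) (seg k u w) = gk_mean u w"
  by (simp add: dplen_def seg_def sgn_g)

text \<open>At unit speed both half arcs are exactly half of the curve, the configuration in which
  \<open>rho\<close> attains its minimum 0; so its derivative vanishes.\<close>

lemma drho_arc: "drho \<alpha> (seg g u 1) (seg k u 1) = 0"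
  unfolding drho_def Let_def seg_half plen_1 by (simp add: algebra_simps)

text \<open>Replacing \<open>gk_mean u w\<close> and \<open>gk (u + w)\<close> by
  \<open>gk u\<close> in \<open>Psi\<close> gives the integrand of the formula: in
  \<open>\<alpha> - 2\<close> the \<open>\<alpha>\<close> stems from the derivative of the length,
  the \<open>-2\<close> from the two speeds. The errors are grouped by the symmetry that removes
  them, translation for the first and exchange of endpoints for the second.\<close>

lemma weighted_Psi_eq:
  assumes w: "w \<in> {-1/2..1/2}" "w \<noteq> 0"
  shows "weighted_Psi u w = dE_integrand \<alpha> \<gamma> h u w + (\<bar>w\<bar> powr (-\<alpha>) * (\<alpha> * (gk_mean u w - gk u) - (gk (u + w) - gk u)) + chord_pow u w * (gk (u + w) - gk u))"
proof -
  let ?D = "pmean (seg g u w)" and ?K = "pmean (seg k u w)"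
  have D: "?D \<noteq> 0" using niceD(7)[OF g w(1), of u] c by auto
  have d: "\<gamma> (u + w) - \<gamma> u = w *\<^sub>R ?D" "h (u + w) - h u = w *\<^sub>R ?K"
    by (rule seg_pmean_diff[OF \<gamma>(1)], rule seg_pmean_diff[OF h(1)])
  have vds: "vector_derivative \<gamma> (at u) = g u" "vector_derivative h (at u) = k u"
    by (rule vector_derivative_at[OF \<gamma>(1)], rule vector_derivative_at[OF h(1)])
  have n: "norm (\<gamma> (u + w) - \<gamma> u) = \<bar>w\<bar> * norm ?D" by (simp add: d)
  have pw: "(\<bar>w\<bar> * norm ?D) powr b = \<bar>w\<bar> powr b * norm ?D powr b" for b by (simp add: powr_mult)
  have sq: "norm ?D powr (-\<alpha> - 1) * (sgn ?D \<bullet> ?K) = norm ?D powr (-\<alpha> - 2) * (?D \<bullet> ?K)"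
    using D by (simp add: sgn_div_norm powr_diff power2_eq_square field_simps powr_numeral)
  have ww: "w * w = \<bar>w\<bar> powr 2" by (simp add: powr_numeral power2_eq_square)
  have "(\<bar>w\<bar> * norm ?D) powr (-\<alpha> - 2) * (w * w) = \<bar>w\<bar> powr (-\<alpha>) * norm ?D powr (-\<alpha> - 2)"
  proof -
    have "\<bar>w\<bar> powr (-\<alpha>) = \<bar>w\<bar> powr (-\<alpha> - 2) * \<bar>w\<bar> powr 2" unfolding powr_add[symmetric] by simp
    then show ?thesis unfolding pw ww by (simp only: mult_ac)
  qed
  moreover have "x / (y powr b) = y powr (- b) * x" for x y b :: real by (simp add: powr_minus divide_inverse)
  ultimately have dE: "dE_integrand \<alpha> \<gamma> h u w = (\<alpha> - 2) * (\<bar>w\<bar> powr (-\<alpha>) * gk u) + 2 * (chord_pow u w * gk u)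
     - \<alpha> * (\<bar>w\<bar> powr (-\<alpha>) * norm ?D powr (-\<alpha> - 2) * (?D \<bullet> ?K))"
    unfolding dE_integrand_def Let_def vds d by (simp add: mult_ac)
  have chd: "chord_pow u w = \<bar>w\<bar> powr (-\<alpha>) * norm ?D powr (-\<alpha>)" unfolding n pw ..
  have "weighted_Psi u w = \<bar>w\<bar> powr (-\<alpha>) * (\<alpha> * (gk_mean u w - norm ?D powr (-\<alpha> - 2) * (?D \<bullet> ?K)) + (norm ?D powr (-\<alpha>) - 1) * (gk (u + w) + gk u))"
    unfolding Psi_def plen_1 dplen_arc sq by (simp add: arc sgn_g)
  also have "\<dots> = dE_integrand \<alpha> \<gamma> h u w + (\<bar>w\<bar> powr (-\<alpha>) * (\<alpha> * (gk_mean u w - gk u) - (gk (u + w) - gk u)) + chord_pow u w * (gk (u + w) - gk u))"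
    unfolding dE chd by (simp add: algebra_simps)
  finally show ?thesis .
qed

section \<open>Truncated integrals and their symmetries\<close>

lemma strip_cont:
  assumes "0 < \<epsilon>"
  shows "continuous_on ({0..1::real} \<times> Wset \<epsilon>) (\<lambda>x. \<bar>snd x\<bar> powr (-\<alpha>))" (is ?w)
    "continuous_on ({0..1::real} \<times> Wset \<epsilon>) (\<lambda>x. chord_pow (fst x) (snd x))" (is ?c)
    "continuous_on S (\<lambda>x. gk (fst x))" "continuous_on S (\<lambda>x. gk (fst x + snd x))" "continuous_on S (\<lambda>x. gk_mean (fst x) (snd x))"
    "continuous_on ({0..1::real} \<times> Wset \<epsilon>) (\<lambda>x. weighted_Psi (fst x) (snd x))" (is ?F)
proof -
  let ?S = "{0..1::real} \<times> Wset \<epsilon>"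
  have nz: "snd x \<noteq> 0 \<and> snd x \<in> {-1/2..1/2}" if "x \<in> ?S" for x using Wset_nz[OF assms] that by (auto simp: mem_Times_iff)
  have "\<forall>x\<in>?S. \<bar>snd x\<bar> \<noteq> 0" using nz by (metis abs_eq_0)
  then show w: ?w by (intro continuous_intros)
  have gc: "continuous_on UNIV \<gamma>" by (intro continuous_at_imp_continuous_on ballI has_vector_derivative_continuous[OF \<gamma>(1)])
  have "continuous_on ?S (\<lambda>x. \<gamma> (fst x + snd x))" "continuous_on ?S (\<lambda>x. \<gamma> (fst x))"
    by (rule continuous_on_compose2[OF gc]; auto intro!: continuous_intros)+
  moreover have "norm (\<gamma> (fst x + snd x) - \<gamma> (fst x)) \<noteq> 0" if "x \<in> ?S" for x
    using chord_pos[OF c g \<gamma> \<alpha>, of "snd x" "fst x"] nz[OF that] by auto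
  ultimately show ?c by (intro continuous_intros ballI) auto
  show "continuous_on S (\<lambda>x. gk (fst x))" "continuous_on S (\<lambda>x. gk (fst x + snd x))"
    by (rule continuous_on_compose2[OF gk_cont[of UNIV]]; auto intro!: continuous_intros)+
  have "continuous_on UNIV (\<lambda>x. gk_mean (fst x) (snd x))"
    by (rule seg_integral_continuous[of "\<lambda>u v. gk v"]) (rule continuous_on_snd_comp[OF gk_cont])
  then show "continuous_on S (\<lambda>x. gk_mean (fst x) (snd x))" by (rule continuous_on_subset) simp
  have "?S \<subseteq> bx" using Wset_nz[OF assms] by (auto simp: bx_def)
  then show ?F by (rule continuous_on_mult[OF w continuous_on_subset[OF Psi_seg_continuous[OF c g k]]])
qed

text \<open>After exchanging the integrals over \<open>u\<close> and \<open>s\<close>, each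
  \<open>s\<close> contributes a translate of \<open>gk\<close> over a full period.\<close>

lemma gk_mean_integral: "set_lebesgue_integral lborel {0..1} (\<lambda>u. gk_mean u w) = integral {0..1} gk"
proof -
  have "continuous_on UNIV (\<lambda>x. gk_mean (fst x) (snd x))"
    by (rule strip_cont(5)[of 1]) simp
  from continuous_on_compose2[OF this, of UNIV "\<lambda>u. (u, w)"] have "continuous_on UNIV (\<lambda>u. gk_mean u w)"
    by (simp add: continuous_intros)
  then have "set_lebesgue_integral lborel {0..1} (\<lambda>u. gk_mean u w) = integral {0..1} (\<lambda>u. gk_mean u w)" by (rule unit_set_integral)
  also have "\<dots> = integral {0..1} (\<lambda>s. integral {0..1} (\<lambda>u. gk (u + s * w)))"
  proof -
    have "continuous_on (cbox (0, 0) (1, 1)) (\<lambda>(u, s). gk (u + s * w))"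
      unfolding split_def by (rule continuous_on_compose2[OF gk_cont[of UNIV]]) (auto intro!: continuous_intros)
    from integral_swap_continuous[OF this] show ?thesis by simp
  qed
  also have "\<dots> = integral {0..1} (\<lambda>s::real. integral {0..1} gk)"
  proof -
    have "integral {0..1} (\<lambda>u. gk (u + s * w)) = integral {0..1} gk" for s
      using integral_periodic_shift[OF gk_cont gk_per, of "s * w"] by (simp only: add.commute)
    then show ?thesis by simp
  qed
  finally show ?thesis by simp
qed

lemma gk_shift_integral: "set_lebesgue_integral lborel {0..1} (\<lambda>u. gk (u + w)) = integral {0..1} gk" "set_lebesgue_integral lborel {0..1} gk = integral {0..1} gk"
proof -
  have "continuous_on UNIV (\<lambda>u. gk (u + w))"
    by (rule continuous_on_compose2[OF gk_cont[of UNIV]]) (auto intro!: continuous_intros)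
  then have "set_lebesgue_integral lborel {0..1} (\<lambda>u. gk (u + w)) = integral {0..1} (\<lambda>u. gk (w + u))"
    by (subst unit_set_integral) (simp_all add: add.commute)
  then show "set_lebesgue_integral lborel {0..1} (\<lambda>u. gk (u + w)) = integral {0..1} gk"
    using integral_periodic_shift[OF gk_cont gk_per, of w] by simp
  show "set_lebesgue_integral lborel {0..1} gk = integral {0..1} gk" by (rule unit_set_integral[OF gk_cont])
qed

lemma unit_integrable:
  fixes f :: "real \<Rightarrow> real"
  assumes "continuous_on UNIV f" shows "set_integrable lborel {0..1} f"
  by (rule borel_integrable_atLeastAtMost'[OF continuous_on_subset[OF assms]]) simp

text \<open>On the strip all terms are integrable one by one. Near \<open>w = 0\<close> the terms
  \<open>?Y\<close> and \<open>?Z\<close> need not be, and for this reason the formula is a limit of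
  truncated integrals although \<open>Psi\<close> itself is integrable against the weight.\<close>

lemma strip_integral:
  assumes \<epsilon>: "0 < \<epsilon>"
  shows "set_lebesgue_integral lborel ({0..1::real} \<times> Wset \<epsilon>) (\<lambda>x. weighted_Psi (fst x) (snd x)) = Ieps \<alpha> \<gamma> h \<epsilon>"
proof -
  let ?S = "{0..1::real} \<times> Wset \<epsilon>" and ?W = "Wset \<epsilon>"
  note sc = strip_cont[OF \<epsilon>]
  let ?X = "\<lambda>x. \<bar>snd x\<bar> powr (-\<alpha>) * (\<alpha> * (gk_mean (fst x) (snd x) - gk (fst x)) - (gk (fst x + snd x) - gk (fst x)))"
  let ?Y = "\<lambda>x. chord_pow (fst x) (snd x) * gk (fst x + snd x)" and ?Z = "\<lambda>x. chord_pow (fst x) (snd x) * gk (fst x)"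
  have cX: "continuous_on ?S ?X" and cY: "continuous_on ?S ?Y" and cZ: "continuous_on ?S ?Z"
    by (intro continuous_on_mult continuous_on_diff continuous_on_const sc)+
  \<comment> \<open>For fixed \<open>w\<close> the functions \<open>gk u\<close>,
    \<open>gk (u + w)\<close> and \<open>gk_mean u w\<close> have the same integral over a
    period.\<close>
  have X0: "set_lebesgue_integral lborel ?S ?X = 0"
  proof -
    have gkc: "continuous_on UNIV (\<lambda>u. gk_mean u w)" "continuous_on UNIV (\<lambda>u. gk (u + w))" for w
      using continuous_on_compose2[OF sc(5)[of UNIV], of UNIV "\<lambda>u. (u, w)"] continuous_on_compose2[OF gk_cont[of UNIV], of UNIV "\<lambda>u. u + w"]
      by (auto simp: continuous_intros)
    have in0: "set_lebesgue_integral lborel {0..1} (\<lambda>u. ?X (u, w)) = 0" for w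
    proof -
      have "set_lebesgue_integral lborel {0..1} (\<lambda>u. ?X (u, w)) = \<bar>w\<bar> powr (-\<alpha>) * (\<alpha> *
         (set_lebesgue_integral lborel {0..1} (\<lambda>u. gk_mean u w) - set_lebesgue_integral lborel {0..1} gk)
         - (set_lebesgue_integral lborel {0..1} (\<lambda>u. gk (u + w)) - set_lebesgue_integral lborel {0..1} gk))"
        by (simp add: set_integral_diff unit_integrable gkc gk_cont continuous_on_diff continuous_on_mult)
      then show ?thesis unfolding gk_mean_integral gk_shift_integral by simp
    qed
    show ?thesis unfolding Fubini_strip(3)[OF cX] in0 by (simp add: set_lebesgue_integral_def)
  qed
  \<comment> \<open>Translating \<open>u\<close> by \<open>-w\<close> turns \<open>?Y\<close> at
    \<open>w\<close> into \<open>?Z\<close> at \<open>-w\<close>, since the chord is symmetric in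
    its endpoints; the range of \<open>w\<close> is symmetric as well.\<close>
  have YZ: "set_lebesgue_integral lborel ?S ?Y = set_lebesgue_integral lborel ?S ?Z"
  proof -
    define q where "q w = set_lebesgue_integral lborel {0..1} (\<lambda>u. ?Z (u, w))" for w
    have gc: "continuous_on UNIV \<gamma>" by (intro continuous_at_imp_continuous_on ballI has_vector_derivative_continuous[OF \<gamma>(1)])
    have "set_lebesgue_integral lborel {0..1} (\<lambda>u. ?Y (u, w)) = q (- w)" if w: "w \<in> ?W" for w
    proof -
      let ?r = "\<lambda>u. norm (\<gamma> u - \<gamma> (u - w)) powr (-\<alpha>) * gk u"
      have nz: "norm (\<gamma> u - \<gamma> (u - w)) \<noteq> 0" for u
        using chord_pos[OF c g \<gamma> \<alpha>, of w "u - w"] Wset_nz[OF \<epsilon> w] by auto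
      have "continuous_on UNIV (\<lambda>u. \<gamma> (u - w))" by (rule continuous_on_compose2[OF gc]) (auto intro!: continuous_intros)
      then have rc: "continuous_on UNIV ?r" using nz by (intro continuous_intros gc gk_cont) auto
      have rp: "periodic1 ?r"
      proof -
        have "\<gamma> (x + 1 - w) = \<gamma> (x - w)" for x using \<gamma>(2) unfolding periodic1_def by (metis add_diff_eq diff_add_eq)
        then show ?thesis using \<gamma>(2) gk_per by (simp add: periodic1_def)
      qed
      have e: "(\<lambda>u. ?Y (u, w)) = (\<lambda>u. ?r (w + u))" by (auto simp: add.commute)
      have "continuous_on UNIV (\<lambda>u. ?r (w + u))" by (rule continuous_on_compose2[OF rc]) (auto intro!: continuous_intros)
      then have "set_lebesgue_integral lborel {0..1} (\<lambda>u. ?r (w + u)) = integral {0..1} (\<lambda>u. ?r (w + u))" by (rule unit_set_integral)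
      also have "\<dots> = integral {0..1} ?r" by (rule integral_periodic_shift[OF rc rp])
      also have "\<dots> = set_lebesgue_integral lborel {0..1} ?r" by (rule unit_set_integral[OF rc, symmetric])
      also have "\<dots> = q (- w)" unfolding q_def by (simp add: norm_minus_commute)
      finally show ?thesis unfolding e .
    qed
    then have "set_lebesgue_integral lborel ?S ?Y = set_lebesgue_integral lborel ?W (\<lambda>w. q (- w))"
      unfolding Fubini_strip(3)[OF cY] by (intro set_lebesgue_integral_cong) (auto simp: Wset_closed)
    also have "\<dots> = set_lebesgue_integral lborel ?W q" by (rule set_integral_reflect) (rule Wset_uminus)
    also have "\<dots> = set_lebesgue_integral lborel ?S ?Z" unfolding Fubini_strip(3)[OF cZ] q_def ..
    finally show ?thesis .
  qed
  have "closed ?S" by (intro closed_Times Wset_closed closed_atLeastAtMost)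
  then have Sm: "?S \<in> sets lborel" by (simp add: borel_closed)
  let ?dE = "\<lambda>x. dE_integrand \<alpha> \<gamma> h (fst x) (snd x)"
  have eq: "?dE x = weighted_Psi (fst x) (snd x) - ?X x - (?Y x - ?Z x)" if "x \<in> ?S" for x
    using weighted_Psi_eq[of "snd x" "fst x"] Wset_nz[OF \<epsilon>, of "snd x"] that by (auto simp: mem_Times_iff algebra_simps)
  have cd: "continuous_on ?S ?dE"
    by (rule continuous_on_eq[where f="\<lambda>x. weighted_Psi (fst x) (snd x) - ?X x - (?Y x - ?Z x)"])
       (intro continuous_on_diff sc cX cY cZ, simp add: eq)
  have "Ieps \<alpha> \<gamma> h \<epsilon> = set_lebesgue_integral lborel ?S ?dE"
    using Fubini_strip(2)[OF cd] unfolding Ieps_def Wset_def[symmetric] by simp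
  also have "\<dots> = set_lebesgue_integral lborel ?S (\<lambda>x. weighted_Psi (fst x) (snd x) - ?X x - (?Y x - ?Z x))"
    by (rule set_lebesgue_integral_cong[OF Sm]) (use eq in blast)
  also have "\<dots> = set_lebesgue_integral lborel ?S (\<lambda>x. weighted_Psi (fst x) (snd x)) - set_lebesgue_integral lborel ?S ?X
      - (set_lebesgue_integral lborel ?S ?Y - set_lebesgue_integral lborel ?S ?Z)"
    by (simp only: set_integral_diff(2) set_integral_diff(1) Fubini_strip(1)[OF sc(6)] Fubini_strip(1)[OF cX] Fubini_strip(1)[OF cY] Fubini_strip(1)[OF cZ])
  finally show ?thesis unfolding X0 YZ by simp
qed

text \<open>Dominated convergence: the truncated integrals are those of the weighted
  \<open>Psi\<close>, which is absolutely integrable on the full box and serves as its own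
  majorant.\<close>

lemma Ieps_tendsto:
  assumes I: "wintegrable \<alpha> (\<lambda>u w. Psi \<alpha> (seg g u w) (seg k u w))"
  shows "((\<lambda>\<epsilon>. Ieps \<alpha> \<gamma> h \<epsilon>) \<longlongrightarrow> DEg \<alpha> g k) (at_right 0)"
proof -
  let ?f = "\<lambda>x. indicator bx x *\<^sub>R weighted_Psi (fst x) (snd x)"
  have int: "integrable lborel ?f" using I unfolding wintegrable_def set_integrable_def .
  have D: "DEg \<alpha> g k = integral\<^sup>L lborel ?f"
    unfolding DEg_def wint_def drho_arc by (simp add: set_lebesgue_integral_def)
  show ?thesis unfolding D tendsto_at_iff_sequentially
  proof (intro allI impI)
    fix X :: "nat \<Rightarrow> real" assume X: "\<forall>i. X i \<in> {0<..} - {0}" "X \<longlonglongrightarrow> 0"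
    let ?s = "\<lambda>i x. indicator ({0..1::real} \<times> Wset (X i)) x *\<^sub>R weighted_Psi (fst x) (snd x)"
    have "(\<lambda>i. integral\<^sup>L lborel (?s i)) \<longlonglongrightarrow> integral\<^sup>L lborel ?f"
    proof (rule integral_dominated_convergence[where w="\<lambda>x. norm (?f x)"])
      show "?f \<in> borel_measurable lborel" using int by simp
      show "integrable lborel (\<lambda>x. norm (?f x))" using int by simp
      show "?s i \<in> borel_measurable lborel" for i
        using Fubini_strip(1)[OF strip_cont(6)[of "X i"]] X(1) by (simp add: set_integrable_def)
      have sub: "{0..1::real} \<times> Wset (X i) \<subseteq> bx" for i using Wset_nz[of "X i"] X(1) by (auto simp: bx_def)
      show "AE x in lborel. norm (?s i x) \<le> norm (?f x)" for i
        using sub[of i] by (intro AE_I2) (auto simp: indicator_def)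
      show "AE x in lborel. (\<lambda>i. ?s i x) \<longlonglongrightarrow> ?f x"
      proof (rule AE_I2)
        fix x :: "real \<times> real"
        show "(\<lambda>i. ?s i x) \<longlonglongrightarrow> ?f x"
        proof (cases "snd x = 0 \<or> x \<notin> bx")
          case True
          \<comment> \<open>On the line \<open>w = 0\<close>, missed by every strip, the integrand
            is zero because \<open>0 powr (-\<alpha>)\<close> is 0.\<close>
          then have z: "?f x = 0" "?s i x = 0" for i using sub[of i] by (auto simp: indicator_def)
          show ?thesis by (simp only: z tendsto_const)
        next
          case False
          then have "\<forall>\<^sub>F i in sequentially. X i < \<bar>snd x\<bar>" using X(2) by (intro order_tendstoD) auto
          then have "\<forall>\<^sub>F i in sequentially. ?s i x = ?f x"
          proof eventually_elim
            case (elim i)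
            then have "x \<in> {0..1::real} \<times> Wset (X i)" using False by (auto simp: bx_def Wset_def mem_Times_iff)
            then show ?case using False by (simp add: indicator_def)
          qed
          then show ?thesis by (rule tendsto_eventually)
        qed
      qed
    qed
    moreover have "integral\<^sup>L lborel (?s i) = Ieps \<alpha> \<gamma> h (X i)" for i
      using strip_integral[of "X i"] X(1) by (simp add: set_lebesgue_integral_def)
    ultimately show "((\<lambda>\<epsilon>. Ieps \<alpha> \<gamma> h \<epsilon>) \<circ> X) \<longlonglongrightarrow> integral\<^sup>L lborel ?f" by (simp add: o_def)
  qed
qed

end

section \<open>Continuous differentiability\<close>

text \<open>The estimates ask for a positive size \<open>\<kappa>\<close> of the direction, whereas
  its Sobolev norm may vanish. They are applied to every larger \<open>\<kappa>\<close>, and the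
  bound passes to the infimum.\<close>

lemma bound_at_infimum:
  fixes x A m b :: real
  assumes "0 \<le> A" "m < b" "\<And>\<kappa>. m < \<kappa> \<Longrightarrow> \<kappa> < b \<Longrightarrow> x \<le> A * \<kappa>"
  shows "x \<le> A * m"
proof (cases "A = 0")
  case True
  then show ?thesis using dense[OF assms(2)] assms(3) by auto
next
  case False
  then have A: "0 < A" using assms(1) by simp
  have "x / A \<le> m"
    by (rule dense_ge_bounded[OF assms(2)]) (use assms(3) A in \<open>simp add: field_simps\<close>)
  then show ?thesis using A by (simp add: field_simps)
qed

lemma gagliardo_0: "gagliardo \<sigma> (\<lambda>_. 0 :: real^'n) = 0"
  by (simp add: gagliardo_def)

lemma Hsob_diff:
  fixes f h :: "real \<Rightarrow> real^'n"
  assumes "2 < \<alpha>" "Hsob ((\<alpha> - 1) / 2) f" "Hsob ((\<alpha> - 1) / 2) h"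
  shows "Hsob ((\<alpha> - 1) / 2) (\<lambda>x. f x - h x)" "vd (\<lambda>x. f x - h x) = (\<lambda>x. vd f x - vd h x)"
  using Hsob_add_scaleR[OF assms, of "-1"] by simp_all

lemma Hsob_add:
  fixes f h :: "real \<Rightarrow> real^'n"
  assumes "2 < \<alpha>" "Hsob ((\<alpha> - 1) / 2) f" "Hsob ((\<alpha> - 1) / 2) h"
  shows "Hsob ((\<alpha> - 1) / 2) (\<lambda>x. f x + h x)" "vd (\<lambda>x. f x + h x) = (\<lambda>x. vd f x + vd h x)"
  using Hsob_add_scaleR[OF assms, of 1] by simp_all

text \<open>As \<open>emb \<alpha>\<close> is at least 1, a single number controls both the sup norm
  of the derivative and its seminorm.\<close>

lemma Hsob_size:
  fixes f :: "real \<Rightarrow> real^'n"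
  assumes \<alpha>: "2 < \<alpha>" and f: "Hsob ((\<alpha> - 1) / 2) f" and \<kappa>: "emb \<alpha> * Hnorm ((\<alpha> - 1) / 2) f \<le> \<kappa>"
  shows "norm (vd f u) \<le> \<kappa>" "gagliardo ((\<alpha> - 1) / 2) (vd f) \<le> ennreal (\<kappa>\<^sup>2)"
proof -
  note F = Hsob_C1[OF \<alpha> f]
  show "norm (vd f u) \<le> \<kappa>" using F(6)[of u] \<kappa> by simp
  have "1 * Hnorm ((\<alpha> - 1) / 2) f \<le> emb \<alpha> * Hnorm ((\<alpha> - 1) / 2) f"
    using emb_ge[OF \<alpha>] F(5) by (intro mult_right_mono) auto
  then have "(Hnorm ((\<alpha> - 1) / 2) f)\<^sup>2 \<le> \<kappa>\<^sup>2" using F(5) \<kappa> by (intro power_mono) auto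
  then show "gagliardo ((\<alpha> - 1) / 2) (vd f) \<le> ennreal (\<kappa>\<^sup>2)" using F(4) ennreal_leI order_trans by blast
qed

lemma admissible_nice:
  fixes \<gamma> :: "real \<Rightarrow> real^'n"
  assumes \<alpha>: "2 < \<alpha>" and a: "admissible ((\<alpha> - 1) / 2) \<gamma>"
  obtains c C \<Gamma> where "0 < c" "c \<le> 1" "c \<le> C" "0 \<le> \<Gamma>" "gagliardo ((\<alpha> - 1) / 2) (vd \<gamma>) \<le> ennreal \<Gamma>" "nice c C (vd \<gamma>)"
    "\<And>g. continuous_on UNIV g \<Longrightarrow> periodic1 g \<Longrightarrow> (\<And>u. norm (g u - vd \<gamma> u) \<le> c) \<Longrightarrow> nice c C g"
proof -
  obtain c0 where c0: "0 < c0" "nondeg c0 (vd \<gamma>)" by (rule admissible_imp_nondeg[OF \<alpha> a])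
  have H: "Hsob ((\<alpha> - 1) / 2) \<gamma>" using a by (simp add: admissible_def)
  note F = Hsob_C1[OF \<alpha> H]
  \<comment> \<open>Halving leaves room: perturbations of size \<open>c\<close> keep the
    nondegeneracy constant at least \<open>c\<close>. The cap at 1 secures the condition
    \<open>\<nu> \<le> 1\<close>.\<close>
  define c where "c = min (c0 / 2) 1"
  define C where "C = emb \<alpha> * Hnorm ((\<alpha> - 1) / 2) \<gamma> + c"
  have c: "0 < c" "c \<le> 1" "c \<le> c0 - c" using c0 by (auto simp: c_def)
  have key: "nice c C g" if g: "continuous_on UNIV g" "periodic1 g" "\<And>u. norm (g u - vd \<gamma> u) \<le> c" for g
  proof -
    have "nondeg (c0 - c) g" by (rule nondeg_perturb[OF c0(2) F(2) g(1,3)])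
    then have "nondeg c g" using c(3) unfolding nondeg_def by (meson order_trans)
    moreover have "norm (g u) \<le> C" for u
      using norm_triangle_sub[of "g u" "vd \<gamma> u"] g(3)[of u] F(6)[of u] by (simp add: C_def)
    ultimately show ?thesis using g by (simp add: nice_def)
  qed
  have n: "nice c C (vd \<gamma>)" by (rule key[OF F(2,3)]) (use c in simp)
  show ?thesis
    by (rule that[OF c(1,2) niceD(6)[OF n] _ F(4) n key]) auto
qed

text \<open>The estimates for velocities, restated in Sobolev norms of curves. Multiplying a norm by
  \<open>emb \<alpha>\<close> gives an admissible size \<open>\<nu>\<close> or
  \<open>\<kappa>\<close> for \<open>curve_data\<close>.\<close>

lemma near_curve:
  fixes \<gamma> :: "real \<Rightarrow> real^'n"
  assumes \<alpha>: "2 < \<alpha>" and a: "admissible ((\<alpha> - 1) / 2) \<gamma>"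
  obtains c K where "0 < c" "c \<le> 1" "0 \<le> K"
    "\<And>\<eta>. Hsob ((\<alpha> - 1) / 2) \<eta> \<Longrightarrow> emb \<alpha> * Hnorm ((\<alpha> - 1) / 2) (\<lambda>x. \<eta> x - \<gamma> x) \<le> c \<Longrightarrow> admissible ((\<alpha> - 1) / 2) \<eta>"
    "OHara \<alpha> \<gamma> < \<infinity>"
    "\<And>h. Hsob ((\<alpha> - 1) / 2) h \<Longrightarrow> wintegrable \<alpha> (\<lambda>u w. Psi \<alpha> (seg (vd \<gamma>) u w) (seg (vd h) u w))"
    "\<And>h. Hsob ((\<alpha> - 1) / 2) h \<Longrightarrow> \<bar>DEg \<alpha> (vd \<gamma>) (vd h)\<bar> \<le> K * Hnorm ((\<alpha> - 1) / 2) h"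
    "\<And>\<eta> h \<nu>. admissible ((\<alpha> - 1) / 2) \<eta> \<Longrightarrow> Hsob ((\<alpha> - 1) / 2) h \<Longrightarrow> 0 < \<nu> \<Longrightarrow> \<nu> \<le> c \<Longrightarrow>
       emb \<alpha> * Hnorm ((\<alpha> - 1) / 2) (\<lambda>x. \<eta> x - \<gamma> x) \<le> \<nu> \<Longrightarrow>
       \<bar>DEg \<alpha> (vd \<eta>) (vd h) - DEg \<alpha> (vd \<gamma>) (vd h)\<bar> \<le> K * \<nu> * Hnorm ((\<alpha> - 1) / 2) h"
    "\<And>h \<nu>. Hsob ((\<alpha> - 1) / 2) h \<Longrightarrow> 0 < \<nu> \<Longrightarrow> \<nu> \<le> c \<Longrightarrow> emb \<alpha> * Hnorm ((\<alpha> - 1) / 2) h < \<nu> \<Longrightarrow>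
       \<bar>enn2real (OHara \<alpha> (\<lambda>x. \<gamma> x + h x)) - enn2real (OHara \<alpha> \<gamma>) - DEg \<alpha> (vd \<gamma>) (vd h)\<bar> \<le> K * \<nu> * Hnorm ((\<alpha> - 1) / 2) h"
proof -
  let ?\<sigma> = "(\<alpha> - 1) / 2"
  obtain c C \<Gamma> where c: "0 < c" "c \<le> 1" "c \<le> C" and \<Gamma>: "0 \<le> \<Gamma>" "gagliardo ?\<sigma> (vd \<gamma>) \<le> ennreal \<Gamma>" and n: "nice c C (vd \<gamma>)"
    and key: "\<And>g. continuous_on UNIV g \<Longrightarrow> periodic1 g \<Longrightarrow> (\<And>u. norm (g u - vd \<gamma> u) \<le> c) \<Longrightarrow> nice c C g"
    using admissible_nice[OF \<alpha> a] by metis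
  have H: "Hsob ?\<sigma> \<gamma>" and per: "periodic1 \<gamma>" using a by (auto simp: admissible_def Hsob_def)
  note F = Hsob_C1[OF \<alpha> H]
  show ?thesis
  proof (rule energy_estimates[OF c(1,3) \<alpha>])
  fix K0 :: real assume K0: "0 \<le> K0"
    and Kphi: "\<And>\<Gamma> g g' \<nu> \<kappa> (k :: real \<Rightarrow> real^'n). curve_data \<alpha> c C \<Gamma> g g' k \<nu> \<kappa> \<Longrightarrow> wintegrable \<alpha> (\<lambda>u w. Phi \<alpha> (seg g u w))"
    and Kpsi: "\<And>\<Gamma> g g' \<nu> \<kappa> (k :: real \<Rightarrow> real^'n). curve_data \<alpha> c C \<Gamma> g g' k \<nu> \<kappa> \<Longrightarrow> wintegrable \<alpha> (\<lambda>u w. Psi \<alpha> (seg g u w) (seg k u w))"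
    and Kb: "\<And>\<Gamma> g g' \<nu> \<kappa> (k :: real \<Rightarrow> real^'n). curve_data \<alpha> c C \<Gamma> g g' k \<nu> \<kappa> \<Longrightarrow> \<bar>DEg \<alpha> g k\<bar> \<le> K0 * (\<Gamma> + 3) * \<kappa>"
    and Kc: "\<And>\<Gamma> g g' \<nu> \<kappa> (k :: real \<Rightarrow> real^'n). curve_data \<alpha> c C \<Gamma> g g' k \<nu> \<kappa> \<Longrightarrow> \<bar>DEg \<alpha> g' k - DEg \<alpha> g k\<bar> \<le> K0 * (\<Gamma> + 3) * (\<nu> * \<kappa>)"
    and Kf: "\<And>\<Gamma> g \<kappa> (k :: real \<Rightarrow> real^'n). curve_data \<alpha> c C \<Gamma> g (\<lambda>u. g u + k u) k \<kappa> \<kappa> \<Longrightarrow>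
       (\<And>t. t \<in> {0..1} \<Longrightarrow> nice c C (\<lambda>u. g u + t *\<^sub>R k u)) \<Longrightarrow> wintegrable \<alpha> (\<lambda>u w. Phi \<alpha> (seg (\<lambda>u. g u + k u) u w)) \<Longrightarrow>
       \<bar>Eg \<alpha> (\<lambda>u. g u + k u) - Eg \<alpha> g - DEg \<alpha> g k\<bar> \<le> K0 * (\<Gamma> + 3) * (\<kappa> * \<kappa>)"
  define K1 where "K1 = K0 * (\<Gamma> + 3)"
  have K1: "0 \<le> K1" using K0 \<Gamma> by (simp add: K1_def)
  define K where "K = K1 * emb \<alpha>"
  have e0: "0 < emb \<alpha>" using emb_ge[OF \<alpha>] by simp
  have K: "0 \<le> K" using K1 e0 by (simp add: K_def)
  have nu: "nice c C (vd \<eta>)" if "Hsob ?\<sigma> \<eta>" "emb \<alpha> * Hnorm ?\<sigma> (\<lambda>x. \<eta> x - \<gamma> x) \<le> c" for \<eta>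
  proof (rule key)
    show "continuous_on UNIV (vd \<eta>)" "periodic1 (vd \<eta>)" using Hsob_C1[OF \<alpha> that(1)] by auto
    show "norm (vd \<eta> u - vd \<gamma> u) \<le> c" for u
      using Hsob_size(1)[OF \<alpha> Hsob_diff(1)[OF \<alpha> that(1) H] that(2), of u] fun_cong[OF Hsob_diff(2)[OF \<alpha> that(1) H], of u] by simp
  qed
  \<comment> \<open>For statements about a single curve, the comparison curve is the curve itself
    and the direction is zero, so that any positive sizes will do.\<close>
  have cd0: "curve_data \<alpha> c C G g g (\<lambda>_. 0 :: real^'n) 1 1" if "nice c C g" "0 \<le> G" "gagliardo ?\<sigma> g \<le> ennreal G" for g G
    using that c by (simp add: curve_data_def gagliardo_0)
  have ohara: "OHara \<alpha> \<eta> < \<infinity> \<and> enn2real (OHara \<alpha> \<eta>) = Eg \<alpha> (vd \<eta>)" and wphi: "wintegrable \<alpha> (\<lambda>u w. Phi \<alpha> (seg (vd \<eta>) u w))"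
    if "Hsob ?\<sigma> \<eta>" "nice c C (vd \<eta>)" for \<eta> :: "real \<Rightarrow> real^'n"
  proof -
    note G = Hsob_C1[OF \<alpha> that(1)]
    show I: "wintegrable \<alpha> (\<lambda>u w. Phi \<alpha> (seg (vd \<eta>) u w))" by (rule Kphi[OF cd0[OF that(2) _ G(4)]]) simp
    have p: "periodic1 \<eta>" "1 < \<alpha>" using that(1) \<alpha> by (auto simp: Hsob_def)
    show "OHara \<alpha> \<eta> < \<infinity> \<and> enn2real (OHara \<alpha> \<eta>) = Eg \<alpha> (vd \<eta>)"
      using OHara_eq[OF c(1) that(2) G(1) p I] by blast
  qed
  \<comment> \<open>The base curve is always \<open>\<gamma>\<close>, with its fixed
    \<open>\<Gamma>\<close>; the curve \<open>\<eta>\<close> enters only through its distance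
    \<open>\<nu>\<close>, which keeps the constant independent of it.\<close>
  have cd: "curve_data \<alpha> c C \<Gamma> (vd \<gamma>) (vd \<eta>) (vd h) \<nu> \<kappa>"
    if "Hsob ?\<sigma> \<eta>" "Hsob ?\<sigma> h" "0 < \<nu>" "\<nu> \<le> c" "emb \<alpha> * Hnorm ?\<sigma> (\<lambda>x. \<eta> x - \<gamma> x) \<le> \<nu>" "emb \<alpha> * Hnorm ?\<sigma> h < \<kappa>" for \<eta> h :: "real \<Rightarrow> real^'n" and \<nu> \<kappa>
  proof -
    have k0: "0 < \<kappa>" using that(6) e0 Hsob_C1(5)[OF \<alpha> that(2)] mult_nonneg_nonneg[of "emb \<alpha>" "Hnorm ?\<sigma> h"] by linarith
    note d = Hsob_diff[OF \<alpha> that(1) H]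
    have 1: "norm (vd \<eta> u - vd \<gamma> u) \<le> \<nu>" for u
      using Hsob_size(1)[OF \<alpha> d(1) that(5), of u] fun_cong[OF d(2), of u] by simp
    have 2: "gagliardo ?\<sigma> (\<lambda>u. vd \<eta> u - vd \<gamma> u) \<le> ennreal (\<nu>\<^sup>2)"
      using Hsob_size(2)[OF \<alpha> d(1) that(5)] unfolding d(2) .
    have 3: "nice c C (vd \<eta>)" using that by (intro nu) auto
    have 4: "norm (vd h u) \<le> \<kappa>" "gagliardo ?\<sigma> (vd h) \<le> ennreal (\<kappa>\<^sup>2)" for u
      using Hsob_size[OF \<alpha> that(2)] that(6) by (simp_all add: less_imp_le)
    show ?thesis unfolding curve_data_def using that(3,4) c(2) k0 n \<Gamma> 1 2 3 4 Hsob_C1(2)[OF \<alpha> that(2)] by auto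
  qed
  \<comment> \<open>That the zero function has norm zero is not immediate, since \<open>SOME\<close>
    may select any of its weak derivatives; uniqueness almost everywhere settles it.\<close>
  have self: "emb \<alpha> * Hnorm ?\<sigma> (\<lambda>x. \<gamma> x - \<gamma> x) \<le> c"
  proof -
    have p0: "periodic1 (\<lambda>x. 0 :: real^'n)" by (simp add: periodic1_def)
    have w0: "weak_deriv (\<lambda>x. 0 :: real^'n) (\<lambda>x. 0)" by (rule C1_weak_deriv[OF p0]) auto
    define gs where "gs = (SOME g. weak_deriv (\<lambda>x. 0 :: real^'n) g)"
    have ws: "weak_deriv (\<lambda>x. 0) gs" unfolding gs_def by (rule someI[of "weak_deriv (\<lambda>x. 0)", OF w0])
    have ae: "AE x in lborel. gs x = 0" by (rule weak_deriv_unique_AE[OF ws, of "\<lambda>x. 0"]) auto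
    have "gagliardo ?\<sigma> gs = 0" using gagliardo_cong_AE[OF ae, of ?\<sigma>] gagliardo_0 by simp
    moreover have "set_lebesgue_integral lborel {0..1} (\<lambda>x. (norm (gs x))\<^sup>2) = 0"
    proof -
      have "AE x in lborel. indicator {0..1} x *\<^sub>R (norm (gs x))\<^sup>2 = 0" using ae by eventually_elim simp
      then show ?thesis unfolding set_lebesgue_integral_def by (rule integral_eq_zero_AE)
    qed
    ultimately have "Hnorm ?\<sigma> (\<lambda>x. 0 :: real^'n) = 0"
      unfolding Hnorm_def Let_def gs_def[symmetric] by (simp add: set_lebesgue_integral_def)
    then show ?thesis using c by simp
  qed
  show ?thesis
  proof (rule that[OF c(1,2) K])
    show "admissible ?\<sigma> \<eta>" if "Hsob ?\<sigma> \<eta>" "emb \<alpha> * Hnorm ?\<sigma> (\<lambda>x. \<eta> x - \<gamma> x) \<le> c" for \<eta>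
      by (rule nondeg_imp_admissible[OF \<alpha> that(1) c(1) niceD(3)[OF nu[OF that]]])
    show "OHara \<alpha> \<gamma> < \<infinity>" using ohara[OF H n] by blast
    fix h :: "real \<Rightarrow> real^'n" assume h: "Hsob ?\<sigma> h"
    note Hh = Hsob_C1[OF \<alpha> h]
    \<comment> \<open>Any number above the lower end serves as upper end in
      \<open>bound_at_infimum\<close>.\<close>
    have lt: "emb \<alpha> * Hnorm ?\<sigma> h < emb \<alpha> * Hnorm ?\<sigma> h + 1" by simp
    show "wintegrable \<alpha> (\<lambda>u w. Psi \<alpha> (seg (vd \<gamma>) u w) (seg (vd h) u w))"
      by (rule Kpsi[OF cd[OF H h c(1) order_refl self lt]])
    have "\<bar>DEg \<alpha> (vd \<gamma>) (vd h)\<bar> \<le> K1 * (emb \<alpha> * Hnorm ?\<sigma> h)"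
      by (rule bound_at_infimum[OF K1 lt]) (use Kb[OF cd[OF H h c(1) order_refl self]] in \<open>auto simp: K1_def\<close>)
    then show "\<bar>DEg \<alpha> (vd \<gamma>) (vd h)\<bar> \<le> K * Hnorm ?\<sigma> h" by (simp add: K_def mult.assoc)
    fix \<nu> :: real assume \<nu>: "0 < \<nu>" "\<nu> \<le> c"
    {
      fix \<eta> assume \<eta>: "admissible ?\<sigma> \<eta>" "emb \<alpha> * Hnorm ?\<sigma> (\<lambda>x. \<eta> x - \<gamma> x) \<le> \<nu>"
      then have H\<eta>: "Hsob ?\<sigma> \<eta>" by (simp add: admissible_def)
      have "\<bar>DEg \<alpha> (vd \<eta>) (vd h) - DEg \<alpha> (vd \<gamma>) (vd h)\<bar> \<le> (K1 * \<nu>) * (emb \<alpha> * Hnorm ?\<sigma> h)"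
      proof (rule bound_at_infimum[OF _ lt])
        show "0 \<le> K1 * \<nu>" using K1 \<nu> by simp
        fix \<kappa> assume k: "emb \<alpha> * Hnorm ?\<sigma> h < \<kappa>"
        show "\<bar>DEg \<alpha> (vd \<eta>) (vd h) - DEg \<alpha> (vd \<gamma>) (vd h)\<bar> \<le> K1 * \<nu> * \<kappa>"
          using Kc[OF cd[OF H\<eta> h \<nu> \<eta>(2) k]] by (simp add: K1_def mult.assoc)
      qed
      then show "\<bar>DEg \<alpha> (vd \<eta>) (vd h) - DEg \<alpha> (vd \<gamma>) (vd h)\<bar> \<le> K * \<nu> * Hnorm ?\<sigma> h"
        by (simp add: K_def mult_ac)
    }
    assume hn: "emb \<alpha> * Hnorm ?\<sigma> h < \<nu>"
    let ?\<eta> = "\<lambda>x. \<gamma> x + h x"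
    note s = Hsob_add[OF \<alpha> H h]
    have d: "(\<lambda>x. ?\<eta> x - \<gamma> x) = h" by simp
    have n\<eta>: "nice c C (vd ?\<eta>)" by (rule nu[OF s(1)]) (use hn \<nu> in \<open>simp add: d\<close>)
    have o: "enn2real (OHara \<alpha> ?\<eta>) = Eg \<alpha> (\<lambda>u. vd \<gamma> u + vd h u)" "enn2real (OHara \<alpha> \<gamma>) = Eg \<alpha> (vd \<gamma>)"
      using ohara[OF s(1) n\<eta>] ohara[OF H n] unfolding s(2) by blast+
    have "\<bar>Eg \<alpha> (\<lambda>u. vd \<gamma> u + vd h u) - Eg \<alpha> (vd \<gamma>) - DEg \<alpha> (vd \<gamma>) (vd h)\<bar> \<le> (K1 * \<nu>) * (emb \<alpha> * Hnorm ?\<sigma> h)"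
    proof (rule bound_at_infimum[OF _ hn])
      show "0 \<le> K1 * \<nu>" using K1 \<nu> by simp
      fix \<kappa> assume k: "emb \<alpha> * Hnorm ?\<sigma> h < \<kappa>" "\<kappa> < \<nu>"
      have k0: "0 < \<kappa>" using k(1) e0 Hh(5) mult_nonneg_nonneg[of "emb \<alpha>" "Hnorm ?\<sigma> h"] by linarith
      have kc: "\<kappa> \<le> c" using k \<nu> by simp
      have cdk: "curve_data \<alpha> c C \<Gamma> (vd \<gamma>) (\<lambda>u. vd \<gamma> u + vd h u) (vd h) \<kappa> \<kappa>"
        using cd[OF s(1) h k0 kc _ k(1)] k(1) unfolding d s(2) by simp
      have t: "nice c C (\<lambda>u. vd \<gamma> u + t *\<^sub>R vd h u)" if t: "t \<in> {0..1}" for t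
      proof (rule key)
        show "continuous_on UNIV (\<lambda>u. vd \<gamma> u + t *\<^sub>R vd h u)" by (intro continuous_intros F(2) Hh(2))
        show "periodic1 (\<lambda>u. vd \<gamma> u + t *\<^sub>R vd h u)" using F(3) Hh(3) by (simp add: periodic1_def)
        show "norm (vd \<gamma> u + t *\<^sub>R vd h u - vd \<gamma> u) \<le> c" for u
        proof -
          have "norm (vd h u) \<le> \<kappa>" using Hsob_size(1)[OF \<alpha> h] k(1) by simp
          then have "t * norm (vd h u) \<le> 1 * \<kappa>" using t by (intro mult_mono) auto
          then show ?thesis using t kc by simp
        qed
      qed
      have "\<bar>Eg \<alpha> (\<lambda>u. vd \<gamma> u + vd h u) - Eg \<alpha> (vd \<gamma>) - DEg \<alpha> (vd \<gamma>) (vd h)\<bar> \<le> K1 * (\<kappa> * \<kappa>)"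
        using Kf[OF cdk t] wphi[OF s(1) n\<eta>] unfolding s(2) K1_def by blast
      \<comment> \<open>One of the two factors \<open>\<kappa>\<close> is given up for
        \<open>\<nu>\<close>, so that the bound is linear in \<open>\<kappa>\<close> and its infimum
        can be taken.\<close>
      also have "\<dots> \<le> K1 * (\<nu> * \<kappa>)" using k k0 K1 by (intro mult_left_mono mult_right_mono) auto
      finally show "\<bar>Eg \<alpha> (\<lambda>u. vd \<gamma> u + vd h u) - Eg \<alpha> (vd \<gamma>) - DEg \<alpha> (vd \<gamma>) (vd h)\<bar> \<le> K1 * \<nu> * \<kappa>" by (simp add: mult.assoc)
    qed
    then show "\<bar>enn2real (OHara \<alpha> (\<lambda>x. \<gamma> x + h x)) - enn2real (OHara \<alpha> \<gamma>) - DEg \<alpha> (vd \<gamma>) (vd h)\<bar> \<le> K * \<nu> * Hnorm ?\<sigma> h"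
      unfolding o by (simp add: K_def mult_ac)
  qed
  qed
qed

lemma DEg_linear:
  fixes k1 k2 :: "real \<Rightarrow> real^'n"
  assumes c: "0 < c" and g: "nice c C g" and k: "continuous_on UNIV k1" "continuous_on UNIV k2"
    and I: "wintegrable \<alpha> (\<lambda>u w. Psi \<alpha> (seg g u w) (seg k1 u w))" "wintegrable \<alpha> (\<lambda>u w. Psi \<alpha> (seg g u w) (seg k2 u w))"
  shows "DEg \<alpha> g (\<lambda>x. k1 x + a *\<^sub>R k2 x) = DEg \<alpha> g k1 + a * DEg \<alpha> g k2"
proof -
  have s: "seg (\<lambda>x. k1 x + a *\<^sub>R k2 x) u w = (\<lambda>s. seg k1 u w s + a *\<^sub>R seg k2 u w s)" for u w
    by (simp add: seg_line)
  have nz: "seg g u w s \<noteq> 0" for u w s using nice_nz[OF c g] by (simp add: seg_def)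
  note gc = seg_continuous[OF niceD(1)[OF g]] and kc = seg_continuous[OF k(1)] seg_continuous[OF k(2)]
  have P: "Psi \<alpha> (seg g u w) (seg (\<lambda>x. k1 x + a *\<^sub>R k2 x) u w) = Psi \<alpha> (seg g u w) (seg k1 u w) + a * Psi \<alpha> (seg g u w) (seg k2 u w)" for u w
    unfolding s by (rule Psi_add_scaleR[OF gc nz kc])
  have R: "drho \<alpha> (seg g u w) (seg (\<lambda>x. k1 x + a *\<^sub>R k2 x) u w) = drho \<alpha> (seg g u w) (seg k1 u w) + a * drho \<alpha> (seg g u w) (seg k2 u w)" for u w
    unfolding s by (rule drho_add_scaleR[OF gc nz kc])
  have i1: "set_integrable lborel {0..1} (\<lambda>u. drho \<alpha> (seg g u 1) (seg k1 u 1))"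
    and i2: "set_integrable lborel {0..1} (\<lambda>u. a * drho \<alpha> (seg g u 1) (seg k2 u 1))"
    by (intro borel_integrable_atLeastAtMost' continuous_on_mult_left drho_seg_continuous[OF c g] k)+
  show ?thesis unfolding DEg_def P R wint_add[OF I] set_integral_add(2)[OF i1 i2] by (simp add: algebra_simps)
qed

theorem theorem1p1:
  fixes \<alpha> :: real
  assumes "2 < \<alpha>" and "\<alpha> < 3"
  shows
   "(\<forall>\<gamma>::real \<Rightarrow> real^'n. admissible ((\<alpha> - 1) / 2) \<gamma> \<longrightarrow>
        (\<exists>\<delta>>0. \<forall>\<eta>. Hsob ((\<alpha> - 1) / 2) \<eta> \<and> Hnorm ((\<alpha> - 1) / 2) (\<lambda>x. \<eta> x - \<gamma> x) < \<delta>
                 \<longrightarrow> admissible ((\<alpha> - 1) / 2) \<eta>))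
    \<and> (\<forall>\<gamma>::real \<Rightarrow> real^'n. admissible ((\<alpha> - 1) / 2) \<gamma> \<longrightarrow> OHara \<alpha> \<gamma> < \<infinity>)
    \<and> (\<exists>DE :: (real \<Rightarrow> real^'n) \<Rightarrow> (real \<Rightarrow> real^'n) \<Rightarrow> real.
        \<forall>\<gamma>. admissible ((\<alpha> - 1) / 2) \<gamma> \<longrightarrow>
          (\<forall>h1 h2 c. Hsob ((\<alpha> - 1) / 2) h1 \<and> Hsob ((\<alpha> - 1) / 2) h2 \<longrightarrow>
              DE \<gamma> (\<lambda>x. h1 x + c *\<^sub>R h2 x) = DE \<gamma> h1 + c * DE \<gamma> h2)
        \<and> (\<exists>C. \<forall>h. Hsob ((\<alpha> - 1) / 2) h \<longrightarrow> \<bar>DE \<gamma> h\<bar> \<le> C * Hnorm ((\<alpha> - 1) / 2) h)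
        \<and> (\<forall>e>0. \<exists>\<delta>>0. \<forall>h. Hsob ((\<alpha> - 1) / 2) h \<and> Hnorm ((\<alpha> - 1) / 2) h < \<delta> \<longrightarrow>
              \<bar>enn2real (OHara \<alpha> (\<lambda>x. \<gamma> x + h x)) - enn2real (OHara \<alpha> \<gamma>) - DE \<gamma> h\<bar>
                \<le> e * Hnorm ((\<alpha> - 1) / 2) h)
        \<and> (\<forall>e>0. \<exists>\<delta>>0. \<forall>\<eta>. admissible ((\<alpha> - 1) / 2) \<eta> \<and>
              Hnorm ((\<alpha> - 1) / 2) (\<lambda>x. \<eta> x - \<gamma> x) < \<delta> \<longrightarrow>
              (\<forall>h. Hsob ((\<alpha> - 1) / 2) h \<longrightarrow>
                 \<bar>DE \<eta> h - DE \<gamma> h\<bar> \<le> e * Hnorm ((\<alpha> - 1) / 2) h))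
        \<and> ((\<forall>u. norm (vector_derivative \<gamma> (at u)) = 1) \<longrightarrow>
            (\<forall>h. Hsob ((\<alpha> - 1) / 2) h \<longrightarrow>
               ((\<lambda>\<epsilon>. Ieps \<alpha> \<gamma> h \<epsilon>) \<longlongrightarrow> DE \<gamma> h) (at_right 0))))"
   (is "_ \<and> _ \<and> (\<exists>DE. \<forall>\<gamma>. _ \<gamma> \<longrightarrow> ?P DE \<gamma>)")
proof -
  let ?\<sigma> = "(\<alpha> - 1) / 2"
  note \<alpha> = assms(1)
  have e0: "0 < emb \<alpha>" using emb_ge[OF \<alpha>] by simp
  have small: "\<exists>\<delta>>0. \<exists>\<nu>>0. \<nu> \<le> c \<and> K * \<nu> \<le> e \<and> (\<forall>x<\<delta>. emb \<alpha> * x < \<nu>)" if "0 < c" "0 \<le> K" "0 < e" for c K e :: real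
  proof -
    \<comment> \<open>The \<open>1\<close> added to \<open>K\<close> avoids a division by
      zero.\<close>
    define \<nu> where "\<nu> = min c (e / (K + 1))"
    have \<nu>: "0 < \<nu>" "\<nu> \<le> c" using that by (auto simp: \<nu>_def)
    have "K * \<nu> \<le> (K + 1) * (e / (K + 1))" using that \<nu> by (intro mult_mono) (auto simp: \<nu>_def)
    then have "K * \<nu> \<le> e" using that by simp
    moreover have "emb \<alpha> * x < \<nu>" if "x < \<nu> / emb \<alpha>" for x using that e0 by (simp add: field_simps)
    ultimately show ?thesis using \<nu> e0 by (intro exI[of _ "\<nu> / emb \<alpha>"] conjI exI[of _ \<nu>]) auto
  qed
  \<comment> \<open>One function for all base curves, since the continuity statement compares
    derivatives at different curves.\<close>
  define DE where "DE \<gamma> h = DEg \<alpha> (vd \<gamma>) (vd h)" for \<gamma> h :: "real \<Rightarrow> real^'n"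
  have main: "(\<exists>\<delta>>0. \<forall>\<eta>. Hsob ?\<sigma> \<eta> \<and> Hnorm ?\<sigma> (\<lambda>x. \<eta> x - \<gamma> x) < \<delta> \<longrightarrow> admissible ?\<sigma> \<eta>) \<and>
     OHara \<alpha> \<gamma> < \<infinity> \<and> ?P DE \<gamma>"
    if a: "admissible ?\<sigma> \<gamma>" for \<gamma> :: "real \<Rightarrow> real^'n"
  proof -
    obtain c K where c: "0 < c" "c \<le> 1" and K: "0 \<le> K"
      and op: "\<And>\<eta>. Hsob ?\<sigma> \<eta> \<Longrightarrow> emb \<alpha> * Hnorm ?\<sigma> (\<lambda>x. \<eta> x - \<gamma> x) \<le> c \<Longrightarrow> admissible ?\<sigma> \<eta>"
      and fin: "OHara \<alpha> \<gamma> < \<infinity>"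
      and wi: "\<And>h. Hsob ?\<sigma> h \<Longrightarrow> wintegrable \<alpha> (\<lambda>u w. Psi \<alpha> (seg (vd \<gamma>) u w) (seg (vd h) u w))"
      and bd: "\<And>h. Hsob ?\<sigma> h \<Longrightarrow> \<bar>DEg \<alpha> (vd \<gamma>) (vd h)\<bar> \<le> K * Hnorm ?\<sigma> h"
      and ct: "\<And>\<eta> h \<nu>. admissible ?\<sigma> \<eta> \<Longrightarrow> Hsob ?\<sigma> h \<Longrightarrow> 0 < \<nu> \<Longrightarrow> \<nu> \<le> c \<Longrightarrow>
         emb \<alpha> * Hnorm ?\<sigma> (\<lambda>x. \<eta> x - \<gamma> x) \<le> \<nu> \<Longrightarrow>
         \<bar>DEg \<alpha> (vd \<eta>) (vd h) - DEg \<alpha> (vd \<gamma>) (vd h)\<bar> \<le> K * \<nu> * Hnorm ?\<sigma> h"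
      and fr: "\<And>h \<nu>. Hsob ?\<sigma> h \<Longrightarrow> 0 < \<nu> \<Longrightarrow> \<nu> \<le> c \<Longrightarrow> emb \<alpha> * Hnorm ?\<sigma> h < \<nu> \<Longrightarrow>
         \<bar>enn2real (OHara \<alpha> (\<lambda>x. \<gamma> x + h x)) - enn2real (OHara \<alpha> \<gamma>) - DEg \<alpha> (vd \<gamma>) (vd h)\<bar> \<le> K * \<nu> * Hnorm ?\<sigma> h"
      by (rule near_curve[OF \<alpha> a]) (rule that; blast)
    have H: "Hsob ?\<sigma> \<gamma>" using a by (simp add: admissible_def)
    note F = Hsob_C1[OF \<alpha> H]
    obtain c' C' where n: "0 < c'" "nice c' C' (vd \<gamma>)" using admissible_nice[OF \<alpha> a] by metis
    have weaken: "K * \<nu> * Hnorm ?\<sigma> h \<le> e * Hnorm ?\<sigma> h" if "K * \<nu> \<le> e" "Hsob ?\<sigma> h" for \<nu> e h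
      using that Hsob_C1(5)[OF \<alpha> that(2)] by (intro mult_right_mono) auto
    show ?thesis
    proof (intro conjI allI impI fin)
      obtain \<delta> \<nu> where d: "\<delta> > 0" "\<nu> \<le> c" "\<forall>x<\<delta>. emb \<alpha> * x < \<nu>" using small[OF c(1) K, of 1] by auto
      show "\<exists>\<delta>>0. \<forall>\<eta>. Hsob ?\<sigma> \<eta> \<and> Hnorm ?\<sigma> (\<lambda>x. \<eta> x - \<gamma> x) < \<delta> \<longrightarrow> admissible ?\<sigma> \<eta>"
      proof (intro exI[of _ \<delta>] conjI d(1) allI impI)
        fix \<eta> assume \<eta>: "Hsob ?\<sigma> \<eta> \<and> Hnorm ?\<sigma> (\<lambda>x. \<eta> x - \<gamma> x) < \<delta>"
        with d(3) have "emb \<alpha> * Hnorm ?\<sigma> (\<lambda>x. \<eta> x - \<gamma> x) < \<nu>" by blast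
        with d(2) \<eta> show "admissible ?\<sigma> \<eta>" by (intro op) auto
      qed
    next
      fix h1 h2 :: "real \<Rightarrow> real^'n" and r :: real assume h: "Hsob ?\<sigma> h1 \<and> Hsob ?\<sigma> h2"
      then show "DE \<gamma> (\<lambda>x. h1 x + r *\<^sub>R h2 x) = DE \<gamma> h1 + r * DE \<gamma> h2"
        unfolding DE_def Hsob_add_scaleR(2)[OF \<alpha> conjunct1[OF h] conjunct2[OF h]]
        by (intro DEg_linear[OF n] wi Hsob_C1(2)[OF \<alpha>]) auto
    next
      show "\<exists>C. \<forall>h. Hsob ?\<sigma> h \<longrightarrow> \<bar>DE \<gamma> h\<bar> \<le> C * Hnorm ?\<sigma> h" unfolding DE_def using bd by blast
    next
      fix e :: real assume "0 < e"
      then obtain \<delta> \<nu> where d: "\<delta> > 0" "\<nu> > 0" "\<nu> \<le> c" "K * \<nu> \<le> e" "\<forall>x<\<delta>. emb \<alpha> * x < \<nu>" using small[OF c(1) K, of e] by auto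
      show "\<exists>\<delta>>0. \<forall>h. Hsob ?\<sigma> h \<and> Hnorm ?\<sigma> h < \<delta> \<longrightarrow>
        \<bar>enn2real (OHara \<alpha> (\<lambda>x. \<gamma> x + h x)) - enn2real (OHara \<alpha> \<gamma>) - DE \<gamma> h\<bar> \<le> e * Hnorm ?\<sigma> h"
        unfolding DE_def
      proof (intro exI[of _ \<delta>] conjI d(1) allI impI)
        fix h :: "real \<Rightarrow> real^'n" assume h: "Hsob ?\<sigma> h \<and> Hnorm ?\<sigma> h < \<delta>"
        show "\<bar>enn2real (OHara \<alpha> (\<lambda>x. \<gamma> x + h x)) - enn2real (OHara \<alpha> \<gamma>) - DEg \<alpha> (vd \<gamma>) (vd h)\<bar> \<le> e * Hnorm ?\<sigma> h"
          by (rule order_trans[OF fr weaken]) (use h d in auto)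
      qed
      show "\<exists>\<delta>>0. \<forall>\<eta>. admissible ?\<sigma> \<eta> \<and> Hnorm ?\<sigma> (\<lambda>x. \<eta> x - \<gamma> x) < \<delta> \<longrightarrow>
        (\<forall>h. Hsob ?\<sigma> h \<longrightarrow> \<bar>DE \<eta> h - DE \<gamma> h\<bar> \<le> e * Hnorm ?\<sigma> h)"
        unfolding DE_def
      proof (intro exI[of _ \<delta>] conjI d(1) allI impI)
        fix \<eta> h :: "real \<Rightarrow> real^'n" assume \<eta>: "admissible ?\<sigma> \<eta> \<and> Hnorm ?\<sigma> (\<lambda>x. \<eta> x - \<gamma> x) < \<delta>" and h: "Hsob ?\<sigma> h"
        have "emb \<alpha> * Hnorm ?\<sigma> (\<lambda>x. \<eta> x - \<gamma> x) \<le> \<nu>" using d(5) \<eta> by (simp add: less_imp_le)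
        from order_trans[OF ct[OF conjunct1[OF \<eta>] h d(2,3) this] weaken[OF d(4) h]]
        show "\<bar>DEg \<alpha> (vd \<eta>) (vd h) - DEg \<alpha> (vd \<gamma>) (vd h)\<bar> \<le> e * Hnorm ?\<sigma> h" .
      qed
    next
      fix h :: "real \<Rightarrow> real^'n" assume arc: "\<forall>u. norm (vector_derivative \<gamma> (at u)) = 1" and h: "Hsob ?\<sigma> h"
      have p: "periodic1 \<gamma>" "periodic1 h" "1 < \<alpha>" using H h \<alpha> by (auto simp: Hsob_def)
      show "((\<lambda>\<epsilon>. Ieps \<alpha> \<gamma> h \<epsilon>) \<longlongrightarrow> DE \<gamma> h) (at_right 0)"
        unfolding DE_def
        by (rule Ieps_tendsto[OF n F(1) p(1) Hsob_C1(2)[OF \<alpha> h] Hsob_C1(1)[OF \<alpha> h] p(2,3) _ wi[OF h]]) (use arc in simp)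
    qed
  qed
  show ?thesis
  proof (intro conjI)
    show "\<exists>DE. \<forall>\<gamma>. admissible ?\<sigma> \<gamma> \<longrightarrow> ?P DE \<gamma>"
    proof (rule exI[of _ DE], intro allI impI)
      fix \<gamma> :: "real \<Rightarrow> real^'n" assume "admissible ?\<sigma> \<gamma>"
      from main[OF this, THEN conjunct2, THEN conjunct2] show "?P DE \<gamma>" .
    qed
  qed (intro allI impI, drule main, elim conjE, assumption)+
qed

end
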